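(* Let $\Omega\subset\mathbb R^n$ be a smooth bounded domain, let $p\ge1$ be an integer, and for $i=1,\dots,p$ let $a_i\in\Omega$, $m_i\ge0$, $b_i>0$. Let $$V(x)=\sum_{i=1}^p\frac{b_i}{|x-a_i|^{m_i}},\qquad K=\{a_i:\ m_i\ge2\}.$$ Let $w\in L^1(\Omega;V)\cap L^1_0(\Omega)$ be such that for all $\varphi\in C^2_c(\Omega\setminus K)$ $$\int_\Omega w(-\Delta\varphi+V\varphi)\,dx=0 .$$ Then $w\equiv0$ (a.e. in $\Omega$).
   Context: With $\delta(x)=\mathrm{dist}(x;\partial\Omega)$: $$L^1(\Omega;V)=\Big\{g:\Omega\to\mathbb R\text{ measurable}:\ \int_\Omega|g|V\,dx<+\infty\Big\},\qquad L^1_0(\Omega)=\Big\{g\in L^1(\Omega):\ \lim_{\varepsilon\to0}\frac1\varepsilon\int_{\{x\in\Omega:\,\delta(x)\le\varepsilon\}}|g(x)|\,dx=0\Big\}.$$ *)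

theory Defs
  imports "HOL-Analysis.Analysis"
begin

text \<open>\<open>Ck_on k S f\<close>: \<open>f\<close> is of class \<open>C\<^sup>k\<close> on the \<^emph>\<open>open\<close> set \<open>S\<close>.\<close>

primrec Ck_on :: "nat \<Rightarrow> 'a::euclidean_space set \<Rightarrow> ('a \<Rightarrow> real) \<Rightarrow> bool" where
  "Ck_on 0 S f \<longleftrightarrow> continuous_on S f"
| "Ck_on (Suc k) S f \<longleftrightarrow>
     (\<forall>x\<in>S. f differentiable (at x)) \<and>
     (\<forall>e\<in>Basis. Ck_on k S (\<lambda>x. frechet_derivative f (at x) e))"

definition Cinf_on :: "'a::euclidean_space set \<Rightarrow> ('a \<Rightarrow> real) \<Rightarrow> bool" where
  "Cinf_on S f \<longleftrightarrow> (\<forall>k. Ck_on k S f)"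

definition laplacian :: "('a::euclidean_space \<Rightarrow> real) \<Rightarrow> 'a \<Rightarrow> real" where
  "laplacian f x =
     (\<Sum>e\<in>Basis. frechet_derivative (\<lambda>y. frechet_derivative f (at y) e) (at x) e)"

text \<open>Elements of \<open>C\<^sup>k\<^sub>c(U)\<close> are represented by their extension by zero to the whole space.\<close>

definition Ck_compact_support :: "nat \<Rightarrow> 'a::euclidean_space set \<Rightarrow> ('a \<Rightarrow> real) set" where
  "Ck_compact_support k U =
     {f. Ck_on k U f \<and> compact (closure {x. f x \<noteq> 0}) \<and> closure {x. f x \<noteq> 0} \<subseteq> U}"

text \<open>A bounded domain with \<open>C\<^sup>\<infinity>\<close> boundary: near each boundary point the domain is, in suitable
  orthonormal coordinates, the region above the graph of a smooth function of \<open>n - 1\<close> variables.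
  Here \<open>\<nu>\<close> is the direction of the last coordinate axis, and the remaining \<open>n - 1\<close> coordinates of
  \<open>x\<close> are encoded by the orthogonal projection \<open>x - (x \<bullet> \<nu>) \<nu>\<close>; a smooth function on the hyperplane
  orthogonal to \<open>\<nu>\<close> is the same as the restriction of a smooth function on the whole space.\<close>

definition smooth_bounded_domain :: "'a::euclidean_space set \<Rightarrow> bool" where
  "smooth_bounded_domain \<Omega> \<longleftrightarrow>
     open \<Omega> \<and> connected \<Omega> \<and> \<Omega> \<noteq> {} \<and> bounded \<Omega> \<and>
     (\<forall>x0\<in>frontier \<Omega>. \<exists>r>0. \<exists>\<nu> \<gamma>. norm \<nu> = 1 \<and> Cinf_on UNIV \<gamma> \<and>
        \<Omega> \<inter> ball x0 r = {x \<in> ball x0 r. x \<bullet> \<nu> > \<gamma> (x - (x \<bullet> \<nu>) *\<^sub>R \<nu>)})"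

text \<open>The weight \<open>V\<close> is meant to be nonnegative. Functions are considered on \<open>\<Omega>\<close> only; their values
  elsewhere are irrelevant.\<close>

definition L1_weighted :: "'a::euclidean_space set \<Rightarrow> ('a \<Rightarrow> real) \<Rightarrow> ('a \<Rightarrow> real) set" where
  "L1_weighted \<Omega> V =
     {g. g \<in> borel_measurable (lebesgue_on \<Omega>) \<and>
         (\<integral>\<^sup>+x. ennreal (\<bar>g x\<bar> * V x) \<partial>(lebesgue_on \<Omega>)) < \<infinity>}"

definition L1_0 :: "'a::euclidean_space set \<Rightarrow> ('a \<Rightarrow> real) set" where
  "L1_0 \<Omega> =
     {g. integrable (lebesgue_on \<Omega>) g \<and>
         ((\<lambda>\<epsilon>. 1 / \<epsilon> *
             integral\<^sup>L (lebesgue_on {x \<in> \<Omega>. infdist x (frontier \<Omega>) \<le> \<epsilon>}) (\<lambda>x. \<bar>g x\<bar>))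
           \<longlongrightarrow> 0) (at_right 0)}"

text \<open>At the points \<open>a i\<close> (a null set) the value is the arbitrary one coming from
  \<open>0 powr m = 0\<close> and division by zero.\<close>

definition potential ::
  "nat \<Rightarrow> (nat \<Rightarrow> 'a::euclidean_space) \<Rightarrow> (nat \<Rightarrow> real) \<Rightarrow> (nat \<Rightarrow> real) \<Rightarrow> 'a \<Rightarrow> real" where
  "potential p a m b x = (\<Sum>i=1..p. b i / norm (x - a i) powr m i)"

definition very_singular_points ::
  "nat \<Rightarrow> (nat \<Rightarrow> 'a::euclidean_space) \<Rightarrow> (nat \<Rightarrow> real) \<Rightarrow> 'a set" where
  "very_singular_points p a m = {a i | i. i \<in> {1..p} \<and> m i \<ge> 2}"

end

theory Submission
  imports Defs
begin

text \<open>
  Write \<open>K\<close> for the set of very singular points and \<open>\<delta>\<close> for the distance to the complement of \<open>\<Omega>\<close>.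
  The argument has three parts: the equation holds across \<open>K\<close>, hence \<open>|w|\<close> is subharmonic, and a
  subharmonic function with the boundary decay of \<open>L\<^sup>1\<^sub>0\<close> cannot be positive.

  \<^emph>\<open>Removing the singular points\<close> (\<open>remove_singularities\<close>). Let \<open>\<chi>\<^sub>\<tau>\<close> be a cutoff that vanishes near
  \<open>K\<close> and equals 1 at distance \<open>\<tau>\<close> from it. The error terms in \<open>\<Delta>(\<phi> \<chi>\<^sub>\<tau>)\<close> are of size \<open>1/\<tau>\<^sup>2\<close> and
  live where some \<open>|x - a\<^sub>i| < \<tau>\<close> with \<open>m\<^sub>i \<ge> 2\<close>, so they are bounded by a multiple of \<open>V\<close>. As
  \<open>w V\<close> is integrable they disappear in the limit. This is applied only to translates of one bump:
  with \<open>\<rho>\<^sub>\<eta>\<close> a \<open>C\<^sup>2\<close> mollifier, \<open>w * \<Delta>\<rho>\<^sub>\<eta> = (V w) * \<rho>\<^sub>\<eta>\<close> at distance more than \<open>\<eta>\<close> from the boundary.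

  \<^emph>\<open>Kato's inequality\<close> (\<open>kato_inequality\<close>). Let \<open>\<Delta>\<^sub>t\<close> be the discrete Laplacian with step \<open>t\<close>
  along the coordinate axes. Since \<open>|b| - |a| \<ge> sgn a (b - a)\<close>, every function satisfies
  \<open>\<Delta>\<^sub>t |W| \<ge> sgn W \<Delta>\<^sub>t W\<close> pointwise, and \<open>\<Delta>\<^sub>t\<close> is symmetric. For \<open>W = w * \<rho>\<^sub>\<eta>\<close> and a nonnegative
  \<open>\<zeta> = f * \<rho>\<^sub>\<epsilon>\<close> supported inside \<open>\<Omega>\<close> one lets \<open>t\<close> tend to 0, where \<open>\<Delta>\<^sub>t\<close> only has to converge on the
  explicit mollifier, and then \<open>\<eta>\<close> tend to 0. The result is
  \<open>\<integral> |w| (f * \<Delta>\<rho>\<^sub>\<epsilon>) \<ge> \<integral> \<zeta> V |w| \<ge> 0\<close>. Working with differences avoids weak derivatives, integration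
  by parts and any smoothness of \<open>f\<close>.

  \<^emph>\<open>The barrier\<close> (\<open>exterior_ball_domain\<close>). A smooth bounded domain has exterior balls of a fixed radius
  \<open>r\<close> at all boundary points (\<open>smooth_bounded_domain_exterior_ball\<close>). If \<open>y\<close> is the centre of the ball
  touching at the boundary point nearest to \<open>x\<close>, then \<open>r + \<delta>(x) = |x - y|\<close>, while
  \<open>r + \<delta>(x') \<le> |x' - y|\<close> for all \<open>x'\<close> in \<open>\<Omega>\<close>. So \<open>exp(- l (r + \<delta>)\<^sup>2)\<close> touches from above, at \<open>x\<close>, a
  Gaussian centred at \<open>y\<close>, and that Gaussian is strictly subharmonic at distance \<open>r\<close> and beyond if
  \<open>l r\<^sup>2\<close> is the dimension. Hence \<open>- exp(- l (r + \<delta>)\<^sup>2)\<close> is uniformly superharmonic in \<open>\<Omega>\<close>, and it is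
  Lipschitz. Take for \<open>f\<close> its excess over its value at \<open>\<delta> = 2\<epsilon>\<close>. After mollification at scale
  \<open>\<epsilon>\<close> the Laplacian is at most a negative constant where \<open>\<delta> > 4\<epsilon>\<close>, and of size \<open>1/\<epsilon>\<close> at most
  elsewhere. Kato's inequality becomes
  \<open>\<integral>\<^bsub>\<delta> > 4\<epsilon>\<^esub> |w| \<le> (C/\<epsilon>) \<integral>\<^bsub>\<delta> \<le> 4\<epsilon>\<^esub> |w|\<close>, whose right side tends to 0 by the definition of
  \<open>L\<^sup>1\<^sub>0\<close> (\<open>kato_uniqueness\<close>).
\<close>

section \<open>Twice differentiable functions and second differences\<close>

text \<open>Derivatives are carried along explicitly: \<open>D x v\<close> is the derivative of \<open>f\<close> at \<open>x\<close> in
  direction \<open>v\<close>, and \<open>H x e v\<close> the derivative of \<open>D _ e\<close> in direction \<open>v\<close>. The calculus rules below then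
  yield the concrete bounds on first and second derivatives that the cutoff argument needs.\<close>

definition c2_with :: "('a::euclidean_space \<Rightarrow> real) \<Rightarrow> ('a \<Rightarrow> 'a \<Rightarrow> real) \<Rightarrow> ('a \<Rightarrow> 'a \<Rightarrow> 'a \<Rightarrow> real) \<Rightarrow> bool" where
  "c2_with f D H \<longleftrightarrow>
     (\<forall>x. (f has_derivative D x) (at x)) \<and>
     (\<forall>x e. ((\<lambda>y. D y e) has_derivative H x e) (at x)) \<and>
     (\<forall>e v. continuous_on UNIV (\<lambda>x. H x e v))"

lemma c2_with_D: "c2_with f D H \<Longrightarrow> (f has_derivative D x) (at x)"
  and c2_with_H: "c2_with f D H \<Longrightarrow> ((\<lambda>y. D y e) has_derivative H x e) (at x)"
  and c2_with_cont: "c2_with f D H \<Longrightarrow> continuous_on UNIV (\<lambda>x. H x e v)"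
  by (auto simp: c2_with_def)

lemma c2_with_frechet:
  assumes "c2_with f D H"
  shows "(\<lambda>y. frechet_derivative f (at y) e) = (\<lambda>y. D y e)"
    and "frechet_derivative (\<lambda>y. D y e) (at x) = H x e"
  using frechet_derivative_at[OF c2_with_D[OF assms]] frechet_derivative_at[OF c2_with_H[OF assms]]
  by metis+

lemma c2_with_Ck_on:
  assumes "c2_with f D H"
  shows "Ck_on 2 U f"
  using c2_with_D[OF assms] c2_with_H[OF assms] continuous_on_subset[OF c2_with_cont[OF assms] subset_UNIV]
  by (auto simp: numeral_2_eq_2 c2_with_frechet[OF assms] differentiable_def)

lemma c2_with_laplacian:
  assumes "c2_with f D H"
  shows "laplacian f x = (\<Sum>e\<in>Basis. H x e e)"
  by (simp add: laplacian_def c2_with_frechet[OF assms])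

lemma c2_with_continuous:
  assumes "c2_with f D H"
  shows "continuous_on UNIV f" "continuous_on UNIV (\<lambda>y. D y e)"
  using has_derivative_continuous[OF c2_with_D[OF assms]] has_derivative_continuous[OF c2_with_H[OF assms]]
  by (simp_all add: continuous_on_eq_continuous_at)

lemma c2_with_mult:
  assumes f: "c2_with f D H" and g: "c2_with g D' H'"
  shows "c2_with (\<lambda>x. f x * g x) (\<lambda>x v. f x * D' x v + D x v * g x)
     (\<lambda>x e v. f x * H' x e v + D x v * D' x e + (D x e * D' x v + H x e v * g x))"
  unfolding c2_with_def
proof (intro conjI allI)
  fix x e v
  show "((\<lambda>x. f x * g x) has_derivative (\<lambda>v. f x * D' x v + D x v * g x)) (at x)"
    by (rule has_derivative_mult[OF c2_with_D[OF f] c2_with_D[OF g]])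
  show "((\<lambda>x. f x * D' x e + D x e * g x) has_derivative
     (\<lambda>v. f x * H' x e v + D x v * D' x e + (D x e * D' x v + H x e v * g x))) (at x)"
    by (intro has_derivative_add has_derivative_mult c2_with_D[OF f] c2_with_D[OF g] c2_with_H[OF f] c2_with_H[OF g])
  show "continuous_on UNIV (\<lambda>x. f x * H' x e v + D x v * D' x e + (D x e * D' x v + H x e v * g x))"
    by (intro continuous_intros c2_with_continuous[OF f] c2_with_continuous[OF g]
        c2_with_cont[OF f] c2_with_cont[OF g])
qed

lemma c2_with_compose:
  assumes f: "c2_with f D H"
    and h: "\<And>s::real. (h has_real_derivative h' s) (at s)" "\<And>s. (h' has_real_derivative h'' s) (at s)"
      "continuous_on UNIV h''"
  shows "c2_with (\<lambda>x. h (f x)) (\<lambda>x v. h' (f x) * D x v)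
     (\<lambda>x e v. h' (f x) * H x e v + h'' (f x) * D x v * D x e)"
  unfolding c2_with_def
proof (intro conjI allI)
  fix x e v
  note h1 = h(1)[THEN DERIV_compose_FDERIV] h(2)[THEN DERIV_compose_FDERIV]
  show "((\<lambda>x. h (f x)) has_derivative (\<lambda>v. h' (f x) * D x v)) (at x)"
    by (rule has_derivative_eq_rhs[OF h1(1)[OF c2_with_D[OF f]]]) (simp add: mult.commute)
  have "((\<lambda>x. h' (f x)) has_derivative (\<lambda>v. h'' (f x) * D x v)) (at x)"
    by (rule has_derivative_eq_rhs[OF h1(2)[OF c2_with_D[OF f]]]) (simp add: mult.commute)
  then show "((\<lambda>x. h' (f x) * D x e) has_derivative
     (\<lambda>v. h' (f x) * H x e v + h'' (f x) * D x v * D x e)) (at x)"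
    by (rule has_derivative_mult[OF _ c2_with_H[OF f]])
  have "continuous_on UNIV h'"
    using DERIV_continuous[OF h(2)] by (simp add: continuous_on_eq_continuous_at)
  then have "continuous_on UNIV (\<lambda>x. h' (f x))"
    by (rule continuous_on_compose2[OF _ c2_with_continuous(1)[OF f]]) simp
  moreover have "continuous_on UNIV (\<lambda>x. h'' (f x))"
    by (rule continuous_on_compose2[OF h(3) c2_with_continuous(1)[OF f]]) simp
  ultimately show "continuous_on UNIV (\<lambda>x. h' (f x) * H x e v + h'' (f x) * D x v * D x e)"
    by (intro continuous_on_add continuous_on_mult c2_with_continuous(2)[OF f] c2_with_cont[OF f])
qed

lemma c2_with_sum:
  assumes "\<And>i. i \<in> I \<Longrightarrow> c2_with (f i) (D i) (H i)"
  shows "c2_with (\<lambda>x. \<Sum>i\<in>I. f i x) (\<lambda>x v. \<Sum>i\<in>I. D i x v) (\<lambda>x e v. \<Sum>i\<in>I. H i x e v)"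
  unfolding c2_with_def
proof (intro conjI allI)
  show "((\<lambda>x. \<Sum>i\<in>I. f i x) has_derivative (\<lambda>v. \<Sum>i\<in>I. D i x v)) (at x)" for x
    by (intro has_derivative_sum c2_with_D[OF assms])
  show "((\<lambda>x. \<Sum>i\<in>I. D i x e) has_derivative (\<lambda>v. \<Sum>i\<in>I. H i x e v)) (at x)" for x e
    by (intro has_derivative_sum c2_with_H[OF assms])
  show "continuous_on UNIV (\<lambda>x. \<Sum>i\<in>I. H i x e v)" for e v
    by (intro continuous_on_sum c2_with_cont[OF assms])
qed

lemma c2_with_cmult:
  assumes "c2_with f D H"
  shows "c2_with (\<lambda>x. c * f x) (\<lambda>x v. c * D x v) (\<lambda>x e v. c * H x e v)"
  unfolding c2_with_def
  by (intro conjI allI has_derivative_mult_right continuous_on_mult_left c2_with_D[OF assms]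
      c2_with_H[OF assms] c2_with_cont[OF assms])

lemma c2_with_scaled_square:
  fixes c :: "'a::euclidean_space"
  shows "c2_with (\<lambda>y. (y - c) \<bullet> (y - c) / \<eta>\<^sup>2) (\<lambda>x v. 2 * ((x - c) \<bullet> v) / \<eta>\<^sup>2) (\<lambda>x e v. 2 * (v \<bullet> e) / \<eta>\<^sup>2)"
  unfolding c2_with_def
  by (auto intro!: derivative_eq_intros simp: inner_commute algebra_simps add_divide_distrib diff_divide_distrib divide_inverse)

definition sdiff :: "real \<Rightarrow> 'a::euclidean_space \<Rightarrow> ('a \<Rightarrow> real) \<Rightarrow> 'a \<Rightarrow> real" where
  "sdiff t e f x = f (x + t *\<^sub>R e) + f (x - t *\<^sub>R e) - 2 * f x"

definition dlap :: "real \<Rightarrow> ('a::euclidean_space \<Rightarrow> real) \<Rightarrow> 'a \<Rightarrow> real" where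
  "dlap t f x = (\<Sum>e\<in>Basis. sdiff t e f x / t\<^sup>2)"

text \<open>Taylor's formula for the even part: constant and linear terms cancel, so the second derivative at
  a pair of symmetric intermediate points is all that remains.\<close>

lemma c2_with_sdiff:
  assumes f: "c2_with f D H" and t: "t > 0"
  obtains \<xi> where "0 < \<xi>" "\<xi> < t"
    "sdiff t e f x = (H (x + \<xi> *\<^sub>R e) e e + H (x - \<xi> *\<^sub>R e) e e) / 2 * t\<^sup>2"
proof -
  define F where "F = (\<lambda>s. f (x + s *\<^sub>R e) + f (x - s *\<^sub>R e) - 2 * f x)"
  define F1 where "F1 = (\<lambda>s. D (x + s *\<^sub>R e) e - D (x - s *\<^sub>R e) e)"
  define F2 where "F2 = (\<lambda>s. H (x + s *\<^sub>R e) e e + H (x - s *\<^sub>R e) e e)"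
  have lin: "D y (- v) = - D y v" "D y (c *\<^sub>R v) = c * D y v" "H y e (c *\<^sub>R v) = c * H y e v" "H y e (- v) = - H y e v" for y c v
    using has_derivative_linear[OF c2_with_D[OF f]] has_derivative_linear[OF c2_with_H[OF f]]
    by (simp_all add: linear_cmul linear_neg)
  have p: "((\<lambda>s::real. x + s *\<^sub>R e) has_derivative (\<lambda>s. s *\<^sub>R e)) (at s)"
    "((\<lambda>s::real. x - s *\<^sub>R e) has_derivative (\<lambda>s. - (s *\<^sub>R e))) (at s)" for s
    by (auto intro!: derivative_eq_intros)
  have 1: "(F has_real_derivative F1 s) (at s)" for s
    unfolding F_def has_field_derivative_def
    by (rule has_derivative_eq_rhs)
       (auto intro!: derivative_eq_intros has_derivative_compose[OF p(1) c2_with_D[OF f]]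
         has_derivative_compose[OF p(2) c2_with_D[OF f]] simp: lin F1_def algebra_simps)
  have 2: "(F1 has_real_derivative F2 s) (at s)" for s
    unfolding F1_def has_field_derivative_def
    by (rule has_derivative_eq_rhs)
       (auto intro!: derivative_eq_intros has_derivative_compose[OF p(1) c2_with_H[OF f]]
         has_derivative_compose[OF p(2) c2_with_H[OF f]] simp: lin F2_def algebra_simps)
  define diff where "diff = (\<lambda>n::nat. if n = 0 then F else if n = 1 then F1 else F2)"
  have "\<exists>\<xi>>0. \<xi> < t \<and> F t = (\<Sum>m<2. diff m 0 / fact m * t ^ m) + diff 2 \<xi> / fact 2 * t ^ 2"
    by (rule Maclaurin) (use t 1 2 in \<open>auto simp: diff_def less_2_cases_iff\<close>)
  then obtain \<xi> where \<xi>: "\<xi>>0" "\<xi> < t" "F t = (\<Sum>m<2. diff m 0 / fact m * t ^ m) + diff 2 \<xi> / fact 2 * t ^ 2" by blast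
  moreover have "F 0 = 0" "F1 0 = 0" by (auto simp: F_def F1_def)
  ultimately have "F t = F2 \<xi> / 2 * t\<^sup>2"
    by (simp add: numeral_2_eq_2 diff_def)
  then show ?thesis using \<xi>(1,2) by (intro that[of \<xi>]) (auto simp: sdiff_def F_def F2_def)
qed

lemma sdiff_bound:
  assumes f: "c2_with f D H" and B: "\<And>z. \<bar>H z e e\<bar> \<le> B"
  shows "\<bar>sdiff t e f x / t\<^sup>2\<bar> \<le> B"
proof -
  have B0: "B \<ge> 0" using B[of 0] by linarith
  have pos: "\<bar>sdiff t e f x / t\<^sup>2\<bar> \<le> B" if t: "t > 0" for t
  proof -
    obtain \<xi> where "sdiff t e f x = (H (x + \<xi> *\<^sub>R e) e e + H (x - \<xi> *\<^sub>R e) e e) / 2 * t\<^sup>2"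
      using c2_with_sdiff[OF f t] by metis
    then have eq: "sdiff t e f x / t\<^sup>2 = (H (x + \<xi> *\<^sub>R e) e e + H (x - \<xi> *\<^sub>R e) e e) / 2"
      using t by (metis nonzero_mult_div_cancel_right not_less_iff_gr_or_eq power_not_zero)
    show ?thesis unfolding eq using B[of "x + \<xi> *\<^sub>R e"] B[of "x - \<xi> *\<^sub>R e"] by simp
  qed
  have sym: "sdiff t e f x = sdiff (- t) e f x" by (simp add: sdiff_def)
  show ?thesis
    using pos[of t] pos[of "-t"] B0 sym by (cases t "0::real" rule: linorder_cases) auto
qed

lemma sdiff_tendsto:
  assumes f: "c2_with f D H" and t: "\<And>j. t j > 0" "t \<longlonglongrightarrow> 0"
  shows "(\<lambda>j::nat. sdiff (t j) e f x / (t j)\<^sup>2) \<longlonglongrightarrow> H x e e"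
proof -
  have "\<exists>\<xi>. 0 < \<xi> \<and> \<xi> < t j \<and>
     sdiff (t j) e f x / (t j)\<^sup>2 = (H (x + \<xi> *\<^sub>R e) e e + H (x - \<xi> *\<^sub>R e) e e) / 2" for j
    using c2_with_sdiff[OF f t(1)[of j], of e x] t(1)[of j] 
    by (metis nonzero_mult_div_cancel_right not_less_iff_gr_or_eq power_not_zero)
  then obtain \<xi> where \<xi>: "\<And>j. 0 < \<xi> j" "\<And>j. \<xi> j < t j"
     "\<And>j. sdiff (t j) e f x / (t j)\<^sup>2 = (H (x + \<xi> j *\<^sub>R e) e e + H (x - \<xi> j *\<^sub>R e) e e) / 2" by metis
  have "\<xi> \<longlonglongrightarrow> 0"
    by (rule tendsto_sandwich[OF _ _ tendsto_const t(2)]) (use \<xi>(1,2) in \<open>auto intro: always_eventually less_imp_le\<close>)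
  have iso: "isCont (\<lambda>y. H y e e) x"
    using c2_with_cont[OF f, of e e] by (simp add: continuous_on_eq_continuous_at)
  have "(\<lambda>j. H (x + \<xi> j *\<^sub>R e) e e) \<longlonglongrightarrow> H x e e"
    by (rule isCont_tendsto_compose[OF iso]) (use \<open>\<xi> \<longlonglongrightarrow> 0\<close> in \<open>auto intro!: tendsto_eq_intros\<close>)
  moreover have "(\<lambda>j. H (x - \<xi> j *\<^sub>R e) e e) \<longlonglongrightarrow> H x e e"
    by (rule isCont_tendsto_compose[OF iso]) (use \<open>\<xi> \<longlonglongrightarrow> 0\<close> in \<open>auto intro!: tendsto_eq_intros\<close>)
  ultimately show ?thesis unfolding \<xi>(3) by (auto intro!: tendsto_eq_intros)
qed

text \<open>At the kink the difference quotient is of order \<open>h\<close> to the power \<open>k + 1\<close>; this is what makes the truncated cubic below twice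
  continuously differentiable.\<close>

lemma max_power_deriv:
  "((\<lambda>y::real. max 0 y ^ Suc (Suc k)) has_real_derivative real (Suc (Suc k)) * max 0 y ^ Suc k) (at y)"
proof (cases y "0::real" rule: linorder_cases)
  case less
  have "((\<lambda>y::real. 0) has_real_derivative 0) (at y)" by simp
  then have "((\<lambda>y::real. max 0 y ^ Suc (Suc k)) has_real_derivative 0) (at y)"
    by (rule DERIV_cong_ev[OF refl _ refl, THEN iffD1, rotated])
       (use less in \<open>auto intro!: eventually_mono[OF order_tendstoD(2)[OF tendsto_ident_at less]] simp: eventually_nhds_conv_at\<close>)
  then show ?thesis using less by simp
next
  case equal
  have "((\<lambda>h::real. max 0 h ^ Suc (Suc k) / h) \<longlongrightarrow> 0) (at 0)"
  proof (rule Lim_null_comparison)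
    show "\<forall>\<^sub>F h in at 0. norm (max 0 h ^ Suc (Suc k) / h) \<le> \<bar>h\<bar> ^ Suc k"
      by (intro always_eventually allI) (auto simp: max_def abs_mult power_abs intro!: mult_nonpos_nonneg)
    show "((\<lambda>h::real. \<bar>h\<bar> ^ Suc k) \<longlongrightarrow> 0) (at 0)"
      by (auto intro!: tendsto_eq_intros)
  qed
  then show ?thesis using equal by (simp add: DERIV_def)
next
  case greater
  have "((\<lambda>y::real. y ^ Suc (Suc k)) has_real_derivative (Suc (Suc k)) * y ^ Suc k) (at y)"
    by (rule derivative_eq_intros refl)+ simp
  then have "((\<lambda>y::real. max 0 y ^ Suc (Suc k)) has_real_derivative (Suc (Suc k)) * y ^ Suc k) (at y)"
    by (rule DERIV_cong_ev[OF refl _ refl, THEN iffD1, rotated])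
       (use greater in \<open>auto intro!: eventually_mono[OF order_tendstoD(1)[OF tendsto_ident_at greater]] simp: eventually_nhds_conv_at\<close>)
  then show ?thesis using greater by simp
qed

text \<open>The simplest profile that is \<open>C\<^sup>2\<close> on the line, positive on \<open>[0, 1)\<close> and zero beyond. Composed with a
  scaled squared norm it gives the mollifier, composed with itself the cutoff.\<close>

definition bump :: "real \<Rightarrow> real" where "bump s = max 0 (1 - s) ^ 3"
definition bump1 :: "real \<Rightarrow> real" where "bump1 s = - 3 * max 0 (1 - s) ^ 2"
definition bump2 :: "real \<Rightarrow> real" where "bump2 s = 6 * max 0 (1 - s)"

lemma bump_deriv: "(bump has_real_derivative bump1 s) (at s)"
  unfolding bump_def[abs_def]
  by (rule DERIV_cong[OF DERIV_chain'[where g = "\<lambda>y. max 0 y ^ 3" and f = "\<lambda>s. 1 - s"]])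
    (use max_power_deriv[of 1 "1 - s"] in \<open>auto intro!: derivative_eq_intros simp: bump1_def numeral_eq_Suc simp del: power_Suc\<close>)

lemma bump1_deriv: "(bump1 has_real_derivative bump2 s) (at s)"
proof -
  have "((\<lambda>s. max 0 (1 - s) ^ 2) has_real_derivative - (2 * max 0 (1 - s))) (at s)"
    by (rule DERIV_cong[OF DERIV_chain'[where g = "\<lambda>y. max 0 y ^ 2" and f = "\<lambda>s. 1 - s"]])
    (use max_power_deriv[of 0 "1 - s"] in \<open>auto intro!: derivative_eq_intros simp: numeral_eq_Suc simp del: power_Suc\<close>)
  from DERIV_cmult[OF this, of "-3"] show ?thesis by (simp add: bump1_def[abs_def] bump2_def)
qed

lemma bump2_cont: "continuous_on UNIV bump2"
  unfolding bump2_def by (intro continuous_intros)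

lemma bump_bounds:
  assumes "s \<ge> 0" shows "0 \<le> bump s" "bump s \<le> 1" "\<bar>bump1 s\<bar> \<le> 3" "\<bar>bump2 s\<bar> \<le> 6"
  using assms by (auto simp: bump_def bump1_def bump2_def max_def power_le_one)

lemma bump_zero: "s \<ge> 1 \<Longrightarrow> bump s = 0 \<and> bump1 s = 0 \<and> bump2 s = 0"
  by (auto simp: bump_def bump1_def bump2_def)

lemma bump_at_0 [simp]: "bump 0 = 1" by (simp add: bump_def)

lemmas c2_with_bump = c2_with_compose[OF _ bump_deriv bump1_deriv bump2_cont]

section \<open>Mollifiers, cutoffs and the removal of the singular points\<close>

text \<open>A radial bump of radius \<open>\<eta>\<close> with its gradient, Hessian and Laplacian. It is not normalised, since in
  the weak equation only the support and the scaling of the bounds matter; the total mass is divided out where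
  convergence of mollifications is needed.\<close>

definition moll :: "real \<Rightarrow> 'a::euclidean_space \<Rightarrow> real" where
  "moll \<eta> z = bump (z \<bullet> z / \<eta>\<^sup>2)"
definition dmoll :: "real \<Rightarrow> 'a::euclidean_space \<Rightarrow> 'a \<Rightarrow> real" where
  "dmoll \<eta> z v = bump1 (z \<bullet> z / \<eta>\<^sup>2) * (2 * (z \<bullet> v) / \<eta>\<^sup>2)"
definition hmoll :: "real \<Rightarrow> 'a::euclidean_space \<Rightarrow> 'a \<Rightarrow> 'a \<Rightarrow> real" where
  "hmoll \<eta> z e v = bump1 (z \<bullet> z / \<eta>\<^sup>2) * (2 * (v \<bullet> e) / \<eta>\<^sup>2) +
     bump2 (z \<bullet> z / \<eta>\<^sup>2) * (2 * (z \<bullet> v) / \<eta>\<^sup>2) * (2 * (z \<bullet> e) / \<eta>\<^sup>2)"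
definition lmoll :: "real \<Rightarrow> 'a::euclidean_space \<Rightarrow> real" where
  "lmoll \<eta> z = (\<Sum>e\<in>Basis. hmoll \<eta> z e e)"

lemma c2_with_moll_shift:
  "c2_with (\<lambda>y. moll \<eta> (y - c)) (\<lambda>y. dmoll \<eta> (y - c)) (\<lambda>y. hmoll \<eta> (y - c))"
  using c2_with_bump[OF c2_with_scaled_square[of c \<eta>]]
  by (simp add: moll_def[abs_def] dmoll_def[abs_def] hmoll_def[abs_def])

lemma c2_with_moll: "c2_with (moll \<eta>) (dmoll \<eta>) (hmoll \<eta>)"
  using c2_with_moll_shift[of \<eta> 0] by simp

lemma moll_bounds: "0 \<le> moll \<eta> z" "moll \<eta> z \<le> 1" "\<bar>moll \<eta> z\<bar> \<le> 1"
  using bump_bounds[of "z \<bullet> z / \<eta>\<^sup>2"] by (auto simp: moll_def)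

lemma moll_even: "moll \<eta> (- z) = moll \<eta> z" "lmoll \<eta> (- z) = lmoll \<eta> z"
  by (auto simp: moll_def lmoll_def hmoll_def)

lemma moll_even': "moll \<eta> (x - y) = moll \<eta> (y - x)" "lmoll \<eta> (x - y) = lmoll \<eta> (y - x)"
  using moll_even[of \<eta> "x - y"] by simp_all

lemma moll_0 [simp]: "moll \<eta> 0 = 1" by (simp add: moll_def)

lemma ratio_ge_1:
  assumes "\<eta> > 0" "norm z \<ge> \<eta>" shows "z \<bullet> z / \<eta>\<^sup>2 \<ge> 1"
  using power_mono[of \<eta> "norm z" 2] assms by (simp add: power2_norm_eq_inner)

lemma moll_outside:
  assumes "\<eta> > 0" "norm z \<ge> \<eta>"
  shows "moll \<eta> z = 0" "dmoll \<eta> z v = 0" "hmoll \<eta> z e v = 0" "lmoll \<eta> z = 0"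
  using bump_zero[OF ratio_ge_1[OF assms]] by (auto simp: moll_def dmoll_def hmoll_def lmoll_def)

lemma inner_ratio_bound:
  assumes "\<eta> > 0" "norm z < \<eta>" "norm e = 1"
  shows "\<bar>2 * (z \<bullet> e) / \<eta>\<^sup>2\<bar> \<le> 2 / \<eta>"
proof -
  have "\<bar>z \<bullet> e\<bar> \<le> norm z * norm e" by (rule Cauchy_Schwarz_ineq2)
  also have "\<dots> \<le> \<eta>" using assms by simp
  finally have "\<bar>z \<bullet> e\<bar> \<le> \<eta>" .
  then have "2 * \<bar>z \<bullet> e\<bar> / \<eta>\<^sup>2 \<le> 2 * \<eta> / \<eta>\<^sup>2" by (intro divide_right_mono) auto
  then show ?thesis using assms by (simp add: abs_mult power2_eq_square)
qed

lemma dmoll_bound: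
  assumes "\<eta> > 0" "norm e = 1"
  shows "\<bar>dmoll \<eta> z e\<bar> \<le> 6 / \<eta>"
proof (cases "norm z < \<eta>")
  case True
  have "\<bar>dmoll \<eta> z e\<bar> \<le> 3 * (2 / \<eta>)"
    unfolding dmoll_def abs_mult
    by (intro mult_mono bump_bounds inner_ratio_bound) (use assms True in auto)
  then show ?thesis by simp
qed (use moll_outside(2)[of \<eta> z e] assms in auto)

lemma hmoll_bound:
  fixes e :: "'a::euclidean_space"
  assumes "\<eta> > 0" "norm e = 1"
  shows "\<bar>hmoll \<eta> z e e\<bar> \<le> 30 / \<eta>\<^sup>2"
proof (cases "norm z < \<eta>")
  case True
  have ee: "e \<bullet> e = 1" using assms by (simp add: norm_eq_1)
  have "\<bar>hmoll \<eta> z e e\<bar> \<le> 3 * (2 / \<eta>\<^sup>2) + 6 * (2 / \<eta>) * (2 / \<eta>)"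
    unfolding hmoll_def
    by (rule order_trans[OF abs_triangle_ineq], unfold abs_mult, intro add_mono mult_mono bump_bounds inner_ratio_bound)
       (use assms True in \<open>auto simp: ee\<close>)
  also have "\<dots> = 30 / \<eta>\<^sup>2" by (simp add: field_simps power2_eq_square)
  finally show ?thesis .
qed (use moll_outside(3)[of \<eta> z e e] assms in auto)

lemma lmoll_bound:
  fixes z :: "'a::euclidean_space"
  assumes "\<eta> > 0" shows "\<bar>lmoll \<eta> z\<bar> \<le> DIM('a) * 30 / \<eta>\<^sup>2"
proof -
  have "\<bar>lmoll \<eta> z\<bar> \<le> (\<Sum>e\<in>(Basis::'a set). 30 / \<eta>\<^sup>2)"
    unfolding lmoll_def by (rule order_trans[OF sum_abs sum_mono[OF hmoll_bound]]) (use assms in auto)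
  then show ?thesis by simp
qed

lemma moll_continuous: "continuous_on UNIV (moll \<eta>)" "continuous_on UNIV (lmoll \<eta>)"
  using c2_with_continuous[OF c2_with_moll] c2_with_cont[OF c2_with_moll]
  by (auto simp: lmoll_def[abs_def] intro!: continuous_intros)

lemma moll_measurable [measurable]: "moll \<eta> \<in> borel_measurable borel" "lmoll \<eta> \<in> borel_measurable borel"
  using moll_continuous by (auto intro: borel_measurable_continuous_onI)

text \<open>Since \<open>bump s\<close> vanishes for \<open>s \<ge> 1\<close>, this function vanishes where the bumps around the points \<open>a i\<close>
  add up to at least \<open>1/2\<close>, which includes a neighbourhood of each \<open>a i\<close>, and it is 1 off their supports. Overlapping supports
  or repeated points do no harm.\<close>

definition cutoff :: "'i set \<Rightarrow> ('i \<Rightarrow> 'a::euclidean_space) \<Rightarrow> real \<Rightarrow> 'a \<Rightarrow> real" where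
  "cutoff J a \<tau> y = bump (2 * (\<Sum>i\<in>J. moll \<tau> (y - a i)))"
definition dcutoff :: "'i set \<Rightarrow> ('i \<Rightarrow> 'a::euclidean_space) \<Rightarrow> real \<Rightarrow> 'a \<Rightarrow> 'a \<Rightarrow> real" where
  "dcutoff J a \<tau> y v = bump1 (2 * (\<Sum>i\<in>J. moll \<tau> (y - a i))) * (2 * (\<Sum>i\<in>J. dmoll \<tau> (y - a i) v))"
definition hcutoff :: "'i set \<Rightarrow> ('i \<Rightarrow> 'a::euclidean_space) \<Rightarrow> real \<Rightarrow> 'a \<Rightarrow> 'a \<Rightarrow> 'a \<Rightarrow> real" where
  "hcutoff J a \<tau> y e v = bump1 (2 * (\<Sum>i\<in>J. moll \<tau> (y - a i))) * (2 * (\<Sum>i\<in>J. hmoll \<tau> (y - a i) e v)) +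
     bump2 (2 * (\<Sum>i\<in>J. moll \<tau> (y - a i))) * (2 * (\<Sum>i\<in>J. dmoll \<tau> (y - a i) v)) * (2 * (\<Sum>i\<in>J. dmoll \<tau> (y - a i) e))"

lemma c2_with_cutoff: "c2_with (cutoff J a \<tau>) (dcutoff J a \<tau>) (hcutoff J a \<tau>)"
  unfolding cutoff_def[abs_def] dcutoff_def[abs_def] hcutoff_def[abs_def]
  by (rule c2_with_bump[OF c2_with_cmult[OF c2_with_sum[OF c2_with_moll_shift]]])

lemma sum_moll_nonneg: "0 \<le> 2 * (\<Sum>i\<in>J. moll \<tau> (y - a i))"
  by (simp add: sum_nonneg moll_bounds)

lemma cutoff_bounds: "0 \<le> cutoff J a \<tau> y" "cutoff J a \<tau> y \<le> 1" "\<bar>cutoff J a \<tau> y\<bar> \<le> 1"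
  using bump_bounds[OF sum_moll_nonneg[of \<tau> y a J]] by (auto simp: cutoff_def)

lemma cutoff_outside:
  assumes "\<tau> > 0" "\<And>i. i \<in> J \<Longrightarrow> norm (y - a i) \<ge> \<tau>"
  shows "cutoff J a \<tau> y = 1" "dcutoff J a \<tau> y v = 0" "hcutoff J a \<tau> y e v = 0"
  using assms by (auto simp: cutoff_def dcutoff_def hcutoff_def moll_outside)

lemma sum_abs_bound:
  fixes f :: "'i \<Rightarrow> real" and B :: real
  assumes "\<And>i. i \<in> J \<Longrightarrow> \<bar>f i\<bar> \<le> B"
  shows "\<bar>2 * (\<Sum>i\<in>J. f i)\<bar> \<le> 2 * (card J * B)"
  using order_trans[OF sum_abs[of f J] sum_bounded_above[of J "\<lambda>i. \<bar>f i\<bar>" B]] assms by simp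

lemma dcutoff_bound:
  fixes y e :: "'a::euclidean_space"
  assumes "\<tau> > 0" "norm e = 1"
  shows "\<bar>dcutoff J a \<tau> y e\<bar> \<le> 3 * (2 * (card J * (6 / \<tau>)))"
proof -
  have "\<bar>2 * (\<Sum>i\<in>J. dmoll \<tau> (y - a i) e)\<bar> \<le> 2 * (card J * (6 / \<tau>))"
    by (rule sum_abs_bound) (rule dmoll_bound[OF assms])
  then show ?thesis
    unfolding dcutoff_def abs_mult[of "bump1 _"]
    by (intro mult_mono bump_bounds(3) sum_moll_nonneg) auto
qed

lemma hcutoff_bound:
  fixes y e :: "'a::euclidean_space"
  assumes "\<tau> > 0" "norm e = 1"
  shows "\<bar>hcutoff J a \<tau> y e e\<bar> \<le> 3 * (2 * (card J * (30 / \<tau>\<^sup>2))) + 6 * (2 * (card J * (6 / \<tau>))) * (2 * (card J * (6 / \<tau>)))"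
proof -
  have 1: "\<bar>2 * (\<Sum>i\<in>J. dmoll \<tau> (y - a i) e)\<bar> \<le> 2 * (card J * (6 / \<tau>))"
    by (rule sum_abs_bound) (rule dmoll_bound[OF assms])
  have 2: "\<bar>2 * (\<Sum>i\<in>J. hmoll \<tau> (y - a i) e e)\<bar> \<le> 2 * (card J * (30 / \<tau>\<^sup>2))"
    by (rule sum_abs_bound) (rule hmoll_bound[OF assms])
  have "\<bar>bump1 s * u + bump2 s * v * v\<bar> \<le> 3 * U + 6 * V * V"
    if "0 \<le> s" "\<bar>u\<bar> \<le> U" "\<bar>v\<bar> \<le> V" for s u v U V
    by (rule order_trans[OF abs_triangle_ineq], unfold abs_mult, intro add_mono mult_mono bump_bounds)
       (use that in auto)
  from this[OF sum_moll_nonneg 2 1] show ?thesis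
    unfolding hcutoff_def .
qed

lemma c2_with_laplacian_measurable:
  assumes "c2_with f D H" shows "laplacian f \<in> borel_measurable borel" "f \<in> borel_measurable borel"
  using c2_with_cont[OF assms] c2_with_continuous(1)[OF assms]
  by (auto simp: c2_with_laplacian[OF assms, abs_def] intro!: borel_measurable_continuous_onI continuous_intros)

definition cut_moll :: "'i set \<Rightarrow> ('i \<Rightarrow> 'a::euclidean_space) \<Rightarrow> real \<Rightarrow> 'a \<Rightarrow> real \<Rightarrow> 'a \<Rightarrow> real" where
  "cut_moll J a \<eta> x \<tau> y = moll \<eta> (y - x) * cutoff J a \<tau> y"

lemma cut_moll_c2:
  obtains D H where "c2_with (cut_moll J a \<eta> x \<tau>) D H"
  using c2_with_mult[OF c2_with_moll_shift[of \<eta> x] c2_with_cutoff[of J a \<tau>]] that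
  unfolding cut_moll_def[abs_def] by blast

lemma cut_moll_laplacian:
  "laplacian (cut_moll J a \<eta> x \<tau>) y = (\<Sum>e\<in>Basis. moll \<eta> (y - x) * hcutoff J a \<tau> y e e + dmoll \<eta> (y - x) e * dcutoff J a \<tau> y e +
     (dmoll \<eta> (y - x) e * dcutoff J a \<tau> y e + hmoll \<eta> (y - x) e e * cutoff J a \<tau> y))"
  unfolding cut_moll_def[abs_def]
  by (subst c2_with_laplacian[OF c2_with_mult[OF c2_with_moll_shift[of \<eta> x] c2_with_cutoff[of J a \<tau>]]]) simp

lemma cut_moll_test:
  fixes a :: "'i \<Rightarrow> 'a::euclidean_space"
  assumes "finite J" "cball x \<eta> \<subseteq> \<Omega>" "\<eta> > 0" "\<tau> > 0"
  shows "cut_moll J a \<eta> x \<tau> \<in> Ck_compact_support 2 (\<Omega> - a ` J)"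
proof -
  let ?S = "\<lambda>y. 2 * (\<Sum>i\<in>J. moll \<tau> (y - a i))"
  let ?C = "cball x \<eta> \<inter> {y. ?S y \<le> 1}"
  have cS: "continuous_on UNIV ?S"
    by (intro continuous_intros c2_with_continuous(1)[OF c2_with_moll_shift])
  have clC: "closed ?C"
    by (intro closed_Int closed_cball closed_Collect_le cS continuous_on_const)
  have "{y. cut_moll J a \<eta> x \<tau> y \<noteq> 0} \<subseteq> ?C"
  proof
    fix y assume "y \<in> {y. cut_moll J a \<eta> x \<tau> y \<noteq> 0}"
    then have "moll \<eta> (y - x) \<noteq> 0" "bump (?S y) \<noteq> 0" by (auto simp: cut_moll_def cutoff_def)
    then have "norm (y - x) < \<eta>" "?S y < 1"
      using moll_outside(1)[OF \<open>\<eta> > 0\<close>, of "y - x"] bump_zero[of "?S y"] by (auto simp: not_le[symmetric])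
    then show "y \<in> ?C" by (simp add: dist_norm norm_minus_commute)
  qed
  then have sub: "closure {y. cut_moll J a \<eta> x \<tau> y \<noteq> 0} \<subseteq> ?C"
    by (rule closure_minimal[OF _ clC])
  have "a i \<notin> ?C" if "i \<in> J" for i
  proof -
    have "moll \<tau> (a i - a i) \<le> (\<Sum>k\<in>J. moll \<tau> (a i - a k))"
      by (rule member_le_sum) (use that assms moll_bounds in auto)
    then show ?thesis by simp
  qed
  then have "?C \<inter> a ` J = {}" by blast
  moreover have "?C \<subseteq> \<Omega>" using assms(2) by (rule le_infI1)
  ultimately have "closure {y. cut_moll J a \<eta> x \<tau> y \<noteq> 0} \<subseteq> \<Omega> - a ` J" using sub by blast
  moreover have "bounded (closure {y. cut_moll J a \<eta> x \<tau> y \<noteq> 0})"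
    using sub by (intro bounded_subset[OF bounded_cball[of x \<eta>]]) (rule le_infE)
  then have "compact (closure {y. cut_moll J a \<eta> x \<tau> y \<noteq> 0})"
    by (simp add: compact_eq_bounded_closed)
  moreover have "Ck_on 2 (\<Omega> - a ` J) (cut_moll J a \<eta> x \<tau>)"
    by (rule cut_moll_c2) (rule c2_with_Ck_on)
  ultimately show ?thesis unfolding Ck_compact_support_def by (intro CollectI conjI)
qed

text \<open>The terms of the product rule that contain a derivative of the cutoff. The condition \<open>\<tau> \<le> 1\<close> allows
  the first order terms, of size \<open>1/\<tau>\<close>, to be absorbed.\<close>

lemma cut_moll_error:
  fixes a :: "'i \<Rightarrow> 'a::euclidean_space"
  assumes "\<eta> > 0" "0 < \<tau>" "\<tau> \<le> 1"
  shows "\<bar>laplacian (cut_moll J a \<eta> x \<tau>) y - lmoll \<eta> (y - x) * cutoff J a \<tau> y\<bar>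
     \<le> DIM('a) * (180 * card J + 864 * (card J)\<^sup>2 + 432 * card J / \<eta>) / \<tau>\<^sup>2" (is "_ \<le> ?R")
proof -
  let ?m = "real (card J)"
  have "laplacian (cut_moll J a \<eta> x \<tau>) y - lmoll \<eta> (y - x) * cutoff J a \<tau> y =
    (\<Sum>e\<in>Basis. moll \<eta> (y - x) * hcutoff J a \<tau> y e e + 2 * (dmoll \<eta> (y - x) e * dcutoff J a \<tau> y e))"
    unfolding cut_moll_laplacian lmoll_def sum_distrib_right sum_subtractf[symmetric]
    by (intro sum.cong) (auto simp: algebra_simps)
  also have "\<bar>\<dots>\<bar> \<le> (\<Sum>e\<in>(Basis::'a set). (180 * ?m + 864 * ?m\<^sup>2 + 432 * ?m / \<eta>) / \<tau>\<^sup>2)"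
  proof (intro order_trans[OF sum_abs] sum_mono)
    fix e :: 'a assume "e \<in> Basis"
    then have e: "norm e = 1" by simp
    have "\<bar>moll \<eta> (y - x) * hcutoff J a \<tau> y e e + 2 * (dmoll \<eta> (y - x) e * dcutoff J a \<tau> y e)\<bar>
      \<le> 1 * (3 * (2 * (?m * (30 / \<tau>\<^sup>2))) + 6 * (2 * (?m * (6 / \<tau>))) * (2 * (?m * (6 / \<tau>))))
        + 2 * ((6 / \<eta>) * (3 * (2 * (?m * (6 / \<tau>)))))"
      by (rule order_trans[OF abs_triangle_ineq], unfold abs_mult,
          intro add_mono mult_mono moll_bounds hcutoff_bound dmoll_bound dcutoff_bound)
         (use assms e in auto)
    also have "\<dots> = (180 * ?m + 864 * ?m\<^sup>2) / \<tau>\<^sup>2 + 432 * ?m / \<eta> / \<tau>"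
      by (simp add: add_divide_distrib power2_eq_square)
    also have "\<dots> \<le> (180 * ?m + 864 * ?m\<^sup>2) / \<tau>\<^sup>2 + 432 * ?m / \<eta> / \<tau>\<^sup>2"
      using assms by (intro add_left_mono divide_left_mono) (auto simp: power2_eq_square mult_le_one intro!: mult_left_le)
    finally show "\<bar>moll \<eta> (y - x) * hcutoff J a \<tau> y e e + 2 * (dmoll \<eta> (y - x) e * dcutoff J a \<tau> y e)\<bar>
       \<le> (180 * ?m + 864 * ?m\<^sup>2 + 432 * ?m / \<eta>) / \<tau>\<^sup>2"
      by (simp add: add_divide_distrib)
  qed
  finally show ?thesis by simp
qed

text \<open>The hypothesis \<open>b / |y - a\<^sub>i|\<^sup>2 \<le> V y\<close> is the strong singularity \<open>m\<^sub>i \<ge> 2\<close>: it converts the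
  bound \<open>1/\<tau>\<^sup>2\<close> on the cutoff error, which occurs only where \<open>|y - a\<^sub>i| < \<tau>\<close> for some \<open>i\<close>, into
  domination by the integrable function \<open>V |w|\<close>.\<close>

lemma remove_singularities:
  fixes w V :: "'a::euclidean_space \<Rightarrow> real"
  assumes J: "finite J" and w: "integrable lborel w" and Vw: "integrable lborel (\<lambda>y. V y * w y)"
    and [measurable]: "V \<in> borel_measurable borel" and V0: "\<And>y. V y \<ge> 0"
    and b: "b > 0" "\<And>i y. i \<in> J \<Longrightarrow> y \<noteq> a i \<Longrightarrow> norm (y - a i) \<le> 1 \<Longrightarrow> b / (norm (y - a i))\<^sup>2 \<le> V y"
    and test: "\<And>\<phi>. \<phi> \<in> Ck_compact_support 2 (\<Omega> - a ` J) \<Longrightarrow> \<phi> \<in> borel_measurable borel \<Longrightarrow>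
        laplacian \<phi> \<in> borel_measurable borel \<Longrightarrow>
        (\<integral>y. w y * (- laplacian \<phi> y + V y * \<phi> y) \<partial>lborel) = 0"
    and x: "cball x \<eta> \<subseteq> \<Omega>" and \<eta>: "\<eta> > 0"
  shows "(\<integral>y. w y * lmoll \<eta> (x - y) \<partial>lborel) = (\<integral>y. V y * w y * moll \<eta> (x - y) \<partial>lborel)"
proof -
  define \<tau> where "\<tau> = (\<lambda>j::nat. inverse (real (Suc j)))"
  have \<tau>: "\<And>j. 0 < \<tau> j" "\<And>j. \<tau> j \<le> 1" "\<tau> \<longlonglongrightarrow> 0"
    using LIMSEQ_inverse_real_of_nat by (auto simp: \<tau>_def divide_simps)
  define \<phi> where "\<phi> = (\<lambda>j. cut_moll J a \<eta> x (\<tau> j))"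
  define C where "C = DIM('a) * (180 * card J + 864 * (card J)\<^sup>2 + 432 * card J / \<eta>)"
  have C: "C \<ge> 0" using \<eta> by (auto simp: C_def)
  define B where "B = DIM('a) * 30 / \<eta>\<^sup>2"
  have [measurable]: "w \<in> borel_measurable borel" using w by auto
  have [measurable]: "\<phi> j \<in> borel_measurable borel" "laplacian (\<phi> j) \<in> borel_measurable borel" for j
    unfolding \<phi>_def by (rule cut_moll_c2, erule c2_with_laplacian_measurable)+
  have err0: "laplacian (\<phi> j) y = lmoll \<eta> (y - x)" "\<phi> j y = moll \<eta> (y - x)" if "\<And>i. i \<in> J \<Longrightarrow> norm (y - a i) \<ge> \<tau> j" for j y
    using cutoff_outside[OF \<tau>(1)[of j], of J y a] that
    by (simp_all add: \<phi>_def cut_moll_laplacian lmoll_def cut_moll_def)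
  have AEJ: "AE y in lborel. y \<notin> a ` J"
    using J by (intro AE_not_in finite_imp_null_set_lborel) auto
  have lim: "(\<lambda>j. \<integral>y. w y * (- laplacian (\<phi> j) y + V y * \<phi> j y) \<partial>lborel) \<longlonglongrightarrow>
      (\<integral>y. w y * (- lmoll \<eta> (y - x) + V y * moll \<eta> (y - x)) \<partial>lborel)"
  proof (rule integral_dominated_convergence[where w = "\<lambda>y. B * \<bar>w y\<bar> + (C / b + 1) * \<bar>V y * w y\<bar>"])
    show "AE y in lborel. (\<lambda>j. w y * (- laplacian (\<phi> j) y + V y * \<phi> j y)) \<longlonglongrightarrow>
        w y * (- lmoll \<eta> (y - x) + V y * moll \<eta> (y - x))"
      using AEJ
    proof eventually_elim
      fix y assume "y \<notin> a ` J"
      then have "\<forall>\<^sub>F j in sequentially. \<forall>i\<in>J. \<tau> j < norm (y - a i)"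
        using J by (intro eventually_ball_finite) (auto intro!: order_tendstoD[OF \<tau>(3)])
      then have "\<forall>\<^sub>F j in sequentially. w y * (- laplacian (\<phi> j) y + V y * \<phi> j y) = w y * (- lmoll \<eta> (y - x) + V y * moll \<eta> (y - x))"
        by eventually_elim (simp add: err0 less_imp_le)
      then show "(\<lambda>j. w y * (- laplacian (\<phi> j) y + V y * \<phi> j y)) \<longlonglongrightarrow>
        w y * (- lmoll \<eta> (y - x) + V y * moll \<eta> (y - x))"
        by (rule tendsto_eventually)
    qed
    show "AE y in lborel. norm (w y * (- laplacian (\<phi> j) y + V y * \<phi> j y)) \<le> B * \<bar>w y\<bar> + (C / b + 1) * \<bar>V y * w y\<bar>" for j
      using AEJ
    proof eventually_elim
      fix y assume y: "y \<notin> a ` J"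
      have "\<bar>laplacian (\<phi> j) y - lmoll \<eta> (y - x) * cutoff J a (\<tau> j) y\<bar> \<le> C / b * V y"
      proof (cases "\<forall>i\<in>J. norm (y - a i) \<ge> \<tau> j")
        case True
        then show ?thesis using err0(1)[of j y] C b(1) V0[of y] cutoff_outside(1)[OF \<tau>(1)[of j], of J y a] by simp
      next
        case False
        then obtain i where i: "i \<in> J" "norm (y - a i) < \<tau> j" by force
        have ni: "norm (y - a i) > 0" using y i by auto
        have "b / (\<tau> j)\<^sup>2 \<le> b / (norm (y - a i))\<^sup>2"
          using i ni b(1) \<tau>(1)[of j] by (intro divide_left_mono power_mono mult_pos_pos zero_less_power) auto
        also have "\<dots> \<le> V y" using b(2)[OF i(1), of y] i \<tau>(2)[of j] ni by auto
        finally have "1 / (\<tau> j)\<^sup>2 \<le> V y / b" using b(1) by (simp add: field_simps)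
        then have "C * (1 / (\<tau> j)\<^sup>2) \<le> C * (V y / b)" by (rule mult_left_mono) (rule C)
        then show ?thesis using cut_moll_error[OF \<eta> \<tau>(1,2), of J a x j y] by (simp add: \<phi>_def C_def)
      qed
      moreover have "\<bar>lmoll \<eta> (y - x) * cutoff J a (\<tau> j) y\<bar> \<le> B * 1"
        unfolding abs_mult B_def by (intro mult_mono lmoll_bound) (use \<eta> cutoff_bounds in auto)
      moreover have "\<bar>V y * \<phi> j y\<bar> \<le> V y * (1 * 1)"
        unfolding abs_mult \<phi>_def cut_moll_def by (intro mult_mono) (use V0 cutoff_bounds moll_bounds in auto)
      ultimately have "\<bar>- laplacian (\<phi> j) y + V y * \<phi> j y\<bar> \<le> B + (C / b + 1) * V y"
        by (simp add: algebra_simps)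
      then have "\<bar>w y\<bar> * \<bar>- laplacian (\<phi> j) y + V y * \<phi> j y\<bar> \<le> \<bar>w y\<bar> * (B + (C / b + 1) * V y)"
        by (rule mult_left_mono) simp
      then show "norm (w y * (- laplacian (\<phi> j) y + V y * \<phi> j y)) \<le> B * \<bar>w y\<bar> + (C / b + 1) * \<bar>V y * w y\<bar>"
        using V0[of y] unfolding real_norm_def abs_mult[of "w y"] by (simp add: abs_mult algebra_simps)
    qed
    show "integrable lborel (\<lambda>y. B * \<bar>w y\<bar> + (C / b + 1) * \<bar>V y * w y\<bar>)"
      using w Vw by auto
  qed measurable
  have "(\<integral>y. w y * (- laplacian (\<phi> j) y + V y * \<phi> j y) \<partial>lborel) = 0" for j
  proof (rule test)
    show "\<phi> j \<in> Ck_compact_support 2 (\<Omega> - a ` J)"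
      unfolding \<phi>_def by (rule cut_moll_test[OF J x \<eta> \<tau>(1)])
  qed measurable
  then have 0: "(\<integral>y. w y * (- lmoll \<eta> (y - x) + V y * moll \<eta> (y - x)) \<partial>lborel) = 0"
    using lim LIMSEQ_unique[of "\<lambda>_. 0" 0] by auto
  have i1: "integrable lborel (\<lambda>y. w y * lmoll \<eta> (x - y))"
  proof (rule Bochner_Integration.integrable_bound[where f = "\<lambda>y. B * w y"])
    have "\<bar>w y\<bar> * \<bar>lmoll \<eta> (x - y)\<bar> \<le> \<bar>w y\<bar> * \<bar>B\<bar>" for y
      using lmoll_bound[OF \<eta>, of "x - y"] by (intro mult_left_mono) (auto simp: B_def)
    then show "AE y in lborel. norm (w y * lmoll \<eta> (x - y)) \<le> norm (B * w y)"
      by (auto simp: abs_mult mult.commute)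
  qed (use w in auto)
  have i2: "integrable lborel (\<lambda>y. V y * w y * moll \<eta> (x - y))"
    by (rule Bochner_Integration.integrable_bound[OF Vw])
       (auto simp: abs_mult moll_bounds intro!: mult_left_le)
  have "(\<integral>y. w y * (- lmoll \<eta> (y - x) + V y * moll \<eta> (y - x)) \<partial>lborel)
     = (\<integral>y. V y * w y * moll \<eta> (x - y) - w y * lmoll \<eta> (x - y) \<partial>lborel)"
    by (intro Bochner_Integration.integral_cong) (auto simp: moll_even'[of \<eta> x] algebra_simps)
  also have "\<dots> = (\<integral>y. V y * w y * moll \<eta> (x - y) \<partial>lborel) - (\<integral>y. w y * lmoll \<eta> (x - y) \<partial>lborel)"
    by (rule Bochner_Integration.integral_diff[OF i2 i1])
  finally show ?thesis using 0 by simp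
qed

section \<open>Translations and convolutions of integrable functions\<close>

lemma integral_shift:
  fixes f :: "'a::euclidean_space \<Rightarrow> real"
  assumes [measurable]: "f \<in> borel_measurable borel"
  shows "(\<integral>x. f (x + c) \<partial>lborel) = (\<integral>x. f x \<partial>lborel)"
proof -
  have "(\<integral>x. f x \<partial>distr lborel borel ((+) c)) = (\<integral>x. f (c + x) \<partial>lborel)"
    by (subst integral_distr) auto
  then show ?thesis by (simp add: lborel_distr_plus add.commute)
qed

lemma integrable_shift:
  fixes f :: "'a::euclidean_space \<Rightarrow> real"
  assumes f: "integrable lborel f"
  shows "integrable lborel (\<lambda>x. f (x + c))"
proof -
  have [measurable]: "f \<in> borel_measurable borel" using f by auto
  have "integrable (distr lborel borel ((+) c)) f" using f by (simp add: lborel_distr_plus)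
  then have "integrable lborel (\<lambda>x. f (c + x))"
    by (subst (asm) integrable_distr_eq) auto
  then show ?thesis by (simp add: add.commute)
qed

text \<open>The Euclidean counterpart of \<open>lborel_distr_uminus\<close>.\<close>

lemma lborel_distr_uminus':
  "distr lborel borel uminus = (lborel :: 'a::euclidean_space measure)"
  by (subst (2) lborel_affine[of "-1" 0]) (auto simp: density_1 one_ennreal_def[symmetric])

lemma integral_reflect:
  fixes f :: "'a::euclidean_space \<Rightarrow> real"
  assumes [measurable]: "f \<in> borel_measurable borel"
  shows "(\<integral>x. f (c - x) \<partial>lborel) = (\<integral>x. f x \<partial>lborel)"
proof -
  have "(\<integral>x. f (c + x) \<partial>distr lborel borel uminus) = (\<integral>x. f (c - x) \<partial>lborel)"
    by (subst integral_distr) auto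
  then show ?thesis using integral_shift[OF assms, of c] by (simp add: lborel_distr_uminus' add.commute)
qed

lemma integrable_reflect:
  fixes f :: "'a::euclidean_space \<Rightarrow> real"
  assumes f: "integrable lborel f"
  shows "integrable lborel (\<lambda>x. f (c - x))"
proof -
  have [measurable]: "f \<in> borel_measurable borel" using f by auto
  have "integrable (distr lborel borel uminus) (\<lambda>x. f (x + c))"
    using integrable_shift[OF f, of c] by (simp add: lborel_distr_uminus')
  then show ?thesis by (subst (asm) integrable_distr_eq) auto
qed

text \<open>Continuity of translations in \<open>L\<^sup>1\<close>, phrased with sequences so that dominated convergence applies
  directly.\<close>

definition transl_cont :: "('a::euclidean_space \<Rightarrow> real) \<Rightarrow> bool" where
  "transl_cont f \<longleftrightarrow> (\<forall>h::nat \<Rightarrow> 'a. h \<longlonglongrightarrow> 0 \<longrightarrow> (\<lambda>n. \<integral>x. \<bar>f (x + h n) - f x\<bar> \<partial>lborel) \<longlonglongrightarrow> 0)"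

text \<open>A point of an open set stays in it under small translations, so the positive part of
  \<open>1\<^sub>U(x) - 1\<^sub>U(x + h)\<close> tends to 0 pointwise and is dominated by \<open>1\<^sub>U\<close>. The difference itself has
  integral zero by translation invariance, so its absolute value has twice the integral of the positive part.\<close>

lemma transl_cont_open:
  fixes U :: "'a::euclidean_space set"
  assumes "open U" "emeasure lborel U < \<infinity>"
  shows "transl_cont (indicator U :: 'a \<Rightarrow> real)"
  unfolding transl_cont_def
proof (intro allI impI)
  fix h :: "nat \<Rightarrow> 'a" assume h: "h \<longlonglongrightarrow> 0"
  let ?X = "indicator U :: 'a \<Rightarrow> real"
  have [measurable]: "U \<in> sets borel" using assms by auto
  have int: "integrable lborel ?X" using assms by (auto simp: integrable_indicator_iff)
  have lim: "(\<lambda>n. \<integral>x. max 0 (?X x - ?X (x + h n)) \<partial>lborel) \<longlonglongrightarrow> (\<integral>x. 0 \<partial>(lborel :: 'a measure))"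
  proof (rule integral_dominated_convergence[where w = ?X])
    show "AE x in lborel. (\<lambda>n. max 0 (?X x - ?X (x + h n))) \<longlonglongrightarrow> 0"
    proof (rule AE_I2)
      fix x :: 'a
      show "(\<lambda>n. max 0 (?X x - ?X (x + h n))) \<longlonglongrightarrow> 0"
      proof (cases "x \<in> U")
        case True
        have "(\<lambda>n. x + h n) \<longlonglongrightarrow> x" using h by (auto intro!: tendsto_eq_intros)
        from topological_tendstoD[OF this assms(1) True]
        show ?thesis by (intro tendsto_eventually) (auto elim!: eventually_mono simp: True)
      qed (auto simp: indicator_def)
    qed
    show "integrable lborel ?X" by (rule int)
  qed (auto simp: indicator_def)
  have "(\<integral>x. \<bar>?X (x + h n) - ?X x\<bar> \<partial>lborel) = 2 * (\<integral>x. max 0 (?X x - ?X (x + h n)) \<partial>lborel)" for n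
  proof -
    have i: "integrable lborel (\<lambda>x. ?X (x + h n))" by (rule integrable_shift[OF int])
    then have m: "integrable lborel (\<lambda>x. max 0 (?X x - ?X (x + h n)))" using int by auto
    have "(\<integral>x. \<bar>?X (x + h n) - ?X x\<bar> \<partial>lborel) = (\<integral>x. 2 * max 0 (?X x - ?X (x + h n)) - (?X x - ?X (x + h n)) \<partial>lborel)"
      by (intro Bochner_Integration.integral_cong) (auto simp: max_def)
    also have "\<dots> = 2 * (\<integral>x. max 0 (?X x - ?X (x + h n)) \<partial>lborel) - ((\<integral>x. ?X x \<partial>lborel) - (\<integral>x. ?X (x + h n) \<partial>lborel))"
      using m i int by (simp only: Bochner_Integration.integral_diff Bochner_Integration.integral_mult_right_zero
         Bochner_Integration.integrable_diff integrable_mult_right)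
    also have "(\<integral>x. ?X (x + h n) \<partial>lborel) = (\<integral>x. ?X x \<partial>lborel)"
      by (rule integral_shift) measurable
    finally show ?thesis by simp
  qed
  then show "(\<lambda>n. \<integral>x. \<bar>?X (x + h n) - ?X x\<bar> \<partial>lborel) \<longlonglongrightarrow> 0"
    using tendsto_mult_right_zero[of _ _ 2] lim by (simp add: mult.commute)
qed

lemma transl_cont_closure:
  fixes f :: "'a::euclidean_space \<Rightarrow> real"
  assumes f: "integrable lborel f"
    and approx: "\<And>e. e > 0 \<Longrightarrow> \<exists>g. integrable lborel g \<and> transl_cont g \<and> (\<integral>x. \<bar>f x - g x\<bar> \<partial>lborel) < e"
  shows "transl_cont f"
  unfolding transl_cont_def
proof (intro allI impI)
  fix h :: "nat \<Rightarrow> 'a" assume h: "h \<longlonglongrightarrow> 0"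
  show "(\<lambda>n. \<integral>x. \<bar>f (x + h n) - f x\<bar> \<partial>lborel) \<longlonglongrightarrow> 0"
  proof (rule LIMSEQ_I)
    fix e :: real assume "e > 0"
    then obtain g where g: "integrable lborel g" "transl_cont g" "(\<integral>x. \<bar>f x - g x\<bar> \<partial>lborel) < e / 3"
      using approx[of "e/3"] by auto
    have "(\<lambda>n. \<integral>x. \<bar>g (x + h n) - g x\<bar> \<partial>lborel) \<longlonglongrightarrow> 0" using g(2) h by (auto simp: transl_cont_def)
    then have "\<forall>\<^sub>F n in sequentially. (\<integral>x. \<bar>g (x + h n) - g x\<bar> \<partial>lborel) < e / 3"
      by (rule order_tendstoD) (use \<open>e > 0\<close> in auto)
    then have "\<forall>\<^sub>F n in sequentially. norm ((\<integral>x. \<bar>f (x + h n) - f x\<bar> \<partial>lborel) - 0) < e"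
    proof eventually_elim
      case (elim n)
      have [measurable]: "f \<in> borel_measurable borel" "g \<in> borel_measurable borel" using f g(1) by auto
      have i: "integrable lborel (\<lambda>x. \<bar>f x - g x\<bar>)" "integrable lborel (\<lambda>x. \<bar>g (x + h n) - g x\<bar>)"
         "integrable lborel (\<lambda>x. \<bar>f (x + h n) - f x\<bar>)"
        using f g(1) integrable_shift[OF f] integrable_shift[OF g(1)] by auto
      have i': "integrable lborel (\<lambda>x. \<bar>f (x + h n) - g (x + h n)\<bar>)"
        by (rule integrable_shift[OF i(1)])
      have "(\<integral>x. \<bar>f (x + h n) - f x\<bar> \<partial>lborel) \<le>
        (\<integral>x. \<bar>f (x + h n) - g (x + h n)\<bar> + \<bar>g (x + h n) - g x\<bar> + \<bar>f x - g x\<bar> \<partial>lborel)"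
        by (intro integral_mono i i' Bochner_Integration.integrable_add) auto
      also have "\<dots> = (\<integral>x. \<bar>f (x + h n) - g (x + h n)\<bar> \<partial>lborel) + (\<integral>x. \<bar>g (x + h n) - g x\<bar> \<partial>lborel) + (\<integral>x. \<bar>f x - g x\<bar> \<partial>lborel)"
        by (simp only: Bochner_Integration.integral_add Bochner_Integration.integrable_add i i')
      also have "(\<integral>x. \<bar>f (x + h n) - g (x + h n)\<bar> \<partial>lborel) = (\<integral>x. \<bar>f x - g x\<bar> \<partial>lborel)"
        by (rule integral_shift[where f = "\<lambda>x. \<bar>f x - g x\<bar>"]) measurable
      finally show ?case using elim g(3) by simp
    qed
    then show "\<exists>no. \<forall>n\<ge>no. norm ((\<integral>x. \<bar>f (x + h n) - f x\<bar> \<partial>lborel) - 0) < e"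
      by (simp add: eventually_sequentially)
  qed
qed

lemma transl_cont_cmult:
  assumes "transl_cont f" shows "transl_cont (\<lambda>x. c * f x)"
  using assms unfolding transl_cont_def
  by (auto simp: right_diff_distrib[symmetric] abs_mult intro!: tendsto_mult_right_zero)

lemma transl_cont_add:
  fixes f g :: "'a::euclidean_space \<Rightarrow> real"
  assumes f: "integrable lborel f" "transl_cont f" and g: "integrable lborel g" "transl_cont g"
  shows "transl_cont (\<lambda>x. f x + g x)"
  unfolding transl_cont_def
proof (intro allI impI)
  fix h :: "nat \<Rightarrow> 'a" assume h: "h \<longlonglongrightarrow> 0"
  let ?R = "\<lambda>n. (\<integral>x. \<bar>f (x + h n) - f x\<bar> \<partial>lborel) + (\<integral>x. \<bar>g (x + h n) - g x\<bar> \<partial>lborel)"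
  have R: "?R \<longlonglongrightarrow> 0"
    using f(2) g(2) h by (auto simp: transl_cont_def intro!: tendsto_eq_intros)
  have i: "integrable lborel (\<lambda>x. \<bar>f (x + h n) - f x\<bar>)" "integrable lborel (\<lambda>x. \<bar>g (x + h n) - g x\<bar>)" for n
    using f(1) g(1) integrable_shift[OF f(1)] integrable_shift[OF g(1)] by auto
  have "(\<integral>x. \<bar>f (x + h n) + g (x + h n) - (f x + g x)\<bar> \<partial>lborel) \<le> ?R n" for n
  proof -
    have "(\<integral>x. \<bar>f (x + h n) + g (x + h n) - (f x + g x)\<bar> \<partial>lborel) \<le>
      (\<integral>x. \<bar>f (x + h n) - f x\<bar> + \<bar>g (x + h n) - g x\<bar> \<partial>lborel)"
      using f(1) g(1) integrable_shift[OF f(1)] integrable_shift[OF g(1)] 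
      by (intro integral_mono) auto
    then show ?thesis by (simp add: i)
  qed
  then show "(\<lambda>n. \<integral>x. \<bar>f (x + h n) + g (x + h n) - (f x + g x)\<bar> \<partial>lborel) \<longlonglongrightarrow> 0"
    by (intro tendsto_sandwich[OF _ _ tendsto_const R]) auto
qed

text \<open>Indicators of sets of finite measure are approximated by open sets (outer regularity), and integrable
  functions by simple ones.\<close>

lemma transl_cont_integrable:
  fixes f :: "'a::euclidean_space \<Rightarrow> real"
  assumes "integrable lborel f" shows "transl_cont f"
  using assms
proof (induction rule: integrable_induct)
  case (base A c)
  have [measurable]: "A \<in> sets borel" using base by simp
  have iA: "integrable lborel (indicator A :: 'a \<Rightarrow> real)"
    using base by (auto simp: integrable_indicator_iff)
  have "transl_cont (indicator A :: 'a \<Rightarrow> real)"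
  proof (rule transl_cont_closure[OF iA])
    fix e :: real assume "e > 0"
    then obtain U where U: "open U" "A \<subseteq> U" "emeasure lborel (U - A) < e"
      using outer_regular_lborel[of A e] by auto
    have [measurable]: "U \<in> sets borel" using U by auto
    have "emeasure lborel U = emeasure lborel A + emeasure lborel (U - A)"
      using U(2) by (subst plus_emeasure) (auto intro!: arg_cong[where f = "emeasure lborel"])
    then have fin: "emeasure lborel U < \<infinity>"
      using base U(3) by (auto simp: less_top[symmetric] top_unique)
    have "(\<integral>x. \<bar>indicator A x - indicator U x\<bar> \<partial>lborel) = (\<integral>x. indicator (U - A) x \<partial>(lborel :: 'a measure) :: real)"
      using U(2) by (intro Bochner_Integration.integral_cong) (auto simp: indicator_def)
    also have "\<dots> = measure lborel (U - A)" by simp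
    also have "\<dots> < e"
    proof -
      have "emeasure lborel (U - A) \<noteq> top" using U(3) by (metis ennreal_less_top order_less_trans less_irrefl)
      from emeasure_eq_ennreal_measure[OF this] show ?thesis using U(3) by (simp add: ennreal_less_iff)
    qed
    finally show "\<exists>g. integrable lborel g \<and> transl_cont g \<and> (\<integral>x. \<bar>indicator A x - g x\<bar> \<partial>lborel) < e"
      using transl_cont_open[OF U(1) fin] fin
      by (intro exI[of _ "indicator U"]) (auto simp: integrable_indicator_iff)
  qed
  from transl_cont_cmult[OF this, of c] show ?case by (simp add: mult.commute)
next
  case (add f g)
  then show ?case by (intro transl_cont_add)
next
  case (lim f s)
  have f: "integrable lborel f" by fact
  show ?case
  proof (rule transl_cont_closure[OF f])
    fix e :: real assume "e > 0"
    have [measurable]: "f \<in> borel_measurable borel" "s i \<in> borel_measurable borel" for i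
      using f lim.hyps(1)[of i] by auto
    have "(\<lambda>i. \<integral>x. \<bar>f x - s i x\<bar> \<partial>lborel) \<longlonglongrightarrow> (\<integral>x. 0 \<partial>(lborel :: 'a measure))"
    proof (rule integral_dominated_convergence[where w = "\<lambda>x. 3 * \<bar>f x\<bar>"])
      show "AE x in lborel. (\<lambda>i. \<bar>f x - s i x\<bar>) \<longlonglongrightarrow> 0"
        using lim by (intro AE_I2) (auto intro!: tendsto_eq_intros)
      show "AE x in lborel. norm \<bar>f x - s i x\<bar> \<le> 3 * \<bar>f x\<bar>" for i
      proof (rule AE_I2)
        fix x :: 'a
        have "\<bar>s i x\<bar> \<le> 2 * \<bar>f x\<bar>" using lim.hyps(3)[of x i] by simp
        then show "norm \<bar>f x - s i x\<bar> \<le> 3 * \<bar>f x\<bar>" by simp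
      qed
    qed (use f in auto)
    then have "\<forall>\<^sub>F i in sequentially. (\<integral>x. \<bar>f x - s i x\<bar> \<partial>lborel) < e"
      by (intro order_tendstoD) (use \<open>e > 0\<close> in auto)
    then obtain i where "(\<integral>x. \<bar>f x - s i x\<bar> \<partial>lborel) < e"
      by (auto simp: eventually_sequentially)
    then show "\<exists>g. integrable lborel g \<and> transl_cont g \<and> (\<integral>x. \<bar>f x - g x\<bar> \<partial>lborel) < e"
      using lim.hyps(1)[of i] lim.IH[of i] by blast
  qed
qed

definition conv :: "('a::euclidean_space \<Rightarrow> real) \<Rightarrow> ('a \<Rightarrow> real) \<Rightarrow> 'a \<Rightarrow> real" where
  "conv f k x = (\<integral>y. f y * k (x - y) \<partial>lborel)"

lemma conv_commute:
  fixes f k :: "'a::euclidean_space \<Rightarrow> real"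
  assumes [measurable]: "f \<in> borel_measurable borel" "k \<in> borel_measurable borel"
  shows "conv f k x = (\<integral>z. f (x - z) * k z \<partial>lborel)"
  unfolding conv_def
  using integral_reflect[of "\<lambda>y. f y * k (x - y)" x] by simp

lemma conv_integrable:
  fixes f k :: "'a::euclidean_space \<Rightarrow> real"
  assumes f: "integrable lborel f" and [measurable]: "k \<in> borel_measurable borel" and B: "\<And>z. \<bar>k z\<bar> \<le> B"
  shows "integrable lborel (\<lambda>y. f y * k (x - y))"
proof (rule Bochner_Integration.integrable_bound[where f = "\<lambda>y. B * f y"])
  have "\<bar>f y\<bar> * \<bar>k (x - y)\<bar> \<le> \<bar>f y\<bar> * \<bar>B\<bar>" for y
    using B[of "x - y"] by (intro mult_left_mono) auto
  then show "AE y in lborel. norm (f y * k (x - y)) \<le> norm (B * f y)"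
    by (auto simp: abs_mult mult.commute)
qed (use f in auto)

lemma conv_bound:
  fixes f k :: "'a::euclidean_space \<Rightarrow> real"
  assumes f: "integrable lborel f" and B: "\<And>z. \<bar>k z\<bar> \<le> B" and [measurable]: "k \<in> borel_measurable borel"
  shows "\<bar>conv f k x\<bar> \<le> B * (\<integral>y. \<bar>f y\<bar> \<partial>lborel)"
proof -
  have "\<bar>conv f k x\<bar> \<le> (\<integral>y. \<bar>f y * k (x - y)\<bar> \<partial>lborel)"
    unfolding conv_def using integral_norm_bound[of lborel "\<lambda>y. f y * k (x - y)"] by simp
  also have "\<dots> \<le> (\<integral>y. B * \<bar>f y\<bar> \<partial>lborel)"
    using f B
    by (intro integral_mono integrable_abs conv_integrable[OF f _ B]) 
       (auto simp: abs_mult mult.commute[of "\<bar>f _\<bar>"] intro!: mult_right_mono)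
  finally show ?thesis by simp
qed

lemma conv_measurable [measurable]:
  fixes f k :: "'a::euclidean_space \<Rightarrow> real"
  assumes [measurable]: "f \<in> borel_measurable borel" "k \<in> borel_measurable borel"
  shows "conv f k \<in> borel_measurable borel"
  unfolding conv_def[abs_def] by measurable

section \<open>Mollification converges in \<open>L\<^sup>1\<close>\<close>

lemma integrable_compact_support:
  fixes f :: "'a::euclidean_space \<Rightarrow> real"
  assumes [measurable]: "f \<in> borel_measurable borel" and B: "\<And>x. \<bar>f x\<bar> \<le> B"
    and 0: "\<And>x. x \<notin> cball c R \<Longrightarrow> f x = 0"
  shows "integrable lborel f" "(\<integral>x. \<bar>f x\<bar> \<partial>lborel) \<le> B * measure lborel (cball c R)"
proof -
  have i: "integrable lborel (\<lambda>x. B * indicator (cball c R) x)"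
    by (intro integrable_mult_right) (use emeasure_bounded_finite[OF bounded_cball] in \<open>auto simp: integrable_indicator_iff\<close>)
  have b: "\<bar>f x\<bar> \<le> B * indicator (cball c R) x" for x
    using B[of x] 0[of x] by (auto simp: indicator_def)
  show "integrable lborel f"
    by (rule Bochner_Integration.integrable_bound[OF i]) (use b in \<open>auto intro!: AE_I2 intro: order_trans[OF _ abs_ge_self]\<close>)
  then have "(\<integral>x. \<bar>f x\<bar> \<partial>lborel) \<le> (\<integral>x. B * indicator (cball c R) x \<partial>lborel)"
    by (intro integral_mono i b) auto
  then show "(\<integral>x. \<bar>f x\<bar> \<partial>lborel) \<le> B * measure lborel (cball c R)" by simp
qed

lemma moll_integrable:
  fixes \<eta> :: real
  assumes "\<eta> > 0"
  shows "integrable lborel (moll \<eta> :: 'a::euclidean_space \<Rightarrow> real)"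
    "integrable lborel (lmoll \<eta> :: 'a \<Rightarrow> real)"
    "(\<integral>x. \<bar>lmoll \<eta> (x::'a)\<bar> \<partial>lborel) \<le> DIM('a) * 30 / \<eta>\<^sup>2 * measure lborel (cball (0::'a) \<eta>)"
proof -
  have out: "\<eta> \<le> norm z" if "z \<notin> cball 0 \<eta>" for z :: 'a using that by simp
  show "integrable lborel (moll \<eta> :: 'a \<Rightarrow> real)"
    by (rule integrable_compact_support(1)[where c = 0 and R = \<eta>, OF _ moll_bounds(3) moll_outside(1)[OF assms out]]) auto
  show "integrable lborel (lmoll \<eta> :: 'a \<Rightarrow> real)"
    by (rule integrable_compact_support(1)[where c = 0 and R = \<eta>, OF _ lmoll_bound[OF assms] moll_outside(4)[OF assms out]]) auto
  show "(\<integral>x. \<bar>lmoll \<eta> (x::'a)\<bar> \<partial>lborel) \<le> DIM('a) * 30 / \<eta>\<^sup>2 * measure lborel (cball (0::'a) \<eta>)"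
    by (rule integrable_compact_support(2)[where c = 0 and R = \<eta>, OF _ lmoll_bound[OF assms] moll_outside(4)[OF assms out]]) auto
qed

lemma moll_lower:
  assumes "\<eta> > 0" "norm z \<le> \<eta> / 2"
  shows "27 / 64 \<le> moll \<eta> z"
proof -
  have "(norm z)\<^sup>2 \<le> (\<eta> / 2)\<^sup>2" using assms by (intro power_mono) auto
  then have "z \<bullet> z / \<eta>\<^sup>2 \<le> 1 / 4" using assms
    by (simp add: power2_norm_eq_inner[symmetric] divide_simps power_divide)
  then have "3 / 4 \<le> max 0 (1 - z \<bullet> z / \<eta>\<^sup>2)" by linarith
  then have "(3 / 4) ^ 3 \<le> max 0 (1 - z \<bullet> z / \<eta>\<^sup>2) ^ 3" by (rule power_mono) simp
  then show ?thesis by (simp add: moll_def bump_def power3_eq_cube)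
qed

text \<open>The integral of the mollifier; the type argument fixes the space over which it is taken.\<close>

definition mass :: "'a::euclidean_space itself \<Rightarrow> real \<Rightarrow> real" where
  "mass _ \<eta> = (\<integral>z. moll \<eta> (z::'a) \<partial>lborel)"

lemma mass_lower:
  assumes "\<eta> > 0"
  shows "27 / 64 * measure lborel (cball (0::'a::euclidean_space) (\<eta> / 2)) \<le> mass TYPE('a) \<eta>"
    "mass TYPE('a) \<eta> > 0"
proof -
  have i: "integrable lborel (\<lambda>x. 27 / 64 * indicator (cball (0::'a) (\<eta> / 2)) x :: real)"
    by (intro integrable_mult_right) (use emeasure_bounded_finite[OF bounded_cball] in \<open>auto simp: integrable_indicator_iff\<close>)
  have "(\<integral>x. 27 / 64 * indicator (cball (0::'a) (\<eta> / 2)) x \<partial>lborel) \<le> mass TYPE('a) \<eta>"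
    unfolding mass_def using moll_lower[OF assms]
    by (intro integral_mono i moll_integrable[OF assms]) (auto simp: indicator_def moll_bounds)
  then show *: "27 / 64 * measure lborel (cball (0::'a) (\<eta> / 2)) \<le> mass TYPE('a) \<eta>" by simp
  have "0 < measure lborel (cball (0::'a) (\<eta> / 2))"
    using content_cball_pos[of "\<eta> / 2" "0::'a"] assms by simp
  then show "mass TYPE('a) \<eta> > 0" using * by linarith
qed

lemma transl_cont_uniform:
  fixes f :: "'a::euclidean_space \<Rightarrow> real"
  assumes f: "integrable lborel f" and e: "e > 0"
  obtains d where "d > 0" "\<And>h. norm h < d \<Longrightarrow> (\<integral>x. \<bar>f (x + h) - f x\<bar> \<partial>lborel) \<le> e"
proof -
  have "\<exists>d>0. \<forall>h. norm h < d \<longrightarrow> (\<integral>x. \<bar>f (x + h) - f x\<bar> \<partial>lborel) \<le> e"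
  proof (rule ccontr)
    assume "\<not> ?thesis"
    then have "\<forall>n. \<exists>h. norm h < inverse (real (Suc n)) \<and> (\<integral>x. \<bar>f (x + h) - f x\<bar> \<partial>lborel) > e"
      by (metis not_le of_nat_0_less_iff positive_imp_inverse_positive zero_less_Suc)
    then obtain h where h: "\<And>n. norm (h n) < inverse (real (Suc n))" "\<And>n. (\<integral>x. \<bar>f (x + h n) - f x\<bar> \<partial>lborel) > e"
      by metis
    have "h \<longlonglongrightarrow> 0"
      by (rule Lim_null_comparison[OF _ LIMSEQ_inverse_real_of_nat])
         (use h(1) in \<open>auto intro!: always_eventually less_imp_le\<close>)
    then have "(\<lambda>n. \<integral>x. \<bar>f (x + h n) - f x\<bar> \<partial>lborel) \<longlonglongrightarrow> 0"
      using transl_cont_integrable[OF f] by (auto simp: transl_cont_def)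
    from order_tendstoD(2)[OF this e] show False
      using h(2) by (auto simp: eventually_sequentially intro: less_asym)
  qed
  then show ?thesis using that by blast
qed

text \<open>Minkowski's inequality in integral form: the difference is the average of \<open>f (x - z) - f x\<close> over the
  mollifier, so by Fubini its norm is at most the average of the translation errors.\<close>

lemma mollify_close:
  fixes f :: "'a::euclidean_space \<Rightarrow> real"
  assumes f: "integrable lborel f" and \<eta>: "\<eta> > 0"
    and e: "\<And>h. norm h < \<eta> \<Longrightarrow> (\<integral>x. \<bar>f (x + h) - f x\<bar> \<partial>lborel) \<le> e"
  shows "integrable lborel (\<lambda>x. conv f (moll \<eta>) x / mass TYPE('a) \<eta>)"
    "(\<integral>x. \<bar>conv f (moll \<eta>) x / mass TYPE('a) \<eta> - f x\<bar> \<partial>lborel) \<le> e"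
proof -
  let ?I = "mass TYPE('a) \<eta>"
  have I: "?I > 0" by (rule mass_lower[OF \<eta>])
  have [measurable]: "f \<in> borel_measurable borel" using f by auto
  define F where "F = (\<lambda>z x. (f (x - z) - f x) * moll \<eta> z)"
  have Fz: "integrable lborel (\<lambda>x. F z x)" for z
    using integrable_shift[OF f, of "-z"] f by (auto simp: F_def)
  have T: "(\<integral>x. \<bar>F z x\<bar> \<partial>lborel) \<le> e * moll \<eta> z" for z
  proof (cases "norm z < \<eta>")
    case True
    have "(\<integral>x. \<bar>F z x\<bar> \<partial>lborel) = (\<integral>x. \<bar>f (x + - z) - f x\<bar> \<partial>lborel) * moll \<eta> z"
      by (simp add: F_def abs_mult moll_bounds)
    also have "\<dots> \<le> e * moll \<eta> z" by (intro mult_right_mono e moll_bounds) (use True in simp)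
    finally show ?thesis .
  qed (use moll_outside[OF \<eta>, of z] in \<open>simp add: F_def\<close>)
  have iM: "integrable lborel (\<lambda>z::'a. e * moll \<eta> z)"
    by (intro integrable_mult_right moll_integrable(1)[OF \<eta>])
  have [measurable]: "case_prod F \<in> borel_measurable (lborel \<Otimes>\<^sub>M lborel)"
    unfolding F_def by measurable
  have [measurable]: "(\<lambda>z. \<integral>x. \<bar>F z x\<bar> \<partial>lborel) \<in> borel_measurable lborel"
    by measurable
  have iT: "integrable lborel (\<lambda>z. \<integral>x. \<bar>F z x\<bar> \<partial>lborel)"
    by (rule Bochner_Integration.integrable_bound[OF iM]) 
       (auto intro!: AE_I2 intro: order_trans[OF T abs_ge_self])
  have iF: "integrable (lborel \<Otimes>\<^sub>M lborel) (case_prod F)"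
    by (rule lborel_pair.Fubini_integrable) (use iT Fz in auto)
  have iF': "integrable (lborel \<Otimes>\<^sub>M lborel) (case_prod (\<lambda>z x. \<bar>F z x\<bar>))"
    using integrable_abs[OF iF] by (simp add: case_prod_beta')
  have eq: "(\<integral>z. F z x \<partial>lborel) = conv f (moll \<eta>) x - f x * ?I" for x
  proof -
    have "integrable lborel (\<lambda>y. f y * moll \<eta> (x - y))"
      by (rule conv_integrable[OF f _ moll_bounds(3)]) measurable
    from integrable_reflect[OF this, of x] have "integrable lborel (\<lambda>z. f (x - z) * moll \<eta> z)" by simp
    then show ?thesis
      using moll_integrable(1)[OF \<eta>, where 'a='a]
      by (simp add: F_def conv_commute left_diff_distrib mass_def)
  qed
  have i1: "integrable lborel (\<lambda>x. \<integral>z. F z x \<partial>lborel)"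
    by (rule lborel_pair.integrable_snd[OF iF])
  have i2: "integrable lborel (\<lambda>x. \<integral>z. \<bar>F z x\<bar> \<partial>lborel)"
    by (rule lborel_pair.integrable_snd[OF iF'])
  have "conv f (moll \<eta>) x / ?I = (\<integral>z. F z x \<partial>lborel) / ?I + f x" for x
    unfolding eq using I by (simp add: field_simps)
  then show "integrable lborel (\<lambda>x. conv f (moll \<eta>) x / ?I)"
    using i1 f by simp
  have "(\<integral>x. \<bar>\<integral>z. F z x \<partial>lborel\<bar> \<partial>lborel) \<le> (\<integral>x. (\<integral>z. \<bar>F z x\<bar> \<partial>lborel) \<partial>lborel)"
    using i1 i2 integral_norm_bound[of lborel "\<lambda>z. F z x" for x] by (intro integral_mono) auto
  also have "\<dots> = (\<integral>z. (\<integral>x. \<bar>F z x\<bar> \<partial>lborel) \<partial>lborel)"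
    by (rule lborel_pair.Fubini_integral[OF iF'])
  also have "\<dots> \<le> (\<integral>z. e * moll \<eta> (z::'a) \<partial>lborel)"
    by (intro integral_mono iT iM T)
  also have "\<dots> = e * ?I" by (simp add: mass_def)
  finally have le: "(\<integral>x. \<bar>\<integral>z. F z x \<partial>lborel\<bar> \<partial>lborel) \<le> e * ?I" .
  have "\<bar>conv f (moll \<eta>) x / ?I - f x\<bar> = \<bar>\<integral>z. F z x \<partial>lborel\<bar> / ?I" for x
  proof -
    have "conv f (moll \<eta>) x / ?I - f x = (\<integral>z. F z x \<partial>lborel) / ?I"
      unfolding eq using I by (simp add: field_simps)
    then show ?thesis using I by (simp add: abs_divide)
  qed
  then show "(\<integral>x. \<bar>conv f (moll \<eta>) x / ?I - f x\<bar> \<partial>lborel) \<le> e"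
    using le I by (simp add: divide_le_eq)
qed

lemma mollify_tendsto:
  fixes f :: "'a::euclidean_space \<Rightarrow> real"
  assumes f: "integrable lborel f" and \<eta>: "\<And>j::nat. \<eta> j > 0" "\<eta> \<longlonglongrightarrow> 0"
  shows "integrable lborel (\<lambda>x. conv f (moll (\<eta> j)) x / mass TYPE('a) (\<eta> j))"
    "(\<lambda>j. \<integral>x. \<bar>conv f (moll (\<eta> j)) x / mass TYPE('a) (\<eta> j) - f x\<bar> \<partial>lborel) \<longlonglongrightarrow> 0"
proof -
  have [measurable]: "f \<in> borel_measurable borel" using f by auto
  have "(\<integral>x. \<bar>f (x + h) - f x\<bar> \<partial>lborel) \<le> 2 * (\<integral>x. \<bar>f x\<bar> \<partial>lborel)" for h
  proof -
    have i: "integrable lborel (\<lambda>x. \<bar>f x\<bar>)" using f by auto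
    have "(\<integral>x. \<bar>f (x + h) - f x\<bar> \<partial>lborel) \<le> (\<integral>x. \<bar>f (x + h)\<bar> + \<bar>f x\<bar> \<partial>lborel)"
      using f integrable_shift[OF f, of h] by (intro integral_mono) auto
    also have "\<dots> = (\<integral>x. \<bar>f (x + h)\<bar> \<partial>lborel) + (\<integral>x. \<bar>f x\<bar> \<partial>lborel)"
      using i integrable_shift[OF i, of h] by simp
    also have "(\<integral>x. \<bar>f (x + h)\<bar> \<partial>lborel) = (\<integral>x. \<bar>f x\<bar> \<partial>lborel)"
      by (rule integral_shift[where f = "\<lambda>x. \<bar>f x\<bar>"]) measurable
    finally show ?thesis by simp
  qed
  then show "integrable lborel (\<lambda>x. conv f (moll (\<eta> j)) x / mass TYPE('a) (\<eta> j))"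
    by (rule mollify_close(1)[OF f \<eta>(1)])
  show "(\<lambda>j. \<integral>x. \<bar>conv f (moll (\<eta> j)) x / mass TYPE('a) (\<eta> j) - f x\<bar> \<partial>lborel) \<longlonglongrightarrow> 0"
  proof (rule LIMSEQ_I)
    fix e :: real assume "e > 0"
    then obtain d where d: "d > 0" "\<And>h. norm h < d \<Longrightarrow> (\<integral>x. \<bar>f (x + h) - f x\<bar> \<partial>lborel) \<le> e / 2"
      using transl_cont_uniform[OF f, of "e / 2"] by auto
    have "\<forall>\<^sub>F j in sequentially. \<eta> j < d" by (rule order_tendstoD(2)[OF \<eta>(2) d(1)])
    then have "\<forall>\<^sub>F j in sequentially. norm ((\<integral>x. \<bar>conv f (moll (\<eta> j)) x / mass TYPE('a) (\<eta> j) - f x\<bar> \<partial>lborel) - 0) < e"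
    proof eventually_elim
      case (elim j)
      have "(\<integral>x. \<bar>conv f (moll (\<eta> j)) x / mass TYPE('a) (\<eta> j) - f x\<bar> \<partial>lborel) \<le> e / 2"
        by (rule mollify_close(2)[OF f \<eta>(1)], rule d(2)) (use elim in simp)
      then show ?case using \<open>e > 0\<close> by simp
    qed
    then show "\<exists>no. \<forall>j\<ge>no. norm ((\<integral>x. \<bar>conv f (moll (\<eta> j)) x / mass TYPE('a) (\<eta> j) - f x\<bar> \<partial>lborel) - 0) < e"
      by (simp add: eventually_sequentially)
  qed
qed

section \<open>Kato's inequality\<close>

lemma sdiff_measurable [measurable]:
  assumes [measurable]: "k \<in> borel_measurable borel"
  shows "sdiff t e k \<in> borel_measurable borel" "dlap t k \<in> borel_measurable borel"
  unfolding dlap_def[abs_def] sdiff_def[abs_def] by measurable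

lemma sdiff_conv:
  fixes f k :: "'a::euclidean_space \<Rightarrow> real"
  assumes f: "integrable lborel f" and k: "k \<in> borel_measurable borel" and B: "\<And>z. \<bar>k z\<bar> \<le> B"
  shows "sdiff t e (conv f k) x = conv f (sdiff t e k) x"
proof -
  note i = conv_integrable[OF f k B]
  have "conv f (sdiff t e k) x =
     (\<integral>y. f y * k (x + t *\<^sub>R e - y) + f y * k (x - t *\<^sub>R e - y) - 2 * (f y * k (x - y)) \<partial>lborel)"
    unfolding conv_def sdiff_def
    by (intro Bochner_Integration.integral_cong) (auto simp: algebra_simps)
  also have "\<dots> = sdiff t e (conv f k) x"
    unfolding conv_def sdiff_def using i by simp
  finally show ?thesis by simp
qed

lemma sdiff_abs_le:
  assumes "\<And>z. \<bar>k z\<bar> \<le> B" shows "\<bar>sdiff t e k z\<bar> \<le> 4 * B"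
  unfolding sdiff_def using assms[of z] assms[of "z + t *\<^sub>R e"] assms[of "z - t *\<^sub>R e"] by linarith

lemma dlap_conv:
  fixes f k :: "'a::euclidean_space \<Rightarrow> real"
  assumes f: "integrable lborel f" and k: "k \<in> borel_measurable borel" and B: "\<And>z. \<bar>k z\<bar> \<le> B"
  shows "dlap t (conv f k) x = conv f (dlap t k) x"
proof -
  have i: "integrable lborel (\<lambda>y. f y * sdiff t e k (x - y))" for e
    by (rule conv_integrable[OF f sdiff_measurable(1)[OF k] sdiff_abs_le[OF B]])
  have "conv f (dlap t k) x = (\<integral>y. (\<Sum>e\<in>Basis. f y * sdiff t e k (x - y) / t\<^sup>2) \<partial>lborel)"
    unfolding conv_def dlap_def by (simp add: sum_distrib_left)
  also have "\<dots> = (\<Sum>e\<in>Basis. (\<integral>y. f y * sdiff t e k (x - y) / t\<^sup>2 \<partial>lborel))"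
    by (rule Bochner_Integration.integral_sum) (use i in auto)
  also have "\<dots> = (\<Sum>e\<in>Basis. conv f (sdiff t e k) x / t\<^sup>2)" by (simp add: conv_def)
  finally show ?thesis by (simp add: dlap_def sdiff_conv[OF f k B])
qed

lemma integrable_bounded_mult:
  fixes S \<zeta> :: "'a::euclidean_space \<Rightarrow> real"
  assumes [measurable]: "S \<in> borel_measurable borel" and B: "\<And>x. \<bar>S x\<bar> \<le> B" and \<zeta>: "integrable lborel \<zeta>"
  shows "integrable lborel (\<lambda>x. S x * \<zeta> x)"
proof (rule Bochner_Integration.integrable_bound[where f = "\<lambda>x. B * \<zeta> x"])
  have "\<bar>S x\<bar> * \<bar>\<zeta> x\<bar> \<le> \<bar>B\<bar> * \<bar>\<zeta> x\<bar>" for x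
    using B[of x] by (intro mult_right_mono) auto
  then show "AE x in lborel. norm (S x * \<zeta> x) \<le> norm (B * \<zeta> x)" by (simp add: abs_mult)
qed (use \<zeta> in auto)

text \<open>The shift invariance of Lebesgue measure moves each of the three terms from one factor to the other. This replaces
  integration by parts.\<close>

lemma sdiff_selfadjoint:
  fixes S \<zeta> :: "'a::euclidean_space \<Rightarrow> real"
  assumes S[measurable]: "S \<in> borel_measurable borel" and B: "\<And>x. \<bar>S x\<bar> \<le> B" and \<zeta>: "integrable lborel \<zeta>"
  shows "integrable lborel (\<lambda>x. S x * sdiff t e \<zeta> x)" "integrable lborel (\<lambda>x. \<zeta> x * sdiff t e S x)"
    "(\<integral>x. S x * sdiff t e \<zeta> x \<partial>lborel) = (\<integral>x. \<zeta> x * sdiff t e S x \<partial>lborel)"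
proof -
  have [measurable]: "\<zeta> \<in> borel_measurable borel" using \<zeta> by auto
  have i1: "integrable lborel (\<lambda>x. S x * \<zeta> (x + c))" for c
    by (rule integrable_bounded_mult[OF S B integrable_shift[OF \<zeta>]])
  have i2: "integrable lborel (\<lambda>x. S (x + c) * \<zeta> x)" for c
    by (rule integrable_bounded_mult[OF _ B \<zeta>]) measurable
  have eq: "(\<integral>x. S x * \<zeta> (x + c) \<partial>lborel) = (\<integral>x. S (x - c) * \<zeta> x \<partial>lborel)" for c
    using integral_shift[of "\<lambda>x. S (x - c) * \<zeta> x" c] by simp
  have e1: "S x * sdiff t e \<zeta> x = S x * \<zeta> (x + t *\<^sub>R e) + S x * \<zeta> (x + - (t *\<^sub>R e)) - 2 * (S x * \<zeta> (x + 0))" for x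
    by (simp add: sdiff_def algebra_simps)
  have e2: "\<zeta> x * sdiff t e S x = S (x + t *\<^sub>R e) * \<zeta> x + S (x + - (t *\<^sub>R e)) * \<zeta> x - 2 * (S (x + 0) * \<zeta> x)" for x
    by (simp add: sdiff_def algebra_simps)
  show "integrable lborel (\<lambda>x. S x * sdiff t e \<zeta> x)"
    unfolding e1 by (intro Bochner_Integration.integrable_add Bochner_Integration.integrable_diff integrable_mult_right i1)
  show "integrable lborel (\<lambda>x. \<zeta> x * sdiff t e S x)"
    unfolding e2 by (intro Bochner_Integration.integrable_add Bochner_Integration.integrable_diff integrable_mult_right i2)
  show "(\<integral>x. S x * sdiff t e \<zeta> x \<partial>lborel) = (\<integral>x. \<zeta> x * sdiff t e S x \<partial>lborel)"
    unfolding e1 e2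
    using eq[of "t *\<^sub>R e"] eq[of "- (t *\<^sub>R e)"]
    by (simp only: Bochner_Integration.integral_diff Bochner_Integration.integral_add integrable_mult_right
        Bochner_Integration.integrable_add i1 i2 Bochner_Integration.integral_mult_right_zero) simp
qed

lemma dlap_selfadjoint:
  fixes S \<zeta> :: "'a::euclidean_space \<Rightarrow> real"
  assumes S: "S \<in> borel_measurable borel" and B: "\<And>x. \<bar>S x\<bar> \<le> B" and \<zeta>: "integrable lborel \<zeta>"
  shows "integrable lborel (\<lambda>x. \<zeta> x * dlap t S x)"
    "(\<integral>x. S x * dlap t \<zeta> x \<partial>lborel) = (\<integral>x. \<zeta> x * dlap t S x \<partial>lborel)"
proof -
  note s = sdiff_selfadjoint[OF S B \<zeta>]
  show "integrable lborel (\<lambda>x. \<zeta> x * dlap t S x)"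
    unfolding dlap_def sum_distrib_left using s(2) by (intro Bochner_Integration.integrable_sum) auto
  have "(\<integral>x. S x * dlap t \<zeta> x \<partial>lborel) = (\<Sum>e\<in>Basis. (\<integral>x. S x * sdiff t e \<zeta> x / t\<^sup>2 \<partial>lborel))"
    unfolding dlap_def sum_distrib_left using s(1) by (subst Bochner_Integration.integral_sum) auto
  also have "\<dots> = (\<Sum>e\<in>Basis. (\<integral>x. \<zeta> x * sdiff t e S x / t\<^sup>2 \<partial>lborel))"
    by (simp add: s(3))
  also have "\<dots> = (\<integral>x. \<zeta> x * dlap t S x \<partial>lborel)"
    unfolding dlap_def sum_distrib_left using s(2) by (subst Bochner_Integration.integral_sum) auto
  finally show "(\<integral>x. S x * dlap t \<zeta> x \<partial>lborel) = (\<integral>x. \<zeta> x * dlap t S x \<partial>lborel)" .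
qed

text \<open>The whole of Kato's inequality is convexity of the absolute value; \<open>sgn\<close> is a subgradient, also at 0.\<close>

lemma sgn_subgradient: "sgn a * (b - a) \<le> \<bar>b\<bar> - \<bar>a :: real\<bar>"
  by (auto simp: sgn_if)

lemma dlap_abs: "sgn (W x) * dlap t W x \<le> dlap t (\<lambda>x. \<bar>W x\<bar>) x"
  unfolding dlap_def sum_distrib_left
proof (rule sum_mono)
  fix e
  have "sgn (W x) * sdiff t e W x \<le> sdiff t e (\<lambda>x. \<bar>W x\<bar>) x"
    using sgn_subgradient[of "W x" "W (x + t *\<^sub>R e)"] sgn_subgradient[of "W x" "W (x - t *\<^sub>R e)"]
    by (simp add: sdiff_def algebra_simps)
  then show "sgn (W x) * (sdiff t e W x / t\<^sup>2) \<le> sdiff t e (\<lambda>x. \<bar>W x\<bar>) x / t\<^sup>2"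
    by (simp add: divide_right_mono)
qed

lemma discrete_kato:
  fixes W \<zeta> :: "'a::euclidean_space \<Rightarrow> real"
  assumes W[measurable]: "W \<in> borel_measurable borel" and B: "\<And>x. \<bar>W x\<bar> \<le> B"
    and \<zeta>: "integrable lborel \<zeta>" "\<And>x. \<zeta> x \<ge> 0"
  shows "(\<integral>x. \<zeta> x * (sgn (W x) * dlap t W x) \<partial>lborel) \<le> (\<integral>x. \<bar>W x\<bar> * dlap t \<zeta> x \<partial>lborel)"
proof -
  have [measurable]: "\<zeta> \<in> borel_measurable borel" using \<zeta> by auto
  have B': "\<bar>\<bar>W x\<bar>\<bar> \<le> B" for x using B by simp
  have m: "(\<lambda>x. \<bar>W x\<bar>) \<in> borel_measurable borel" by measurable
  have i: "integrable lborel (\<lambda>x. \<zeta> x * (sgn (W x) * dlap t W x))"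
  proof (rule Bochner_Integration.integrable_bound[OF dlap_selfadjoint(1)[OF W B \<zeta>(1)]])
    show "AE x in lborel. norm (\<zeta> x * (sgn (W x) * dlap t W x)) \<le> norm (\<zeta> x * dlap t W x)"
      by (intro AE_I2) (auto simp: abs_mult sgn_if)
  qed measurable
  have "(\<integral>x. \<zeta> x * (sgn (W x) * dlap t W x) \<partial>lborel) \<le> (\<integral>x. \<zeta> x * dlap t (\<lambda>x. \<bar>W x\<bar>) x \<partial>lborel)"
    by (intro integral_mono i dlap_selfadjoint(1)[OF m B' \<zeta>(1)] mult_left_mono dlap_abs \<zeta>(2))
  also have "\<dots> = (\<integral>x. \<bar>W x\<bar> * dlap t \<zeta> x \<partial>lborel)"
    by (rule dlap_selfadjoint(2)[OF m B' \<zeta>(1), symmetric])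
  finally show ?thesis .
qed

lemma dlap_moll:
  fixes z :: "'a::euclidean_space"
  assumes "\<eta> > 0"
  shows "\<bar>dlap t (moll \<eta>) z\<bar> \<le> DIM('a) * 30 / \<eta>\<^sup>2"
    and "(\<And>j::nat. s j > 0) \<Longrightarrow> s \<longlonglongrightarrow> 0 \<Longrightarrow> (\<lambda>j. dlap (s j) (moll \<eta>) z) \<longlonglongrightarrow> lmoll \<eta> z"
    and "\<bar>t\<bar> \<le> 1 \<Longrightarrow> norm z \<ge> \<eta> + 1 \<Longrightarrow> dlap t (moll \<eta>) z = 0"
proof -
  have "\<bar>dlap t (moll \<eta>) z\<bar> \<le> (\<Sum>e\<in>(Basis::'a set). 30 / \<eta>\<^sup>2)"
    unfolding dlap_def
    by (intro order_trans[OF sum_abs] sum_mono sdiff_bound[OF c2_with_moll] hmoll_bound) (use assms in auto)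
  then show "\<bar>dlap t (moll \<eta>) z\<bar> \<le> DIM('a) * 30 / \<eta>\<^sup>2" by simp
  show "(\<lambda>j. dlap (s j) (moll \<eta>) z) \<longlonglongrightarrow> lmoll \<eta> z" if "\<And>j::nat. s j > 0" "s \<longlonglongrightarrow> 0"
    unfolding dlap_def lmoll_def
    by (intro tendsto_sum sdiff_tendsto[OF c2_with_moll] that)
  show "dlap t (moll \<eta>) z = 0" if t: "\<bar>t\<bar> \<le> 1" and z: "norm z \<ge> \<eta> + 1"
    unfolding dlap_def
  proof (intro sum.neutral ballI)
    fix e :: 'a assume "e \<in> Basis"
    then have "norm (t *\<^sub>R e) \<le> 1" using t by simp
    then have "norm (z + t *\<^sub>R e) \<ge> \<eta>" "norm (z - t *\<^sub>R e) \<ge> \<eta>" "norm z \<ge> \<eta>"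
      using z norm_diff_ineq[of z "t *\<^sub>R e"] norm_triangle_ineq2[of z "t *\<^sub>R e"] by linarith+
    then show "sdiff t e (moll \<eta>) z / t\<^sup>2 = 0"
      by (simp add: sdiff_def moll_outside(1)[OF assms])
  qed
qed

text \<open>The step tends to 0 on the kernel only, so nothing but integrability is asked of \<open>f\<close>. The bound does
  not depend on the step and serves as a majorant.\<close>

lemma conv_dlap_moll_tendsto:
  fixes f :: "'a::euclidean_space \<Rightarrow> real"
  assumes f: "integrable lborel f" and \<eta>: "\<eta> > 0" and s: "\<And>j::nat. s j > 0" "s \<longlonglongrightarrow> 0"
  shows "(\<lambda>j. dlap (s j) (conv f (moll \<eta>)) x) \<longlonglongrightarrow> conv f (lmoll \<eta>) x"
    "\<bar>dlap t (conv f (moll \<eta>)) x\<bar> \<le> DIM('a) * 30 / \<eta>\<^sup>2 * (\<integral>y. \<bar>f y\<bar> \<partial>lborel)"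
proof -
  have [measurable]: "f \<in> borel_measurable borel" using f by auto
  let ?B = "DIM('a) * 30 / \<eta>\<^sup>2"
  have eq: "dlap t (conv f (moll \<eta>)) x = conv f (dlap t (moll \<eta>)) x" for t
    by (rule dlap_conv[OF f _ moll_bounds(3)]) measurable
  show "\<bar>dlap t (conv f (moll \<eta>)) x\<bar> \<le> ?B * (\<integral>y. \<bar>f y\<bar> \<partial>lborel)"
    unfolding eq by (rule conv_bound[OF f dlap_moll(1)[OF \<eta>]]) measurable
  show "(\<lambda>j. dlap (s j) (conv f (moll \<eta>)) x) \<longlonglongrightarrow> conv f (lmoll \<eta>) x"
    unfolding eq unfolding conv_def
  proof (rule integral_dominated_convergence[where w = "\<lambda>y. ?B * \<bar>f y\<bar>"])
    show "AE y in lborel. (\<lambda>j. f y * dlap (s j) (moll \<eta>) (x - y)) \<longlonglongrightarrow> f y * lmoll \<eta> (x - y)"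
      by (intro AE_I2 tendsto_mult_left dlap_moll(2)[OF \<eta>] s)
    show "AE y in lborel. norm (f y * dlap (s j) (moll \<eta>) (x - y)) \<le> ?B * \<bar>f y\<bar>" for j
      by (intro AE_I2, unfold real_norm_def abs_mult mult.commute[of "\<bar>f _\<bar>"], intro mult_right_mono dlap_moll(1)[OF \<eta>]) simp
    show "integrable lborel (\<lambda>y. ?B * \<bar>f y\<bar>)" using f by simp
  qed measurable
qed

lemma conv_compact_support:
  fixes f k :: "'a::euclidean_space \<Rightarrow> real"
  assumes f0: "\<And>x. norm x > R \<Longrightarrow> f x = 0" and k0: "\<And>x. norm x \<ge> r \<Longrightarrow> k x = 0" and x: "norm x > R + r"
  shows "conv f k x = 0"
proof -
  have "f y * k (x - y) = 0" for y
  proof (cases "norm y > R")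
    case False
    then have "norm (x - y) \<ge> r" using x norm_triangle_ineq2[of x y] by linarith
    then show ?thesis by (simp add: k0)
  qed (simp add: f0)
  then have "(\<lambda>y. f y * k (x - y)) = (\<lambda>_. 0)" by auto
  then show ?thesis by (simp add: conv_def)
qed

lemma conv_nonneg: "(\<And>x. f x \<ge> 0) \<Longrightarrow> (\<And>x. k x \<ge> 0) \<Longrightarrow> conv f k x \<ge> 0"
  unfolding conv_def by (intro integral_nonneg_AE AE_I2 mult_nonneg_nonneg)

text \<open>The limit of \<open>discrete_kato\<close> as the step tends to 0, for two mollified functions. Both sides pass to the limit by dominated
  convergence: on the right by compact support, on the left because \<open>\<zeta>\<close> is integrable.\<close>

lemma mollified_kato:
  fixes w f :: "'a::euclidean_space \<Rightarrow> real"
  assumes w: "integrable lborel w" and f: "integrable lborel f" "\<And>x. f x \<ge> 0" "\<And>x. norm x > R \<Longrightarrow> f x = 0"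
    and \<eta>: "\<eta> > 0" and \<epsilon>: "\<epsilon> > 0"
  shows "(\<integral>x. conv f (moll \<epsilon>) x * (sgn (conv w (moll \<eta>) x) * conv w (lmoll \<eta>) x) \<partial>lborel)
     \<le> (\<integral>x. \<bar>conv w (moll \<eta>) x\<bar> * conv f (lmoll \<epsilon>) x \<partial>lborel)"
proof -
  have [measurable]: "f \<in> borel_measurable borel" "w \<in> borel_measurable borel" using f w by auto
  define W where "W = conv w (moll \<eta>)"
  define \<zeta> where "\<zeta> = conv f (moll \<epsilon>)"
  have [measurable]: "W \<in> borel_measurable borel" "\<zeta> \<in> borel_measurable borel" unfolding W_def \<zeta>_def by measurable
  define s where "s = (\<lambda>j. inverse (real (Suc j)))"
  have s: "\<And>j. 0 < s j" "\<And>j. s j \<le> 1" "s \<longlonglongrightarrow> 0"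
    using LIMSEQ_inverse_real_of_nat by (auto simp: s_def divide_simps)
  have WB: "\<bar>W x\<bar> \<le> 1 * (\<integral>y. \<bar>w y\<bar> \<partial>lborel)" for x
    unfolding W_def by (rule conv_bound[OF w moll_bounds(3)]) measurable
  have \<zeta>B: "\<bar>\<zeta> x\<bar> \<le> 1 * (\<integral>y. \<bar>f y\<bar> \<partial>lborel)" for x
    unfolding \<zeta>_def by (rule conv_bound[OF f(1) moll_bounds(3)]) measurable
  have \<zeta>i: "integrable lborel \<zeta>"
  proof (rule integrable_compact_support(1)[OF _ \<zeta>B])
    show "\<zeta> x = 0" if "x \<notin> cball 0 (R + \<epsilon>)" for x
      unfolding \<zeta>_def by (rule conv_compact_support[OF f(3) moll_outside(1)[OF \<epsilon>]]) (use that in auto)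
  qed measurable
  have \<zeta>0: "\<zeta> x \<ge> 0" for x unfolding \<zeta>_def by (rule conv_nonneg[OF f(2) moll_bounds(1)])
  let ?C = "DIM('a) * 30 / \<epsilon>\<^sup>2 * (\<integral>y. \<bar>f y\<bar> \<partial>lborel)"
  let ?M = "\<integral>y. \<bar>w y\<bar> \<partial>lborel"
  have L: "(\<lambda>j. \<integral>x. \<bar>W x\<bar> * dlap (s j) \<zeta> x \<partial>lborel) \<longlonglongrightarrow> (\<integral>x. \<bar>W x\<bar> * conv f (lmoll \<epsilon>) x \<partial>lborel)"
  proof (rule integral_dominated_convergence[where w = "\<lambda>x. ?M * ?C * indicator (cball 0 (R + (\<epsilon> + 1))) x"])
    show "AE x in lborel. (\<lambda>j. \<bar>W x\<bar> * dlap (s j) \<zeta> x) \<longlonglongrightarrow> \<bar>W x\<bar> * conv f (lmoll \<epsilon>) x"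
      unfolding \<zeta>_def by (intro AE_I2 tendsto_mult_left conv_dlap_moll_tendsto(1)[OF f(1) \<epsilon> s(1,3)])
    show "AE x in lborel. norm (\<bar>W x\<bar> * dlap (s j) \<zeta> x) \<le> ?M * ?C * indicator (cball 0 (R + (\<epsilon> + 1))) x" for j
    proof (rule AE_I2)
      fix x :: 'a
      have "\<bar>dlap (s j) \<zeta> x\<bar> \<le> ?C"
        unfolding \<zeta>_def by (rule conv_dlap_moll_tendsto(2)[OF f(1) \<epsilon> s(1,3)])
      then have b: "\<bar>W x\<bar> * \<bar>dlap (s j) \<zeta> x\<bar> \<le> ?M * ?C"
        using WB[of x] by (intro mult_mono) auto
      have "dlap (s j) \<zeta> x = 0" if x: "norm x > R + (\<epsilon> + 1)"
      proof -
        have "dlap (s j) \<zeta> x = conv f (dlap (s j) (moll \<epsilon>)) x"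
          unfolding \<zeta>_def by (rule dlap_conv[OF f(1) _ moll_bounds(3)]) measurable
        also have "\<dots> = 0"
          by (rule conv_compact_support[OF f(3) dlap_moll(3)[OF \<epsilon>] x]) (use s(1,2)[of j] in auto)
        finally show ?thesis .
      qed
      then show "norm (\<bar>W x\<bar> * dlap (s j) \<zeta> x) \<le> ?M * ?C * indicator (cball 0 (R + (\<epsilon> + 1))) x"
        using b by (cases "norm x > R + (\<epsilon> + 1)") (auto simp: abs_mult indicator_def)
    qed
    show "integrable lborel (\<lambda>x::'a. ?M * ?C * indicator (cball 0 (R + (\<epsilon> + 1))) x)"
      by (intro integrable_mult_right) (use emeasure_bounded_finite[OF bounded_cball] in \<open>auto simp: integrable_indicator_iff\<close>)
  qed measurable
  have Rr: "(\<lambda>j. \<integral>x. \<zeta> x * (sgn (W x) * dlap (s j) W x) \<partial>lborel) \<longlonglongrightarrow> (\<integral>x. \<zeta> x * (sgn (W x) * conv w (lmoll \<eta>) x) \<partial>lborel)"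
  proof (rule integral_dominated_convergence[where w = "\<lambda>x. (DIM('a) * 30 / \<eta>\<^sup>2 * ?M) * \<bar>\<zeta> x\<bar>"])
    show "AE x in lborel. (\<lambda>j. \<zeta> x * (sgn (W x) * dlap (s j) W x)) \<longlonglongrightarrow> \<zeta> x * (sgn (W x) * conv w (lmoll \<eta>) x)"
      unfolding W_def by (intro AE_I2 tendsto_mult_left conv_dlap_moll_tendsto(1)[OF w \<eta> s(1,3)])
    show "AE x in lborel. norm (\<zeta> x * (sgn (W x) * dlap (s j) W x)) \<le> (DIM('a) * 30 / \<eta>\<^sup>2 * ?M) * \<bar>\<zeta> x\<bar>" for j
    proof (rule AE_I2)
      fix x :: 'a
      have d: "\<bar>dlap (s j) W x\<bar> \<le> DIM('a) * 30 / \<eta>\<^sup>2 * ?M"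
        unfolding W_def by (rule conv_dlap_moll_tendsto(2)[OF w \<eta> s(1,3)])
      have "\<bar>sgn (W x)\<bar> * \<bar>dlap (s j) W x\<bar> \<le> 1 * (DIM('a) * 30 / \<eta>\<^sup>2 * ?M)"
        by (intro mult_mono d) (auto simp: sgn_if)
      then have "\<bar>\<zeta> x\<bar> * (\<bar>sgn (W x)\<bar> * \<bar>dlap (s j) W x\<bar>) \<le> \<bar>\<zeta> x\<bar> * (1 * (DIM('a) * 30 / \<eta>\<^sup>2 * ?M))"
        by (rule mult_left_mono) simp
      then show "norm (\<zeta> x * (sgn (W x) * dlap (s j) W x)) \<le> (DIM('a) * 30 / \<eta>\<^sup>2 * ?M) * \<bar>\<zeta> x\<bar>"
        by (simp only: real_norm_def abs_mult mult_1 mult.commute)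
    qed
    show "integrable lborel (\<lambda>x. (DIM('a) * 30 / \<eta>\<^sup>2 * ?M) * \<bar>\<zeta> x\<bar>)" using \<zeta>i by (intro integrable_mult_right integrable_abs)
  qed measurable
  show ?thesis
    using LIMSEQ_le[OF Rr L] discrete_kato[OF _ WB \<zeta>i \<zeta>0] by (auto simp: W_def \<zeta>_def)
qed

text \<open>Inside \<open>\<Omega>\<close> the weak equation turns \<open>w * \<Delta>\<rho>\<^sub>\<eta>\<close> into \<open>g * \<rho>\<^sub>\<eta>\<close>, which
  converges to \<open>g = V w\<close> in \<open>L\<^sup>1\<close>. The factor \<open>sgn (w * \<rho>\<^sub>\<eta>)\<close> converges only along a subsequence, almost
  everywhere, and only where \<open>w \<noteq> 0\<close>; but \<open>g\<close> vanishes elsewhere, so the lower bound tends to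
  \<open>\<integral> \<zeta> V |w| \<ge> 0\<close>.\<close>

lemma kato_inequality:
  fixes w g f :: "'a::euclidean_space \<Rightarrow> real"
  assumes w: "integrable lborel w" and g: "integrable lborel g"
    and gV: "\<And>x. g x = V x * w x" "\<And>x. V x \<ge> 0"
    and weak: "\<And>x \<eta>. \<eta> > 0 \<Longrightarrow> cball x \<eta> \<subseteq> \<Omega> \<Longrightarrow> conv w (lmoll \<eta>) x = conv g (moll \<eta>) x"
    and f: "integrable lborel f" "\<And>x. f x \<ge> 0" "\<And>x. norm x > R \<Longrightarrow> f x = 0"
    and \<epsilon>: "\<epsilon> > 0" and \<rho>: "\<rho> > 0" "\<And>x. conv f (moll \<epsilon>) x \<noteq> 0 \<Longrightarrow> cball x \<rho> \<subseteq> \<Omega>"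
  shows "0 \<le> (\<integral>x. \<bar>w x\<bar> * conv f (lmoll \<epsilon>) x \<partial>lborel)"
proof -
  have [measurable]: "f \<in> borel_measurable borel" "w \<in> borel_measurable borel" "g \<in> borel_measurable borel"
    using f w g by auto
  define \<zeta> where "\<zeta> = conv f (moll \<epsilon>)"
  define T where "T = conv f (lmoll \<epsilon>)"
  have [measurable]: "\<zeta> \<in> borel_measurable borel" "T \<in> borel_measurable borel" unfolding \<zeta>_def T_def by measurable
  \<comment> \<open>All these scales are at most \<open>\<rho>\<close>, so the weak equation is available on the whole support of \<open>\<zeta>\<close>.\<close>
  define \<eta> where "\<eta> = (\<lambda>j. \<rho> * inverse (real (Suc j)))"
  have \<eta>: "\<And>j. 0 < \<eta> j" "\<And>j. \<eta> j \<le> \<rho>" "\<eta> \<longlonglongrightarrow> 0"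
    using \<rho>(1) tendsto_mult_right_zero[OF LIMSEQ_inverse_real_of_nat, of \<rho>] by (auto simp: \<eta>_def divide_simps)
  define wj where "wj = (\<lambda>j x. conv w (moll (\<eta> j)) x / mass TYPE('a) (\<eta> j))"
  define gj where "gj = (\<lambda>j x. conv g (moll (\<eta> j)) x / mass TYPE('a) (\<eta> j))"
  have [measurable]: "wj j \<in> borel_measurable borel" "gj j \<in> borel_measurable borel" for j
    unfolding wj_def gj_def by measurable
  have wji: "integrable lborel (wj j)" and gji: "integrable lborel (gj j)" for j
    unfolding wj_def gj_def by (rule mollify_tendsto(1)[OF w \<eta>(1,3)] mollify_tendsto(1)[OF g \<eta>(1,3)])+
  have wjl: "(\<lambda>j. \<integral>x. \<bar>wj j x - w x\<bar> \<partial>lborel) \<longlonglongrightarrow> 0" and gjl: "(\<lambda>j. \<integral>x. \<bar>gj j x - g x\<bar> \<partial>lborel) \<longlonglongrightarrow> 0"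
    unfolding wj_def gj_def by (rule mollify_tendsto(2)[OF w \<eta>(1,3)] mollify_tendsto(2)[OF g \<eta>(1,3)])+
  let ?F = "\<integral>y. \<bar>f y\<bar> \<partial>lborel"
  let ?C = "DIM('a) * 30 / \<epsilon>\<^sup>2 * ?F"
  have \<zeta>B: "\<bar>\<zeta> x\<bar> \<le> 1 * ?F" for x
    unfolding \<zeta>_def by (rule conv_bound[OF f(1) moll_bounds(3)]) measurable
  have TB: "\<bar>T x\<bar> \<le> ?C" for x
    unfolding T_def by (rule conv_bound[OF f(1) lmoll_bound[OF \<epsilon>]]) measurable
  have \<zeta>0: "\<zeta> x \<ge> 0" for x unfolding \<zeta>_def by (rule conv_nonneg[OF f(2) moll_bounds(1)])
  have iT: "integrable lborel (\<lambda>x. \<bar>wj j x\<bar> * T x)" "integrable lborel (\<lambda>x. \<bar>w x\<bar> * T x)" for j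
    by (subst mult.commute, rule integrable_bounded_mult[OF _ TB], measurable, intro integrable_abs wji w)+
  have i\<zeta>: "integrable lborel (\<lambda>x. \<zeta> x * (sgn (wj j x) * h x))" if h: "integrable lborel h" for j h
  proof (rule integrable_bounded_mult[OF _ \<zeta>B])
    show "integrable lborel (\<lambda>x. sgn (wj j x) * h x)"
      by (rule integrable_bounded_mult[OF _ _ h, of _ 1]) (auto simp: sgn_if)
  qed measurable
  have main: "(\<integral>x. \<zeta> x * (sgn (wj j x) * gj j x) \<partial>lborel) \<le> (\<integral>x. \<bar>wj j x\<bar> * T x \<partial>lborel)" for j
  proof -
    let ?I = "mass TYPE('a) (\<eta> j)"
    have I: "?I > 0" by (rule mass_lower[OF \<eta>(1)])
    have "(\<integral>x. \<zeta> x * (sgn (wj j x) * gj j x) \<partial>lborel) =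
       (\<integral>x. \<zeta> x * (sgn (conv w (moll (\<eta> j)) x) * conv w (lmoll (\<eta> j)) x) / ?I \<partial>lborel)"
    proof (rule Bochner_Integration.integral_cong[OF refl])
      fix x
      have "conv w (lmoll (\<eta> j)) x = conv g (moll (\<eta> j)) x" if "\<zeta> x \<noteq> 0"
        using \<rho>(2)[of x] that \<eta>(2)[of j] by (intro weak \<eta>(1)) (auto simp: \<zeta>_def subset_iff)
      moreover have "sgn (wj j x) = sgn (conv w (moll (\<eta> j)) x)"
        using I by (simp add: wj_def sgn_divide)
      ultimately show "\<zeta> x * (sgn (wj j x) * gj j x) = \<zeta> x * (sgn (conv w (moll (\<eta> j)) x) * conv w (lmoll (\<eta> j)) x) / ?I"
        by (cases "\<zeta> x = 0") (auto simp: gj_def)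
    qed
    also have "\<dots> = (\<integral>x. \<zeta> x * (sgn (conv w (moll (\<eta> j)) x) * conv w (lmoll (\<eta> j)) x) \<partial>lborel) / ?I" by simp
    also have "\<dots> \<le> (\<integral>x. \<bar>conv w (moll (\<eta> j)) x\<bar> * T x \<partial>lborel) / ?I"
      using mollified_kato[OF w f \<eta>(1) \<epsilon>] I unfolding \<zeta>_def T_def by (intro divide_right_mono) auto
    also have "\<dots> = (\<integral>x. \<bar>wj j x\<bar> * T x \<partial>lborel)"
      using I by (simp add: wj_def)
    finally show ?thesis .
  qed
  obtain r :: "nat \<Rightarrow> nat" where r: "strict_mono r" "AE x in lborel. (\<lambda>n. wj (r n) x - w x) \<longlonglongrightarrow> 0"
    using tendsto_L1_AE_subseq[of lborel "\<lambda>j x. wj j x - w x"] wji w wjl by auto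
  have L1: "(\<lambda>j. \<integral>x. \<bar>wj (r j) x\<bar> * T x \<partial>lborel) \<longlonglongrightarrow> (\<integral>x. \<bar>w x\<bar> * T x \<partial>lborel)"
  proof (rule LIM_zero_cancel, rule Lim_null_comparison)
    have "(\<lambda>j. ?C * (\<integral>x. \<bar>wj j x - w x\<bar> \<partial>lborel)) \<longlonglongrightarrow> 0"
      by (rule tendsto_mult_right_zero[OF wjl])
    from LIMSEQ_subseq_LIMSEQ[OF this r(1)]
    show "(\<lambda>j. ?C * (\<integral>x. \<bar>wj (r j) x - w x\<bar> \<partial>lborel)) \<longlonglongrightarrow> 0" by (simp add: o_def)
    have "\<bar>(\<integral>x. \<bar>wj j x\<bar> * T x \<partial>lborel) - (\<integral>x. \<bar>w x\<bar> * T x \<partial>lborel)\<bar> \<le> ?C * (\<integral>x. \<bar>wj j x - w x\<bar> \<partial>lborel)" for j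
    proof -
      have "\<bar>(\<integral>x. \<bar>wj j x\<bar> * T x \<partial>lborel) - (\<integral>x. \<bar>w x\<bar> * T x \<partial>lborel)\<bar> = \<bar>\<integral>x. \<bar>wj j x\<bar> * T x - \<bar>w x\<bar> * T x \<partial>lborel\<bar>"
        using iT by simp
      also have "\<dots> \<le> (\<integral>x. \<bar>\<bar>wj j x\<bar> * T x - \<bar>w x\<bar> * T x\<bar> \<partial>lborel)"
        using integral_norm_bound[of lborel "\<lambda>x. \<bar>wj j x\<bar> * T x - \<bar>w x\<bar> * T x"] by simp
      also have "\<dots> \<le> (\<integral>x. ?C * \<bar>wj j x - w x\<bar> \<partial>lborel)"
      proof (rule integral_mono)
        fix x
        have "\<bar>\<bar>wj j x\<bar> * T x - \<bar>w x\<bar> * T x\<bar> = \<bar>T x\<bar> * \<bar>\<bar>wj j x\<bar> - \<bar>w x\<bar>\<bar>"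
          by (simp add: abs_mult[symmetric] algebra_simps)
        also have "\<dots> \<le> ?C * \<bar>wj j x - w x\<bar>"
          using TB[of x] by (intro mult_mono) auto
        finally show "\<bar>\<bar>wj j x\<bar> * T x - \<bar>w x\<bar> * T x\<bar> \<le> ?C * \<bar>wj j x - w x\<bar>" .
      qed (use iT(1)[of j] iT(2) wji[of j] w in auto)
      finally show ?thesis by simp
    qed
    then show "\<forall>\<^sub>F j in sequentially. norm ((\<integral>x. \<bar>wj (r j) x\<bar> * T x \<partial>lborel) - (\<integral>x. \<bar>w x\<bar> * T x \<partial>lborel)) \<le> ?C * (\<integral>x. \<bar>wj (r j) x - w x\<bar> \<partial>lborel)"
      by (simp only: real_norm_def eventually_True)
  qed
  have L2: "(\<lambda>j. \<integral>x. \<zeta> x * (sgn (wj (r j) x) * g x) \<partial>lborel) \<longlonglongrightarrow> (\<integral>x. \<zeta> x * \<bar>g x\<bar> \<partial>lborel)"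
  proof (rule integral_dominated_convergence[where w = "\<lambda>x. ?F * \<bar>g x\<bar>"])
    show "AE x in lborel. (\<lambda>j. \<zeta> x * (sgn (wj (r j) x) * g x)) \<longlonglongrightarrow> \<zeta> x * \<bar>g x\<bar>"
      using r(2)
    proof eventually_elim
      fix x assume "(\<lambda>n. wj (r n) x - w x) \<longlonglongrightarrow> 0"
      then have l: "(\<lambda>n. wj (r n) x) \<longlonglongrightarrow> w x" by (rule LIM_zero_cancel)
      \<comment> \<open>The sign of \<open>w x\<close> is that of \<open>g x\<close> because \<open>V\<close> is nonnegative.\<close>
      have ab: "sgn (w x) * g x = \<bar>g x\<bar>" using gV(2)[of x] by (auto simp: gV(1) sgn_if abs_mult)
      show "(\<lambda>j. \<zeta> x * (sgn (wj (r j) x) * g x)) \<longlonglongrightarrow> \<zeta> x * \<bar>g x\<bar>"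
      proof (cases "w x = 0")
        case True then show ?thesis by (simp add: gV)
      next
        case False
        have "(\<lambda>j. \<zeta> x * (sgn (wj (r j) x) * g x)) \<longlonglongrightarrow> \<zeta> x * (sgn (w x) * g x)"
          by (intro tendsto_mult_left tendsto_mult_right tendsto_sgn l False)
        then show ?thesis unfolding ab .
      qed
    qed
    show "AE x in lborel. norm (\<zeta> x * (sgn (wj (r j) x) * g x)) \<le> ?F * \<bar>g x\<bar>" for j
    proof (rule AE_I2)
      fix x
      have "\<bar>\<zeta> x\<bar> * (\<bar>sgn (wj (r j) x)\<bar> * \<bar>g x\<bar>) \<le> ?F * (1 * \<bar>g x\<bar>)"
        using \<zeta>B[of x] by (intro mult_mono mult_right_mono) (auto simp: sgn_if)
      then show "norm (\<zeta> x * (sgn (wj (r j) x) * g x)) \<le> ?F * \<bar>g x\<bar>" by (simp only: real_norm_def abs_mult mult_1)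
    qed
    show "integrable lborel (\<lambda>x. ?F * \<bar>g x\<bar>)" using g by simp
  qed measurable
  have L3: "(\<lambda>j. ?F * (\<integral>x. \<bar>gj (r j) x - g x\<bar> \<partial>lborel)) \<longlonglongrightarrow> 0"
    using LIMSEQ_subseq_LIMSEQ[OF tendsto_mult_right_zero[OF gjl, where c = ?F] r(1)] by (simp add: o_def)
  have lower: "(\<integral>x. \<zeta> x * (sgn (wj j x) * g x) \<partial>lborel) - ?F * (\<integral>x. \<bar>gj j x - g x\<bar> \<partial>lborel)
      \<le> (\<integral>x. \<bar>wj j x\<bar> * T x \<partial>lborel)" for j
  proof -
    have "(\<integral>x. \<zeta> x * (sgn (wj j x) * g x) \<partial>lborel) - (\<integral>x. ?F * \<bar>gj j x - g x\<bar> \<partial>lborel)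
       = (\<integral>x. \<zeta> x * (sgn (wj j x) * g x) - ?F * \<bar>gj j x - g x\<bar> \<partial>lborel)"
      by (rule Bochner_Integration.integral_diff[symmetric]) (use i\<zeta>[OF g] gji[of j] g in auto)
    also have "\<dots> \<le> (\<integral>x. \<zeta> x * (sgn (wj j x) * gj j x) \<partial>lborel)"
    proof (rule integral_mono)
      fix x
      have "\<zeta> x * (sgn (wj j x) * (g x - gj j x)) \<le> \<bar>\<zeta> x\<bar> * (\<bar>sgn (wj j x)\<bar> * \<bar>g x - gj j x\<bar>)"
        by (simp only: abs_mult[symmetric] abs_ge_self)
      also have "\<dots> \<le> ?F * (1 * \<bar>g x - gj j x\<bar>)"
        using \<zeta>B[of x] by (intro mult_mono mult_right_mono) (auto simp: sgn_if)
      finally show "\<zeta> x * (sgn (wj j x) * g x) - ?F * \<bar>gj j x - g x\<bar> \<le> \<zeta> x * (sgn (wj j x) * gj j x)"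
        by (simp add: algebra_simps abs_minus_commute)
    next
      show "integrable lborel (\<lambda>x. \<zeta> x * (sgn (wj j x) * g x) - ?F * \<bar>gj j x - g x\<bar>)"
        using i\<zeta>[OF g] gji[of j] g by (intro Bochner_Integration.integrable_diff integrable_mult_right integrable_abs)
    qed (rule i\<zeta>[OF gji])
    also have "\<dots> \<le> (\<integral>x. \<bar>wj j x\<bar> * T x \<partial>lborel)" by (rule main)
    finally show ?thesis by simp
  qed
  have "(\<integral>x. \<zeta> x * \<bar>g x\<bar> \<partial>lborel) - 0 \<le> (\<integral>x. \<bar>w x\<bar> * T x \<partial>lborel)"
    by (rule LIMSEQ_le[OF tendsto_diff[OF L2 L3] L1]) (use lower in auto)
  moreover have "0 \<le> (\<integral>x. \<zeta> x * \<bar>g x\<bar> \<partial>lborel)"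
    by (intro integral_nonneg_AE AE_I2 mult_nonneg_nonneg \<zeta>0) auto
  ultimately show ?thesis by (simp add: T_def)
qed

section \<open>A barrier on domains with exterior balls\<close>

text \<open>The second difference of \<open>exp\<close> at 0.\<close>

lemma exp_plus_exp_minus: "2 + y\<^sup>2 \<le> exp y + exp (- y :: real)"
proof -
  have c: "c2_with (exp :: real \<Rightarrow> real) (\<lambda>x v. exp x * v) (\<lambda>x e v. exp x * v * e)"
    unfolding c2_with_def
    by (auto intro!: derivative_eq_intros continuous_intros)
  have pos: "2 + y\<^sup>2 \<le> exp y + exp (- y)" if y: "y > 0" for y :: real
  proof -
    obtain \<xi> :: real where "sdiff y 1 exp 0 = (exp (0 + \<xi> *\<^sub>R 1) * 1 * 1 + exp (0 - \<xi> *\<^sub>R 1) * 1 * 1) / 2 * y\<^sup>2"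
      by (rule c2_with_sdiff[OF c y])
    moreover have "2 \<le> exp \<xi> + exp (- \<xi>)"
      using exp_ge_add_one_self[of \<xi>] exp_ge_add_one_self[of "- \<xi>"] by linarith
    then have "2 * y\<^sup>2 \<le> (exp \<xi> + exp (- \<xi>)) * y\<^sup>2" by (rule mult_right_mono) simp
    ultimately show ?thesis by (simp add: sdiff_def)
  qed
  show ?thesis using pos[of y] pos[of "- y"] by (cases y "0::real" rule: linorder_cases) auto
qed

text \<open>The continuous Laplacian of the Gaussian is \<open>(4 l\<^sup>2 |z|\<^sup>2 - 2 n l) exp(- l |z|\<^sup>2)\<close>, hence at least
  \<open>2 l n exp(- l |z|\<^sup>2)\<close> when \<open>n \<le> l |z|\<^sup>2\<close>. Under the condition on the step at least half of that bound remains,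
  uniformly in the step.\<close>

lemma dlap_gaussian:
  fixes z :: "'a::euclidean_space" and l t :: real
  assumes l: "l > 0" and t: "t > 0" "l * t\<^sup>2 \<le> 1 / 4" and z: "DIM('a) \<le> l * (z \<bullet> z)"
  shows "l * DIM('a) * exp (- l * (z \<bullet> z)) \<le> dlap t (\<lambda>z. exp (- l * (z \<bullet> z))) z"
proof -
  let ?n = "real DIM('a)" and ?q = "z \<bullet> z"
  let ?G = "exp (- l * ?q)"
  have part: "?G * ((1 - l * t\<^sup>2) * (2 + (2 * l * t * (z \<bullet> e))\<^sup>2) - 2) \<le> sdiff t e (\<lambda>z. exp (- l * (z \<bullet> z))) z"
    if "e \<in> Basis" for e
  proof -
    have ee: "e \<bullet> e = 1" using that by simp
    have "exp (- l * ((z + t *\<^sub>R e) \<bullet> (z + t *\<^sub>R e))) = ?G * (exp (- (l * t\<^sup>2)) * exp (- (2 * l * t * (z \<bullet> e))))"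
      "exp (- l * ((z - t *\<^sub>R e) \<bullet> (z - t *\<^sub>R e))) = ?G * (exp (- (l * t\<^sup>2)) * exp (2 * l * t * (z \<bullet> e)))"
      unfolding exp_add[symmetric]
      by (simp_all add: inner_add_left inner_add_right inner_diff_left inner_diff_right ee inner_commute[of e z] algebra_simps power2_eq_square)
    then have "sdiff t e (\<lambda>z. exp (- l * (z \<bullet> z))) z =
        ?G * (exp (- (l * t\<^sup>2)) * (exp (2 * l * t * (z \<bullet> e)) + exp (- (2 * l * t * (z \<bullet> e)))) - 2)"
      unfolding sdiff_def by (simp only:) (simp add: algebra_simps)
    moreover have "(1 - l * t\<^sup>2) * (2 + (2 * l * t * (z \<bullet> e))\<^sup>2) \<le>
        exp (- (l * t\<^sup>2)) * (exp (2 * l * t * (z \<bullet> e)) + exp (- (2 * l * t * (z \<bullet> e))))"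
      using exp_ge_add_one_self[of "- (l * t\<^sup>2)"] by (intro mult_mono exp_plus_exp_minus) auto
    ultimately show ?thesis by (simp add: mult_left_mono)
  qed
  have sq: "(\<Sum>e\<in>Basis. (z \<bullet> e)\<^sup>2) = ?q"
    by (subst euclidean_inner[of z z]) (simp add: power2_eq_square)
  have "l * ?n \<le> 4 * l\<^sup>2 * ?q - 2 * ?n * l - 4 * l ^ 3 * t\<^sup>2 * ?q"
  proof -
    have "l\<^sup>2 * ?q * (l * t\<^sup>2) \<le> l\<^sup>2 * ?q * (1 / 4)" by (intro mult_left_mono t) auto
    moreover have "l * ?n \<le> l * (l * ?q)" using z l by (intro mult_left_mono) auto
    ultimately show ?thesis by (simp add: power2_eq_square power3_eq_cube algebra_simps)
  qed
  then have "?G * (l * ?n) \<le> ?G * (4 * l\<^sup>2 * ?q - 2 * ?n * l - 4 * l ^ 3 * t\<^sup>2 * ?q)"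
    by (intro mult_left_mono) auto
  also have "\<dots> = ?G * ((1 - l * t\<^sup>2) * (2 * ?n + 4 * l\<^sup>2 * t\<^sup>2 * ?q) - 2 * ?n) / t\<^sup>2"
    using t(1) by (simp add: divide_simps) (simp add: algebra_simps power2_eq_square power3_eq_cube)
  also have "(1 - l * t\<^sup>2) * (2 * ?n + 4 * l\<^sup>2 * t\<^sup>2 * ?q) - 2 * ?n
     = (\<Sum>e\<in>Basis. (1 - l * t\<^sup>2) * (2 + (2 * l * t * (z \<bullet> e))\<^sup>2) - 2)"
    unfolding sq[symmetric]
    by (simp add: sum_subtractf sum_distrib_left[symmetric] sum.distrib power_mult_distrib algebra_simps)
  also have "?G * \<dots> / t\<^sup>2 = (\<Sum>e\<in>Basis. ?G * ((1 - l * t\<^sup>2) * (2 + (2 * l * t * (z \<bullet> e))\<^sup>2) - 2) / t\<^sup>2)"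
    by (simp add: sum_distrib_left sum_divide_distrib)
  also have "\<dots> \<le> dlap t (\<lambda>z. exp (- l * (z \<bullet> z))) z"
    unfolding dlap_def by (intro sum_mono divide_right_mono part) auto
  finally show ?thesis by (simp add: mult.commute)
qed

text \<open>Discrete Laplacians of integrable functions have integral zero; dominated convergence gives the
  same for the Laplacian of the bump.\<close>

lemma lmoll_integral:
  assumes \<eta>: "\<eta> > 0" shows "(\<integral>z. lmoll \<eta> (z::'a::euclidean_space) \<partial>lborel) = 0"
proof -
  define s where "s = (\<lambda>j. inverse (real (Suc j)))"
  have s: "\<And>j. 0 < s j" "\<And>j. s j \<le> 1" "s \<longlonglongrightarrow> 0"
    using LIMSEQ_inverse_real_of_nat by (auto simp: s_def divide_simps)
  have "(\<lambda>j. \<integral>z. dlap (s j) (moll \<eta>) (z::'a) \<partial>lborel) \<longlonglongrightarrow> (\<integral>z. lmoll \<eta> (z::'a) \<partial>lborel)"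
  proof (rule integral_dominated_convergence[where w = "\<lambda>z. DIM('a) * 30 / \<eta>\<^sup>2 * indicator (cball 0 (\<eta> + 1)) z"])
    show "AE z::'a in lborel. (\<lambda>j. dlap (s j) (moll \<eta>) z) \<longlonglongrightarrow> lmoll \<eta> z"
      by (intro AE_I2 dlap_moll(2)[OF \<eta> s(1,3)])
    show "AE z::'a in lborel. norm (dlap (s j) (moll \<eta>) z) \<le> DIM('a) * 30 / \<eta>\<^sup>2 * indicator (cball 0 (\<eta> + 1)) z" for j
    proof (rule AE_I2)
      fix z :: 'a
      show "norm (dlap (s j) (moll \<eta>) z) \<le> DIM('a) * 30 / \<eta>\<^sup>2 * indicator (cball 0 (\<eta> + 1)) z"
        using dlap_moll(1)[OF \<eta>, of "s j" z] dlap_moll(3)[OF \<eta>, of "s j" z] s(1,2)[of j]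
        by (cases "norm z \<ge> \<eta> + 1") (auto simp: indicator_def)
    qed
    show "integrable lborel (\<lambda>z::'a. DIM('a) * 30 / \<eta>\<^sup>2 * indicator (cball 0 (\<eta> + 1)) z)"
      by (intro integrable_mult_right) (use emeasure_bounded_finite[OF bounded_cball] in \<open>auto simp: integrable_indicator_iff\<close>)
  qed measurable
  moreover have "(\<integral>z. dlap t (moll \<eta>) (z::'a) \<partial>lborel) = 0" for t
    using dlap_selfadjoint(2)[of "\<lambda>_::'a. 1" 1 "moll \<eta>" t] moll_integrable(1)[OF \<eta>, where 'a='a]
    by (simp add: dlap_def sdiff_def)
  ultimately show ?thesis using LIMSEQ_unique[of "\<lambda>_. 0" 0] by auto
qed

text \<open>As \<open>\<Delta>\<rho>\<^sub>\<epsilon>\<close> has integral zero, \<open>f\<close> may be replaced by \<open>f - f x\<close>, which is at most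
  \<open>L \<epsilon>\<close> on the support. This gains one power of \<open>\<epsilon>\<close> over the trivial bound.\<close>

lemma conv_lmoll_lipschitz:
  fixes f :: "'a::euclidean_space \<Rightarrow> real"
  assumes f[measurable]: "f \<in> borel_measurable borel" and fi: "integrable lborel f"
    and L: "\<And>x y. \<bar>f x - f y\<bar> \<le> L * dist x y" and \<epsilon>: "\<epsilon> > 0"
  shows "\<bar>conv f (lmoll \<epsilon>) x\<bar> \<le> L * (DIM('a) * 30 / \<epsilon> * measure lborel (cball (0::'a) \<epsilon>))"
proof -
  have L0: "L \<ge> 0" 
  proof -
    obtain e :: 'a where "e \<in> Basis" using nonempty_Basis by blast
    then show ?thesis using L[of e 0] by (simp add: norm_Basis) 
  qed
  note li = moll_integrable(2)[OF \<epsilon>, where 'a='a]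
  have i: "integrable lborel (\<lambda>z. f (x - z) * lmoll \<epsilon> z)"
    using integrable_reflect[OF conv_integrable[OF fi moll_measurable(2) lmoll_bound[OF \<epsilon>], where x = x], of x] by simp
  have "conv f (lmoll \<epsilon>) x = (\<integral>z. f (x - z) * lmoll \<epsilon> z \<partial>lborel) - (\<integral>z. f x * lmoll \<epsilon> (z::'a) \<partial>lborel)"
    by (simp add: conv_commute lmoll_integral[OF \<epsilon>])
  also have "\<dots> = (\<integral>z. f (x - z) * lmoll \<epsilon> z - f x * lmoll \<epsilon> z \<partial>lborel)"
    by (rule Bochner_Integration.integral_diff[symmetric]) (use i li in auto)
  also have "\<bar>\<dots>\<bar> \<le> (\<integral>z. \<bar>f (x - z) * lmoll \<epsilon> z - f x * lmoll \<epsilon> z\<bar> \<partial>lborel)"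
    using integral_norm_bound[of lborel "\<lambda>z. f (x - z) * lmoll \<epsilon> z - f x * lmoll \<epsilon> z"] by simp
  also have "\<dots> \<le> (\<integral>z. L * \<epsilon> * \<bar>lmoll \<epsilon> (z::'a)\<bar> \<partial>lborel)"
  proof (rule integral_mono)
    fix z :: 'a
    show "\<bar>f (x - z) * lmoll \<epsilon> z - f x * lmoll \<epsilon> z\<bar> \<le> L * \<epsilon> * \<bar>lmoll \<epsilon> z\<bar>"
    proof (cases "norm z \<ge> \<epsilon>")
      case False
      have "\<bar>f (x - z) - f x\<bar> \<le> L * norm z" using L[of "x - z" x] by (simp add: dist_norm)
      also have "\<dots> \<le> L * \<epsilon>" using False L0 by (intro mult_left_mono) auto
      finally show ?thesis by (simp add: left_diff_distrib[symmetric] abs_mult mult_right_mono)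
    qed (simp add: moll_outside(4)[OF \<epsilon>])
  qed (use i li in auto)
  also have "\<dots> = L * \<epsilon> * (\<integral>z. \<bar>lmoll \<epsilon> (z::'a)\<bar> \<partial>lborel)" by simp
  also have "\<dots> \<le> L * \<epsilon> * (DIM('a) * 30 / \<epsilon>\<^sup>2 * measure lborel (cball (0::'a) \<epsilon>))"
    using L0 \<epsilon> by (intro mult_left_mono moll_integrable(3)) auto
  also have "\<dots> = L * (DIM('a) * 30 / \<epsilon> * measure lborel (cball (0::'a) \<epsilon>))"
    using \<epsilon> by (simp add: power2_eq_square)
  finally show ?thesis .
qed

lemma cball_half_measure:
  assumes "\<epsilon> > 0"
  shows "measure lborel (cball (0::'a::euclidean_space) \<epsilon>) = 2 ^ DIM('a) * measure lborel (cball (0::'a) (\<epsilon> / 2))"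
  using content_ball_conv_unit_ball[of \<epsilon> "0::'a"] content_ball_conv_unit_ball[of "\<epsilon>/2" "0::'a"] assms
  by (simp add: content_cball_conv_ball power_divide)

locale exterior_ball_domain =
  fixes \<Omega> :: "'a::euclidean_space set" and r :: real
  assumes op: "open \<Omega>" and bd: "bounded \<Omega>" and r: "r > 0"
    and ext: "\<And>p. p \<in> frontier \<Omega> \<Longrightarrow> \<exists>y. dist p y = r \<and> ball y r \<inter> \<Omega> = {}"
begin

definition \<delta> :: "'a \<Rightarrow> real" where "\<delta> x = infdist x (- \<Omega>)"

lemma compl_ne: "- \<Omega> \<noteq> {}"
  using bd not_bounded_UNIV by (metis Compl_empty_eq double_compl)

lemma \<delta>_nonneg: "0 \<le> \<delta> x" by (simp add: \<delta>_def infdist_nonneg)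
lemma \<delta>_outside: "x \<notin> \<Omega> \<Longrightarrow> \<delta> x = 0" by (simp add: \<delta>_def)
lemma \<delta>_le: "z \<notin> \<Omega> \<Longrightarrow> \<delta> x \<le> dist x z" by (simp add: \<delta>_def infdist_le)
lemma \<delta>_lip: "\<delta> x \<le> \<delta> y + dist x y"
  unfolding \<delta>_def using infdist_triangle by blast
lemma \<delta>_pos: "x \<in> \<Omega> \<longleftrightarrow> \<delta> x > 0"
  using op compl_ne in_closed_iff_infdist_zero[of "- \<Omega>" x] \<delta>_nonneg[of x] by (auto simp: \<delta>_def less_le)
lemma \<delta>_measurable [measurable]: "\<delta> \<in> borel_measurable borel"
  unfolding \<delta>_def[abs_def] by (intro borel_measurable_continuous_onI continuous_intros)

lemma \<delta>_frontier:
  assumes "x \<in> \<Omega>" obtains p where "p \<in> frontier \<Omega>" "dist x p = \<delta> x"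
proof -
  obtain z where z: "z \<notin> \<Omega>" "\<delta> x = dist x z"
    using infdist_attains_inf[of "- \<Omega>" x] op compl_ne by (auto simp: \<delta>_def)
  have "closed_segment x z \<inter> frontier \<Omega> \<noteq> {}"
    by (rule connected_Int_frontier) (use assms z in auto)
  then obtain p where p: "p \<in> closed_segment x z" "p \<in> frontier \<Omega>" by blast
  have "dist x p \<le> \<delta> x" using z segment_bound[OF p(1)] by (simp add: dist_norm norm_minus_commute)
  moreover have "p \<notin> \<Omega>" using p(2) op by (simp add: frontier_def interior_open)
  ultimately show ?thesis using \<delta>_le[of p x] p(2) by (intro that[of p]) auto
qed

text \<open>The centre of the exterior ball at the nearest boundary point: equality at \<open>x\<close> and the one-sided
  bound throughout \<open>\<Omega>\<close> make the distance to \<open>y\<close> touch \<open>r + \<delta>\<close> from above.\<close>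

lemma \<delta>_touching:
  assumes "x \<in> \<Omega>"
  obtains y where "dist x y = r + \<delta> x" "\<forall>x'\<in>\<Omega>. r + \<delta> x' \<le> dist x' y"
proof -
  obtain p where p: "p \<in> frontier \<Omega>" "dist x p = \<delta> x" by (rule \<delta>_frontier[OF assms])
  obtain y where y: "dist p y = r" "ball y r \<inter> \<Omega> = {}" using ext[OF p(1)] by blast
  have ge: "r + \<delta> x' \<le> dist x' y" if x': "x' \<in> \<Omega>" for x'
  proof -
    let ?D = "dist x' y"
    have D: "?D \<ge> r" using y(2) x' by (force simp: dist_commute)
    have ny: "x' \<noteq> y" using D r by (metis dist_self linorder_not_less)
    have q1: "r / ?D \<le> 1" using D r ny by simp
    define q where "q = y + (r / ?D) *\<^sub>R (x' - y)"
    have "dist y q = r" using ny r by (simp add: q_def dist_norm)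
    then have "q \<in> closure (ball y r)" using r by simp
    moreover have "closure (ball y r) \<subseteq> - \<Omega>" using y(2) op by (intro closure_minimal) auto
    ultimately have "\<delta> x' \<le> dist x' q" by (intro \<delta>_le) auto
    also have "x' - q = (1 - r / ?D) *\<^sub>R (x' - y)" by (simp add: q_def algebra_simps)
    then have "dist x' q = (1 - r / ?D) * ?D" using q1 by (simp add: dist_norm[of x' q]) (simp add: dist_norm)
    also have "\<dots> = ?D - r" using ny by (simp add: field_simps)
    finally show ?thesis by simp
  qed
  have "dist x y \<le> r + \<delta> x" using dist_triangle[of x y p] p(2) y(1) by simp
  then have "dist x y = r + \<delta> x" using ge[OF assms] by simp
  then show ?thesis using ge by (intro that[of y]) auto
qed

text \<open>The rate is the smallest for which \<open>dlap_gaussian\<close> applies at distance \<open>r\<close> from the centre.\<close>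

definition l :: real where "l = DIM('a) / r\<^sup>2"
definition E :: "'a \<Rightarrow> real" where "E x = exp (- l * (r + \<delta> x)\<^sup>2)"

lemma l_pos: "l > 0" using r by (simp add: l_def)

lemma E_measurable [measurable]: "E \<in> borel_measurable borel"
  unfolding E_def[abs_def] by measurable

text \<open>\<open>E\<close> touches a Gaussian from above at \<open>x\<close>, so its second differences there are at least those of the
  Gaussian. This needs no regularity of \<open>\<delta>\<close>.\<close>

lemma dlap_E:
  assumes x: "x \<in> \<Omega>" and t: "0 < t" "t < \<delta> x" "l * t\<^sup>2 \<le> 1 / 4"
  shows "l * DIM('a) * E x \<le> dlap t E x"
proof -
  obtain y where y: "dist x y = r + \<delta> x" "\<forall>x'\<in>\<Omega>. r + \<delta> x' \<le> dist x' y"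
    by (rule \<delta>_touching[OF x])
  let ?g = "\<lambda>z::'a. exp (- l * (z \<bullet> z))"
  have dq: "(x' - y) \<bullet> (x' - y) = (dist x' y)\<^sup>2" for x' by (simp add: dist_norm power2_norm_eq_inner)
  have Ex: "E x = ?g (x - y)" by (simp add: E_def dq y(1))
  have E_ge: "?g (x' - y) \<le> E x'" if "x' \<in> \<Omega>" for x'
    using bspec[OF y(2) that] r \<delta>_nonneg[of x'] l_pos by (auto simp: E_def dq intro!: mult_left_mono power_mono)
  have "real DIM('a) = l * r\<^sup>2" using r by (simp add: l_def)
  also have "\<dots> \<le> l * ((x - y) \<bullet> (x - y))"
    unfolding dq y(1) using l_pos r \<delta>_nonneg[of x] by (intro mult_left_mono power_mono) auto
  finally have "l * DIM('a) * ?g (x - y) \<le> dlap t ?g (x - y)"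
    by (rule dlap_gaussian[OF l_pos t(1,3)])
  also have "\<dots> \<le> dlap t E x"
    unfolding dlap_def
  proof (intro sum_mono divide_right_mono)
    fix e :: 'a assume e: "e \<in> Basis"
    have "x + t *\<^sub>R e \<in> \<Omega>" "x - t *\<^sub>R e \<in> \<Omega>"
      using \<delta>_le[of "x + t *\<^sub>R e" x] \<delta>_le[of "x - t *\<^sub>R e" x] t(1,2) e by (auto simp: dist_norm)
    from E_ge[OF this(1)] E_ge[OF this(2)]
    show "sdiff t e ?g (x - y) \<le> sdiff t e E x"
      by (simp add: sdiff_def Ex algebra_simps)
  qed simp
  finally show ?thesis by (simp add: Ex)
qed

lemma \<delta>_bounded: obtains D where "D > 0" "\<And>x. \<delta> x \<le> D"
proof -
  obtain q where q: "q \<notin> \<Omega>" using compl_ne by auto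
  obtain B where B: "\<And>x. x \<in> \<Omega> \<Longrightarrow> dist x q \<le> B" using bd bounded_any_center[of \<Omega> q] by (auto simp: dist_commute)
  have "\<delta> x \<le> \<bar>B\<bar> + 1" for x
    using B[of x] \<delta>_le[OF q, of x] \<delta>_outside[of x] by (cases "x \<in> \<Omega>") auto
  then show ?thesis by (intro that[of "\<bar>B\<bar> + 1"]) auto
qed

text \<open>The threshold \<open>2 \<epsilon>\<close> leaves room for one mollification at scale \<open>\<epsilon>\<close>: the mollified
  function is still supported where \<open>\<delta> \<ge> \<epsilon>\<close>.\<close>

definition barrier :: "real \<Rightarrow> 'a \<Rightarrow> real" where
  "barrier \<epsilon> x = max 0 (exp (- l * (r + 2 * \<epsilon>)\<^sup>2) - E x)"

lemma barrier_measurable [measurable]: "barrier \<epsilon> \<in> borel_measurable borel"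
  unfolding barrier_def[abs_def] by measurable

lemma barrier_bounds: "0 \<le> barrier \<epsilon> x" "barrier \<epsilon> x \<le> 1" "\<bar>barrier \<epsilon> x\<bar> \<le> 1"
proof -
  have "exp (- l * (r + 2 * \<epsilon>)\<^sup>2) \<le> 1" using l_pos by simp
  moreover have "E x \<ge> 0" by (simp add: E_def)
  ultimately have "exp (- l * (r + 2 * \<epsilon>)\<^sup>2) - E x \<le> 1" by linarith
  then show "0 \<le> barrier \<epsilon> x" "barrier \<epsilon> x \<le> 1" "\<bar>barrier \<epsilon> x\<bar> \<le> 1" by (auto simp: barrier_def)
qed

lemma barrier_zero:
  assumes "\<epsilon> > 0" "\<delta> x \<le> 2 * \<epsilon>" shows "barrier \<epsilon> x = 0"
proof -
  have "l * (r + \<delta> x)\<^sup>2 \<le> l * (r + 2 * \<epsilon>)\<^sup>2"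
    using l_pos r assms \<delta>_nonneg[of x] by (intro mult_left_mono power_mono) auto
  then show ?thesis by (simp add: barrier_def E_def)
qed

lemma barrier_eq:
  assumes "\<epsilon> > 0" "\<delta> x \<ge> 2 * \<epsilon>" shows "barrier \<epsilon> x = exp (- l * (r + 2 * \<epsilon>)\<^sup>2) - E x"
proof -
  have "l * (r + 2 * \<epsilon>)\<^sup>2 \<le> l * (r + \<delta> x)\<^sup>2"
    using l_pos r assms by (intro mult_left_mono power_mono) auto
  then show ?thesis by (simp add: barrier_def E_def)
qed

lemma barrier_lipschitz:
  assumes D: "\<And>x. \<delta> x \<le> D"
  shows "\<bar>barrier \<epsilon> x - barrier \<epsilon> y\<bar> \<le> 2 * l * (r + D) * dist x y"
proof -
  have ex: "\<bar>exp (- u) - exp (- v)\<bar> \<le> \<bar>u - v\<bar>" if "u \<ge> 0" "v \<ge> 0" for u v :: real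
  proof -
    have *: "exp (- u) - exp (- v) \<le> v - u" if "0 \<le> u" "u \<le> v" for u v :: real
    proof -
      have "exp (- u) - exp (- v) = exp (- u) * (1 - exp (u - v))"
        by (simp add: algebra_simps exp_add[symmetric])
      also have "\<dots> \<le> 1 * (v - u)"
      proof (intro mult_mono)
        show "1 - exp (u - v) \<le> v - u" using exp_ge_add_one_self[of "u - v"] by linarith
      qed (use that in auto)
      finally show ?thesis by simp
    qed
    show ?thesis using *[of u v] *[of v u] that by (cases "u \<le> v") (auto simp: abs_if)
  qed
  have "\<bar>barrier \<epsilon> x - barrier \<epsilon> y\<bar> \<le> \<bar>E x - E y\<bar>" unfolding barrier_def max_def by (simp split: if_split) linarith
  also have "\<dots> \<le> \<bar>l * (r + \<delta> x)\<^sup>2 - l * (r + \<delta> y)\<^sup>2\<bar>"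
    using ex[of "l * (r + \<delta> x)\<^sup>2" "l * (r + \<delta> y)\<^sup>2"] l_pos by (simp add: E_def)
  also have "l * (r + \<delta> x)\<^sup>2 - l * (r + \<delta> y)\<^sup>2 = l * ((r + \<delta> x) + (r + \<delta> y)) * (\<delta> x - \<delta> y)"
    by (simp add: algebra_simps power2_eq_square)
  also have "\<bar>\<dots>\<bar> \<le> l * (2 * (r + D)) * dist x y"
    unfolding abs_mult
    using \<delta>_lip[of x y] \<delta>_lip[of y x] D[of x] D[of y] \<delta>_nonneg[of x] \<delta>_nonneg[of y] r l_pos
    by (intro mult_mono) (auto simp: dist_commute)
  finally show ?thesis by (simp add: algebra_simps)
qed

lemma barrier_support:
  obtains R where "\<And>\<epsilon> x. \<epsilon> > 0 \<Longrightarrow> norm x > R \<Longrightarrow> barrier \<epsilon> x = 0" "\<And>\<epsilon>. \<epsilon> > 0 \<Longrightarrow> integrable lborel (barrier \<epsilon>)"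
proof -
  obtain R where R: "\<And>x. x \<in> \<Omega> \<Longrightarrow> norm x \<le> R" using bd by (auto simp: bounded_iff)
  have z: "barrier \<epsilon> x = 0" if "\<epsilon> > 0" "norm x > R" for \<epsilon> x
  proof (rule barrier_zero)
    have "x \<notin> \<Omega>" using R[of x] that by linarith
    then show "\<delta> x \<le> 2 * \<epsilon>" using that by (simp add: \<delta>_outside)
  qed (use that in simp)
  have "integrable lborel (barrier \<epsilon>)" if "\<epsilon> > 0" for \<epsilon>
    by (rule integrable_compact_support(1)[OF _ barrier_bounds(3), where c = 0 and R = R]) (use z that in auto)
  with z show ?thesis by (rule that)
qed

text \<open>Where \<open>\<delta> > 4 \<epsilon>\<close>, the points that enter the convolution, and their neighbours at a small step, have
  \<open>\<delta> \<ge> 2 \<epsilon>\<close>; there the truncation is inactive and the discrete Laplacian of the barrier is that of \<open>- E\<close>.\<close>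

lemma barrier_superharmonic:
  assumes D: "\<And>x. \<delta> x \<le> D" and \<epsilon>: "\<epsilon> > 0" and x: "\<delta> x > 4 * \<epsilon>" and fi: "integrable lborel (barrier \<epsilon>)"
  shows "conv (barrier \<epsilon>) (lmoll \<epsilon>) x \<le> - (l * DIM('a) * exp (- l * (r + D)\<^sup>2)) * mass TYPE('a) \<epsilon>"
proof -
  let ?c = "l * DIM('a) * exp (- l * (r + D)\<^sup>2)"
  define s where "s = (\<lambda>j. inverse (real (Suc j)))"
  have s: "\<And>j. 0 < s j" "s \<longlonglongrightarrow> 0"
    using LIMSEQ_inverse_real_of_nat by (auto simp: s_def)
  have lim: "(\<lambda>j. dlap (s j) (conv (barrier \<epsilon>) (moll \<epsilon>)) x) \<longlonglongrightarrow> conv (barrier \<epsilon>) (lmoll \<epsilon>) x"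
    by (rule conv_dlap_moll_tendsto(1)[OF fi \<epsilon> s])
  have "(\<lambda>j. l * (s j)\<^sup>2) \<longlonglongrightarrow> l * 0\<^sup>2" by (intro tendsto_intros s)
  then have "\<forall>\<^sub>F j in sequentially. l * (s j)\<^sup>2 < 1 / 4" by (rule order_tendstoD) simp
  moreover have "\<forall>\<^sub>F j in sequentially. s j < \<epsilon>" by (rule order_tendstoD(2)[OF s(2) \<epsilon>])
  ultimately have "\<forall>\<^sub>F j in sequentially. dlap (s j) (conv (barrier \<epsilon>) (moll \<epsilon>)) x \<le> - ?c * mass TYPE('a) \<epsilon>"
  proof eventually_elim
    case (elim j)
    let ?t = "s j"
    note mi = moll_integrable(1)[OF \<epsilon>, where 'a='a]
    have comm: "conv (barrier \<epsilon>) (moll \<epsilon>) = conv (moll \<epsilon>) (barrier \<epsilon>)"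
      by (simp add: fun_eq_iff conv_commute[of "barrier \<epsilon>" "moll \<epsilon>"] conv_def[of "moll \<epsilon>"] mult.commute)
    have pt: "moll \<epsilon> y * dlap ?t (barrier \<epsilon>) (x - y) \<le> moll \<epsilon> y * (- ?c)" for y
    proof (cases "norm y \<ge> \<epsilon>")
      case False
      have d: "\<delta> (x - y) > 3 * \<epsilon>" using \<delta>_lip[of x "x - y"] x False by (simp add: dist_norm)
      then have "x - y \<in> \<Omega>" using \<epsilon> by (subst \<delta>_pos) simp
      then have "l * DIM('a) * E (x - y) \<le> dlap ?t E (x - y)"
        by (rule dlap_E) (use d elim s(1)[of j] in auto)
      moreover have "l * DIM('a) * exp (- l * (r + D)\<^sup>2) \<le> l * DIM('a) * E (x - y)"
        unfolding E_def using l_pos r D[of "x - y"] \<delta>_nonneg[of "x - y"]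
        by (intro mult_left_mono) (auto intro!: mult_left_mono power_mono)
      moreover have "dlap ?t (barrier \<epsilon>) (x - y) = - dlap ?t E (x - y)"
        unfolding dlap_def sum_negf[symmetric]
      proof (rule sum.cong[OF refl])
        fix e :: 'a assume e: "e \<in> Basis"
        have "\<delta> (x - y + ?t *\<^sub>R e) \<ge> 2 * \<epsilon>" "\<delta> (x - y - ?t *\<^sub>R e) \<ge> 2 * \<epsilon>"
          using \<delta>_lip[of "x - y" "x - y + ?t *\<^sub>R e"] \<delta>_lip[of "x - y" "x - y - ?t *\<^sub>R e"] d elim e s(1)[of j]
          by (auto simp: dist_norm)
        then show "sdiff ?t e (barrier \<epsilon>) (x - y) / ?t\<^sup>2 = - (sdiff ?t e E (x - y) / ?t\<^sup>2)"
          using d \<epsilon> by (simp add: sdiff_def barrier_eq add_divide_distrib diff_divide_distrib)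
      qed
      ultimately show ?thesis by (intro mult_left_mono moll_bounds) simp
    qed (simp add: moll_outside(1)[OF \<epsilon>])
    have "dlap ?t (conv (barrier \<epsilon>) (moll \<epsilon>)) x = conv (moll \<epsilon>) (dlap ?t (barrier \<epsilon>)) x"
      unfolding comm by (rule dlap_conv[OF mi _ barrier_bounds(3)]) measurable
    also have "\<dots> \<le> (\<integral>y. moll \<epsilon> (y::'a) * (- ?c) \<partial>lborel)"
      unfolding conv_def
    proof (rule integral_mono)
      have "\<bar>dlap ?t (barrier \<epsilon>) z\<bar> \<le> (\<Sum>e\<in>(Basis::'a set). 4 * 1 / ?t\<^sup>2)" for z
        unfolding dlap_def
        by (intro order_trans[OF sum_abs] sum_mono, unfold abs_divide, simp, intro divide_right_mono)
          (use sdiff_abs_le[OF barrier_bounds(3)] in auto)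
      then show "integrable lborel (\<lambda>y. moll \<epsilon> y * dlap ?t (barrier \<epsilon>) (x - y))"
        by (intro conv_integrable[OF mi]) measurable
    qed (use mi pt in auto)
    also have "\<dots> = - ?c * mass TYPE('a) \<epsilon>" by (simp add: mass_def)
    finally show ?case .
  qed
  then show ?thesis by (rule tendsto_upperbound[OF lim]) simp
qed

text \<open>The mollified barrier is the test function. Its Laplacian is at most a negative multiple of \<open>\<epsilon>\<^sup>n\<close> where
  \<open>\<delta> > 4 \<epsilon>\<close> and at most a multiple of \<open>\<epsilon>\<^sup>n / \<epsilon>\<close> elsewhere, because the mollifier is not normalised; both
  bounds are expressed through the measure of the same ball, which cancels.\<close>

lemma kato_uniqueness:
  fixes w g V :: "'a \<Rightarrow> real"
  assumes w: "integrable lborel w" and g: "integrable lborel g"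
    and w0: "\<And>x. x \<notin> \<Omega> \<Longrightarrow> w x = 0"
    and gV: "\<And>x. g x = V x * w x" "\<And>x. V x \<ge> 0"
    and weak: "\<And>x \<eta>. \<eta> > 0 \<Longrightarrow> cball x \<eta> \<subseteq> \<Omega> \<Longrightarrow> conv w (lmoll \<eta>) x = conv g (moll \<eta>) x"
    and decay: "((\<lambda>\<epsilon>. 1 / \<epsilon> * (\<integral>x. \<bar>w x\<bar> * indicator {x. \<delta> x \<le> \<epsilon>} x \<partial>lborel)) \<longlongrightarrow> 0) (at_right 0)"
  shows "AE x in lborel. w x = 0"
proof -
  have [measurable]: "w \<in> borel_measurable borel" using w by auto
  obtain D where D: "D > 0" "\<And>x. \<delta> x \<le> D" using \<delta>_bounded by metis
  obtain R where R: "\<And>\<epsilon> x. \<epsilon> > 0 \<Longrightarrow> norm x > R \<Longrightarrow> barrier \<epsilon> x = 0" "\<And>\<epsilon>. \<epsilon> > 0 \<Longrightarrow> integrable lborel (barrier \<epsilon>)"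
    using barrier_support by metis
  define L where "L = 2 * l * (r + D)"
  define c where "c = l * DIM('a) * exp (- l * (r + D)\<^sup>2)"
  define out where "out = (\<lambda>\<epsilon>. \<integral>x. \<bar>w x\<bar> * indicator {x. \<delta> x > \<epsilon>} x \<partial>lborel)"
  define bl where "bl = (\<lambda>\<epsilon>. \<integral>x. \<bar>w x\<bar> * indicator {x. \<delta> x \<le> \<epsilon>} x \<partial>lborel)"
  have c: "c > 0" using l_pos by (simp add: c_def)
  have L: "L > 0" using l_pos r D(1) by (simp add: L_def)
  have iw: "integrable lborel (\<lambda>x. \<bar>w x\<bar> * indicator {x. \<delta> x > \<epsilon>} x)"
    "integrable lborel (\<lambda>x. \<bar>w x\<bar> * indicator {x. \<delta> x \<le> \<epsilon>} x)" for \<epsilon>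
    by (rule Bochner_Integration.integrable_bound[OF w]; auto simp: indicator_def)+
  \<comment> \<open>The constant is the Lipschitz bound divided by the superharmonicity bound: \<open>2 ^ DIM('a)\<close> compares the
     ball of radius \<open>\<epsilon>\<close> with that of radius \<open>\<epsilon> / 2\<close>, where the mollifier is at least \<open>27 / 64\<close>.\<close>
  have est: "out (4 * \<epsilon>) \<le> (L * 30 * DIM('a) * 2 ^ DIM('a) * 64 / (27 * c)) / \<epsilon> * bl (4 * \<epsilon>)" if \<epsilon>: "\<epsilon> > 0" for \<epsilon>
  proof -
    let ?T = "conv (barrier \<epsilon>) (lmoll \<epsilon>)"
    let ?m = "measure lborel (cball (0::'a) (\<epsilon> / 2))"
    let ?B = "L * (DIM('a) * 30 / \<epsilon> * (2 ^ DIM('a) * ?m))"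
    let ?A = "c * (27 / 64 * ?m)"
    have m: "?m > 0" using content_cball_pos[of "\<epsilon> / 2" "0::'a"] \<epsilon> by simp
    have 0: "0 \<le> (\<integral>x. \<bar>w x\<bar> * ?T x \<partial>lborel)"
    proof (rule kato_inequality[OF w g gV weak R(2)[OF \<epsilon>] barrier_bounds(1) R(1)[OF \<epsilon>] \<epsilon> \<epsilon>])
      fix x assume nz: "conv (barrier \<epsilon>) (moll \<epsilon>) x \<noteq> 0"
      show "cball x \<epsilon> \<subseteq> \<Omega>"
      proof (rule ccontr)
        assume "\<not> cball x \<epsilon> \<subseteq> \<Omega>"
        then obtain z where "z \<notin> \<Omega>" "dist x z \<le> \<epsilon>" by (meson mem_cball subsetI)
        then have dx: "\<delta> x \<le> \<epsilon>" using \<delta>_le[of z x] by simp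
        have "barrier \<epsilon> y * moll \<epsilon> (x - y) = 0" for y
        proof (cases "norm (x - y) \<ge> \<epsilon>")
          case False
          then have "\<delta> y \<le> 2 * \<epsilon>" using \<delta>_lip[of y x] dx by (simp add: dist_norm norm_minus_commute)
          then show ?thesis using barrier_zero[OF \<epsilon>] by simp
        qed (simp add: moll_outside(1)[OF \<epsilon>])
        then have "(\<lambda>y. barrier \<epsilon> y * moll \<epsilon> (x - y)) = (\<lambda>_. 0)" by blast
        then show False using nz by (simp add: conv_def)
      qed
    qed
    have upper: "\<bar>w x\<bar> * ?T x \<le> - ?A * (\<bar>w x\<bar> * indicator {x. \<delta> x > 4 * \<epsilon>} x) + ?B * (\<bar>w x\<bar> * indicator {x. \<delta> x \<le> 4 * \<epsilon>} x)" for x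
    proof (cases "\<delta> x > 4 * \<epsilon>")
      case True
      have "?T x \<le> - c * mass TYPE('a) \<epsilon>"
        unfolding c_def by (rule barrier_superharmonic[OF D(2) \<epsilon> True R(2)[OF \<epsilon>]])
      also have "\<dots> \<le> - ?A" using mass_lower(1)[OF \<epsilon>, where 'a='a] c by simp
      finally have "\<bar>w x\<bar> * ?T x \<le> \<bar>w x\<bar> * (- ?A)" by (rule mult_left_mono) simp
      then show ?thesis using True by (simp add: mult.commute)
    next
      case False
      have "\<bar>?T x\<bar> \<le> L * (DIM('a) * 30 / \<epsilon> * measure lborel (cball (0::'a) \<epsilon>))"
        unfolding L_def by (rule conv_lmoll_lipschitz[OF _ R(2)[OF \<epsilon>] barrier_lipschitz[OF D(2)] \<epsilon>]) measurable
      then have "?T x \<le> ?B" unfolding cball_half_measure[OF \<epsilon>] by simp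
      then have "\<bar>w x\<bar> * ?T x \<le> \<bar>w x\<bar> * ?B" by (rule mult_left_mono) simp
      then show ?thesis using False by (simp add: mult.commute)
    qed
    have "\<bar>?T x\<bar> \<le> DIM('a) * 30 / \<epsilon>\<^sup>2 * (\<integral>y. \<bar>barrier \<epsilon> y\<bar> \<partial>lborel)" for x
      by (rule conv_bound[OF R(2)[OF \<epsilon>] lmoll_bound[OF \<epsilon>]]) measurable
    from integrable_bounded_mult[OF _ this integrable_abs[OF w]]
    have iT: "integrable lborel (\<lambda>x. \<bar>w x\<bar> * ?T x)" by (simp add: mult.commute)
    have "(\<integral>x. \<bar>w x\<bar> * ?T x \<partial>lborel) \<le>
       (\<integral>x. - ?A * (\<bar>w x\<bar> * indicator {x. \<delta> x > 4 * \<epsilon>} x) + ?B * (\<bar>w x\<bar> * indicator {x. \<delta> x \<le> 4 * \<epsilon>} x) \<partial>lborel)"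
      by (intro integral_mono iT upper Bochner_Integration.integrable_add integrable_mult_right iw)
    also have "\<dots> = - ?A * out (4 * \<epsilon>) + ?B * bl (4 * \<epsilon>)"
      unfolding out_def bl_def
      by (subst Bochner_Integration.integral_add) (use iw in \<open>auto intro!: integrable_mult_right\<close>)
    finally have "?A * out (4 * \<epsilon>) \<le> ?B * bl (4 * \<epsilon>)" using 0 by simp
    then have "?m * (c * (27 / 64) * out (4 * \<epsilon>)) \<le> ?m * (L * (DIM('a) * 30 / \<epsilon> * 2 ^ DIM('a)) * bl (4 * \<epsilon>))"
      by (simp add: ac_simps)
    then have "c * (27 / 64) * out (4 * \<epsilon>) \<le> L * (DIM('a) * 30 / \<epsilon> * 2 ^ DIM('a)) * bl (4 * \<epsilon>)"
      by (rule mult_le_cancel_left_pos[OF m, THEN iffD1])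
    then have "out (4 * \<epsilon>) \<le> L * (DIM('a) * 30 / \<epsilon> * 2 ^ DIM('a)) * bl (4 * \<epsilon>) / (c * (27 / 64))"
    proof (subst pos_le_divide_eq)
      show "0 < c * (27 / 64)" using c by simp
    qed (simp only: ac_simps)
    also have "\<dots> = (L * 30 * DIM('a) * 2 ^ DIM('a) * 64 / (27 * c)) / \<epsilon> * bl (4 * \<epsilon>)"
      using c \<epsilon> by (simp add: divide_simps)
    finally show ?thesis .
  qed
  define C where "C = L * 30 * DIM('a) * 2 ^ DIM('a) * 64 / (27 * c)"
  define s where "s = (\<lambda>j. inverse (real (Suc j)))"
  have s: "\<And>j. 0 < s j" "s \<longlonglongrightarrow> 0"
    using LIMSEQ_inverse_real_of_nat by (auto simp: s_def)
  have "filterlim s (at_right 0) sequentially"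
    using s by (auto simp: filterlim_at less_imp_neq[THEN not_sym] intro!: always_eventually)
  from filterlim_compose[OF decay this]
  have dec: "(\<lambda>j. 4 * C * (1 / s j * bl (s j))) \<longlonglongrightarrow> 0"
    unfolding bl_def by (rule tendsto_mult_right_zero)
  have "out (s j) \<le> 4 * C * (1 / s j * bl (s j))" for j
    using est[of "s j / 4"] s(1)[of j] by (simp add: C_def)
  moreover have "0 \<le> out \<epsilon>" for \<epsilon> unfolding out_def by (intro integral_nonneg_AE AE_I2) auto
  ultimately have out0: "(\<lambda>j. out (s j)) \<longlonglongrightarrow> 0"
    by (intro tendsto_sandwich[OF _ _ tendsto_const dec]) auto
  have "out \<epsilon> \<le> 0" if "\<epsilon> > 0" for \<epsilon>
  proof (rule tendsto_lowerbound[OF out0])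
    have "\<forall>\<^sub>F j in sequentially. s j < \<epsilon>" by (rule order_tendstoD(2)[OF s(2) that])
    then show "\<forall>\<^sub>F j in sequentially. out \<epsilon> \<le> out (s j)"
    proof eventually_elim
      case (elim j)
      then show ?case unfolding out_def
        by (intro integral_mono iw mult_left_mono) (auto simp: indicator_def)
    qed
  qed simp
  then have out_zero: "out \<epsilon> = 0" if "\<epsilon> > 0" for \<epsilon>
    using \<open>\<And>\<epsilon>. 0 \<le> out \<epsilon>\<close> that by (metis order_antisym)
  have "AE x in lborel. \<bar>w x\<bar> * indicator {x. \<delta> x > s j} x = 0" for j
    using out_zero[OF s(1)] unfolding out_def
    by (subst (asm) integral_nonneg_eq_0_iff_AE[OF iw(1)]) auto
  then have "AE x in lborel. \<forall>j. \<bar>w x\<bar> * indicator {x. \<delta> x > s j} x = 0"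
    unfolding AE_all_countable by blast
  then show ?thesis
  proof eventually_elim
    case (elim x)
    show ?case
    proof (cases "x \<in> \<Omega>")
      case True
      then have "\<delta> x > 0" by (simp add: \<delta>_pos)
      from order_tendstoD(2)[OF s(2) this] obtain j where "s j < \<delta> x"
        by (auto simp: eventually_sequentially)
      with elim[rule_format, of j] show ?thesis by simp
    qed (rule w0)
  qed
qed

end

section \<open>Smooth domains have exterior balls\<close>

lemma c2_with_taylor:
  assumes f: "c2_with f D H"
  obtains \<xi> where "0 < \<xi>" "\<xi> < 1" "f (u + v) = f u + D u v + H (u + \<xi> *\<^sub>R v) v v / 2"
proof -
  have lin: "D y (c *\<^sub>R v) = c * D y v" "H y e (c *\<^sub>R v) = c * H y e v" for y c v e
    using has_derivative_linear[OF c2_with_D[OF f]] has_derivative_linear[OF c2_with_H[OF f]]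
    by (simp_all add: linear_cmul)
  have p: "((\<lambda>s::real. u + s *\<^sub>R v) has_derivative (\<lambda>s. s *\<^sub>R v)) (at s)" for s
    by (auto intro!: derivative_eq_intros)
  have 1: "((\<lambda>s. f (u + s *\<^sub>R v)) has_real_derivative D (u + s *\<^sub>R v) v) (at s)" for s
    unfolding has_field_derivative_def
    by (rule has_derivative_eq_rhs[OF has_derivative_compose[OF p c2_with_D[OF f]]]) (auto simp: lin)
  have 2: "((\<lambda>s. D (u + s *\<^sub>R v) v) has_real_derivative H (u + s *\<^sub>R v) v v) (at s)" for s
    unfolding has_field_derivative_def
    by (rule has_derivative_eq_rhs[OF has_derivative_compose[OF p c2_with_H[OF f]]]) (auto simp: lin)
  define diff where "diff = (\<lambda>n::nat. if n = 0 then (\<lambda>s. f (u + s *\<^sub>R v)) else if n = 1 then (\<lambda>s. D (u + s *\<^sub>R v) v) else (\<lambda>s. H (u + s *\<^sub>R v) v v))"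
  have "\<exists>\<xi>>0. \<xi> < 1 \<and> f (u + 1 *\<^sub>R v) = (\<Sum>m<2. diff m 0 / fact m * 1 ^ m) + diff 2 \<xi> / fact 2 * 1 ^ 2"
    by (rule Maclaurin) (use 1 2 in \<open>auto simp: diff_def less_2_cases_iff\<close>)
  then show ?thesis
    by (auto simp: diff_def numeral_2_eq_2 intro: that)
qed

text \<open>Partial derivatives along the basis determine the first derivative and its derivative in every
  direction by linearity.\<close>

lemma Ck_on_2_c2_with:
  fixes \<gamma> :: "'a::euclidean_space \<Rightarrow> real"
  assumes "Ck_on 2 UNIV \<gamma>"
  obtains D F where "c2_with \<gamma> D (\<lambda>x e v. \<Sum>b\<in>Basis. \<Sum>b'\<in>Basis. (e \<bullet> b) * (v \<bullet> b') * F b b' x)"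
    "\<forall>b\<in>Basis. \<forall>b'\<in>Basis. continuous_on UNIV (F b b')"
proof -
  define D where "D = (\<lambda>x. frechet_derivative \<gamma> (at x))"
  define F where "F = (\<lambda>b b' x. frechet_derivative (\<lambda>y. D y b) (at x) b')"
  have d1: "(\<gamma> has_derivative D x) (at x)" for x
    using assms by (simp add: numeral_2_eq_2 D_def frechet_derivative_works)
  have d2: "((\<lambda>y. D y b) has_derivative frechet_derivative (\<lambda>y. D y b) (at x)) (at x)" if "b \<in> Basis" for x b
    using assms that by (simp add: numeral_2_eq_2 D_def frechet_derivative_works[symmetric])
  have cF: "continuous_on UNIV (F b b')" if "b \<in> Basis" "b' \<in> Basis" for b b'
    using assms that by (simp add: numeral_2_eq_2 D_def F_def)
  have linsum: "L v = (\<Sum>b\<in>Basis. (v \<bullet> b) * L b)" if "linear L" for L :: "'a \<Rightarrow> real" and v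
  proof -
    have "L v = L (\<Sum>b\<in>Basis. (v \<bullet> b) *\<^sub>R b)" by (simp add: euclidean_representation)
    then show ?thesis by (simp add: linear_sum[OF that] linear_cmul[OF that])
  qed
  have De: "D x e = (\<Sum>b\<in>Basis. (e \<bullet> b) * D x b)" for x e
    by (rule linsum) (rule has_derivative_linear[OF d1])
  have Fe: "frechet_derivative (\<lambda>y. D y b) (at x) v = (\<Sum>b'\<in>Basis. (v \<bullet> b') * F b b' x)" if "b \<in> Basis" for b x v
    unfolding F_def by (rule linsum) (rule has_derivative_linear[OF d2[OF that]])
  have "c2_with \<gamma> D (\<lambda>x e v. \<Sum>b\<in>Basis. \<Sum>b'\<in>Basis. (e \<bullet> b) * (v \<bullet> b') * F b b' x)"
    unfolding c2_with_def
  proof (intro conjI allI)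
    fix x e v
    show "(\<gamma> has_derivative D x) (at x)" by (rule d1)
    have "((\<lambda>y. \<Sum>b\<in>Basis. (e \<bullet> b) * D y b) has_derivative
       (\<lambda>v. \<Sum>b\<in>Basis. (e \<bullet> b) * frechet_derivative (\<lambda>y. D y b) (at x) v)) (at x)"
      by (intro has_derivative_sum has_derivative_mult_right d2)
    moreover have "(\<lambda>v. \<Sum>b\<in>Basis. (e \<bullet> b) * frechet_derivative (\<lambda>y. D y b) (at x) v)
       = (\<lambda>v. \<Sum>b\<in>Basis. \<Sum>b'\<in>Basis. (e \<bullet> b) * (v \<bullet> b') * F b b' x)"
      by (intro ext sum.cong refl) (simp add: Fe sum_distrib_left mult.assoc)
    ultimately show "((\<lambda>y. D y e) has_derivative (\<lambda>v. \<Sum>b\<in>Basis. \<Sum>b'\<in>Basis. (e \<bullet> b) * (v \<bullet> b') * F b b' x)) (at x)"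
      by (simp add: De[symmetric])
    show "continuous_on UNIV (\<lambda>x. \<Sum>b\<in>Basis. \<Sum>b'\<in>Basis. (e \<bullet> b) * (v \<bullet> b') * F b b' x)"
      by (intro continuous_on_sum continuous_on_mult_left cF)
  qed
  then show ?thesis using cF by (intro that[of D F]) auto
qed

text \<open>\<open>G\<close> is the gradient; the quadratic lower bound is Taylor's formula with the second derivatives bounded on
  \<open>K\<close>, convexity keeping the intermediate point in \<open>K\<close>.\<close>

lemma C2_bounds_on_compact:
  fixes \<gamma> :: "'a::euclidean_space \<Rightarrow> real"
  assumes \<gamma>: "Ck_on 2 UNIV \<gamma>" and K: "compact K" "convex K"
  obtains G M B where "\<forall>u\<in>K. \<forall>w\<in>K. \<gamma> w \<ge> \<gamma> u + G u \<bullet> (w - u) - M * (norm (w - u))\<^sup>2"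
    "\<forall>u\<in>K. norm (G u) \<le> B" "M > 0" "B > 0"
proof -
  obtain D F where c: "c2_with \<gamma> D (\<lambda>x e v. \<Sum>b\<in>Basis. \<Sum>b'\<in>Basis. (e \<bullet> b) * (v \<bullet> b') * F b b' x)"
    and cF: "\<forall>b\<in>Basis. \<forall>b'\<in>Basis. continuous_on UNIV (F b b')"
    by (rule Ck_on_2_c2_with[OF \<gamma>])
  define G where "G = (\<lambda>x. \<Sum>b\<in>Basis. D x b *\<^sub>R b)"
  have DG: "D x v = G x \<bullet> v" for x v
  proof -
    have l: "linear (D x)" by (rule has_derivative_linear[OF c2_with_D[OF c]])
    have "D x v = D x (\<Sum>b\<in>Basis. (v \<bullet> b) *\<^sub>R b)" by (simp only: euclidean_representation)
    also have "\<dots> = (\<Sum>b\<in>Basis. (v \<bullet> b) * D x b)" by (simp add: linear_sum[OF l] linear_cmul[OF l])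
    also have "\<dots> = G x \<bullet> v" by (simp add: G_def inner_sum_left inner_commute[of v] mult.commute)
    finally show ?thesis .
  qed
  have "continuous_on UNIV G"
    unfolding G_def by (intro continuous_on_sum continuous_on_scaleR continuous_on_const c2_with_continuous(2)[OF c])
  then have "compact (G ` K)"
    by (rule compact_continuous_image[OF continuous_on_subset[OF _ subset_UNIV] K(1)])
  then obtain B where B: "B > 0" "\<And>u. u \<in> K \<Longrightarrow> norm (G u) \<le> B"
    using compact_imp_bounded[of "G ` K"] by (auto simp: bounded_pos)
  define S where "S = (\<lambda>x. \<Sum>b\<in>Basis. \<Sum>b'\<in>Basis. \<bar>F b b' x\<bar>)"
  have "continuous_on UNIV S"
    unfolding S_def using cF by (intro continuous_on_sum continuous_on_rabs) auto
  then have "compact (S ` K)"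
    by (rule compact_continuous_image[OF continuous_on_subset[OF _ subset_UNIV] K(1)])
  then obtain M where M: "M > 0" "\<And>u. u \<in> K \<Longrightarrow> \<bar>S u\<bar> \<le> M"
    using compact_imp_bounded[of "S ` K"] by (auto simp: bounded_pos)
  have "\<gamma> w \<ge> \<gamma> u + G u \<bullet> (w - u) - M * (norm (w - u))\<^sup>2" if u: "u \<in> K" and w: "w \<in> K" for u w
  proof -
    let ?v = "w - u"
    obtain \<xi> where \<xi>: "0 < \<xi>" "\<xi> < 1" "\<gamma> (u + ?v) = \<gamma> u + D u ?v +
        (\<Sum>b\<in>Basis. \<Sum>b'\<in>Basis. (?v \<bullet> b) * (?v \<bullet> b') * F b b' (u + \<xi> *\<^sub>R ?v)) / 2"
      by (rule c2_with_taylor[OF c])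
    have "u + \<xi> *\<^sub>R ?v = (1 - \<xi>) *\<^sub>R u + \<xi> *\<^sub>R w" by (simp add: algebra_simps)
    then have z: "u + \<xi> *\<^sub>R ?v \<in> K" using convexD[OF K(2) u w, of "1 - \<xi>" \<xi>] \<xi> by simp
    have "\<bar>\<Sum>b\<in>Basis. \<Sum>b'\<in>Basis. (?v \<bullet> b) * (?v \<bullet> b') * F b b' (u + \<xi> *\<^sub>R ?v)\<bar>
      \<le> (\<Sum>b\<in>Basis. \<Sum>b'\<in>Basis. norm ?v * norm ?v * \<bar>F b b' (u + \<xi> *\<^sub>R ?v)\<bar>)"
      by (intro order_trans[OF sum_abs] sum_mono, unfold abs_mult, intro mult_mono Basis_le_norm) auto
    also have "\<dots> = (norm ?v)\<^sup>2 * S (u + \<xi> *\<^sub>R ?v)"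
      by (simp add: S_def sum_distrib_left power2_eq_square)
    also have "\<dots> \<le> (norm ?v)\<^sup>2 * M" using M(2)[OF z] by (intro mult_left_mono) auto
    finally have "\<bar>\<Sum>b\<in>Basis. \<Sum>b'\<in>Basis. (?v \<bullet> b) * (?v \<bullet> b') * F b b' (u + \<xi> *\<^sub>R ?v)\<bar> \<le> M * (norm ?v)\<^sup>2"
      by (simp add: mult.commute)
    moreover have "0 \<le> M * (norm ?v)\<^sup>2" using M by simp
    ultimately show ?thesis using \<xi>(3) DG[of u ?v] by simp
  qed
  then show ?thesis using B(2) M(1) B(1) by (intro that[of G M B]) auto
qed

lemma smaller_exterior_ball:
  fixes p y :: "'a::euclidean_space"
  assumes "dist p y = r" "ball y r \<inter> \<Omega> = {}" "0 < s" "s \<le> r"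
  shows "\<exists>y'. dist p y' = s \<and> ball y' s \<inter> \<Omega> = {}"
proof -
  define y' where "y' = p + (s / r) *\<^sub>R (y - p)"
  have r: "r > 0" using assms by simp
  have 1: "dist p y' = s" using assms r by (simp add: y'_def dist_norm norm_minus_commute)
  have "y - y' = (1 - s / r) *\<^sub>R (y - p)" by (simp add: y'_def algebra_simps)
  then have "dist y y' = (1 - s / r) * r" using assms r by (simp add: dist_norm norm_minus_commute)
  also have "\<dots> = r - s" using r by (simp add: field_simps)
  finally have yy: "dist y y' = r - s" .
  have "ball y' s \<subseteq> ball y r"
  proof
    fix z assume "z \<in> ball y' s"
    then show "z \<in> ball y r" using dist_triangle[of y z y'] yy by simp
  qed
  then show ?thesis using 1 assms(2) by (intro exI[of _ y']) auto
qed

text \<open>With \<open>P\<close> the projection along \<open>\<nu>\<close>, the vector \<open>N = \<nu> - P (grad \<gamma>)\<close> is an inner normal at \<open>p\<close>. The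
  quadratic bound on \<open>\<gamma>\<close> gives \<open>(x - p) \<bullet> N + M |x - p|\<^sup>2 > 0\<close> for \<open>x\<close> in \<open>\<Omega>\<close> near \<open>p\<close>, and a larger constant
  gives it in all of \<open>\<Omega>\<close>. Completing the square, this says that \<open>x\<close> lies outside the ball with centre
  \<open>p - N / (2 M)\<close> and radius \<open>|N| / (2 M)\<close>.\<close>

lemma exterior_ball_graph:
  fixes \<Omega> :: "'a::euclidean_space set"
  assumes op: "open \<Omega>" and r: "r > 0" and \<nu>: "norm \<nu> = 1" and \<gamma>: "Ck_on 2 UNIV \<gamma>"
    and gr: "\<Omega> \<inter> ball x0 r = {x \<in> ball x0 r. x \<bullet> \<nu> > \<gamma> (x - (x \<bullet> \<nu>) *\<^sub>R \<nu>)}"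
  obtains s where "s > 0" "\<forall>p\<in>frontier \<Omega> \<inter> ball x0 (r / 2). \<exists>y. dist p y = s \<and> ball y s \<inter> \<Omega> = {}"
proof -
  define P where "P = (\<lambda>x. x - (x \<bullet> \<nu>) *\<^sub>R \<nu>)"
  have \<nu>\<nu>: "\<nu> \<bullet> \<nu> = 1" using \<nu> by (simp add: norm_eq_1)
  have Pdiff: "P x - P y = P (x - y)" for x y by (simp add: P_def inner_diff_left algebra_simps)
  have Psym: "P x \<bullet> y = x \<bullet> P y" for x y by (simp add: P_def inner_diff_left inner_diff_right inner_commute)
  have Pnu: "P x \<bullet> \<nu> = 0" for x by (simp add: P_def inner_diff_left \<nu>\<nu>)
  have Pnorm: "norm (P x) \<le> norm x" for x
  proof -
    have "x \<bullet> x = P x \<bullet> P x + (x \<bullet> \<nu>)\<^sup>2"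
      by (simp add: P_def inner_diff_left inner_diff_right \<nu>\<nu> power2_eq_square inner_commute)
    then show ?thesis unfolding norm_le by simp
  qed
  have mem: "x \<in> \<Omega> \<longleftrightarrow> x \<bullet> \<nu> > \<gamma> (P x)" if "x \<in> ball x0 r" for x
    using eqset_imp_iff[OF gr, of x] that by (simp add: P_def)
  let ?K = "cball (P x0) r"
  have PK: "P x \<in> ?K" if "x \<in> ball x0 r" for x
    using that Pnorm[of "x0 - x"] Pdiff[of x0 x] by (simp add: dist_norm)
  obtain G M B where GM: "\<forall>u\<in>?K. \<forall>w\<in>?K. \<gamma> w \<ge> \<gamma> u + G u \<bullet> (w - u) - M * (norm (w - u))\<^sup>2"
    and GB: "\<forall>u\<in>?K. norm (G u) \<le> B" and M: "M > 0" and B: "B > 0"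
    by (rule C2_bounds_on_compact[OF \<gamma> compact_cball convex_cball])
  \<comment> \<open>The second summand handles points at distance at least \<open>r / 2\<close> from \<open>p\<close>, where the linear term is
     dominated by the quadratic one.\<close>
  define M' where "M' = M + (1 + B) * (2 / r)"
  have M': "M' > 0" using M B r by (simp add: M'_def add_pos_nonneg)
  have "\<exists>y. dist p y = 1 / (2 * M') \<and> ball y (1 / (2 * M')) \<inter> \<Omega> = {}"
    if p: "p \<in> frontier \<Omega>" "p \<in> ball x0 (r / 2)" for p
  proof -
    define N where "N = \<nu> - P (G (P p))"
    have pr: "p \<in> ball x0 r" using p(2) r by (auto intro: less_le_trans)
    have np: "p \<notin> \<Omega>" using p(1) op by (simp add: frontier_def interior_open)
    then have pg: "p \<bullet> \<nu> \<le> \<gamma> (P p)" using mem[OF pr] by simp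
    have N1: "norm N \<ge> 1"
    proof -
      have "N \<bullet> \<nu> = 1" by (simp add: N_def inner_diff_left \<nu>\<nu> Pnu)
      then show ?thesis using Cauchy_Schwarz_ineq2[of N \<nu>] \<nu> by simp
    qed
    have NB: "norm N \<le> 1 + B"
      using norm_triangle_ineq4[of \<nu> "P (G (P p))"] Pnorm[of "G (P p)"] bspec[OF GB PK[OF pr]] \<nu> by (simp add: N_def)
    have pos: "(x - p) \<bullet> N + M' * (norm (x - p))\<^sup>2 > 0" if x: "x \<in> \<Omega>" for x
    proof (cases "x \<in> ball x0 r")
      case True
      have "x \<bullet> \<nu> > \<gamma> (P x)" using mem[OF True] x by simp
      moreover have "\<gamma> (P x) \<ge> \<gamma> (P p) + G (P p) \<bullet> (P x - P p) - M * (norm (P x - P p))\<^sup>2"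
        by (rule GM[rule_format, OF PK[OF pr] PK[OF True]])
      moreover have "M * (norm (P x - P p))\<^sup>2 \<le> M' * (norm (x - p))\<^sup>2"
        unfolding Pdiff using Pnorm[of "x - p"] M B r
        by (intro mult_mono power_mono) (auto simp: M'_def)
      moreover have "(x - p) \<bullet> N = x \<bullet> \<nu> - p \<bullet> \<nu> - G (P p) \<bullet> (P x - P p)"
      proof -
        have "(x - p) \<bullet> P (G (P p)) = G (P p) \<bullet> P (x - p)"
          using Psym[of "G (P p)" "x - p"] by (metis inner_commute)
        then show ?thesis by (simp only: N_def inner_diff_right inner_diff_left Pdiff)
      qed
      ultimately show ?thesis using pg by linarith
    next
      case False
      then have far: "norm (x - p) \<ge> r / 2"
        using p(2) dist_triangle[of x0 x p] by (simp add: dist_norm norm_minus_commute)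
      have "\<bar>(x - p) \<bullet> N\<bar> \<le> norm (x - p) * (1 + B)"
        by (rule order_trans[OF Cauchy_Schwarz_ineq2]) (intro mult_left_mono NB norm_ge_zero)
      also have "\<dots> \<le> norm (x - p) * (1 + B) * (2 / r * norm (x - p))"
      proof -
        have "1 \<le> 2 / r * norm (x - p)" using far r by (simp add: field_simps)
        from mult_left_mono[OF this, of "norm (x - p) * (1 + B)"] show ?thesis using B by simp
      qed
      also have "\<dots> = (1 + B) * (2 / r) * (norm (x - p))\<^sup>2" by (simp add: power2_eq_square)
      also have "\<dots> < M' * (norm (x - p))\<^sup>2"
        using far r M by (intro mult_strict_right_mono) (auto simp: M'_def)
      finally show ?thesis by linarith
    qed
    define y where "y = p - (1 / (2 * M')) *\<^sub>R N"
    define R where "R = norm N / (2 * M')"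
    have py: "dist p y = R" using M' by (simp add: y_def R_def dist_norm)
    have "x \<notin> ball y R" if "x \<in> \<Omega>" for x
    proof -
      have expand: "(norm (v + c *\<^sub>R N))\<^sup>2 = (norm v)\<^sup>2 + 2 * c * (v \<bullet> N) + (c * norm N)\<^sup>2" for v c
        unfolding power_mult_distrib power2_norm_eq_inner
        by (simp add: inner_add_left inner_add_right inner_commute[of N v] power2_eq_square distrib_left mult.assoc)
      have "x - y = (x - p) + (1 / (2 * M')) *\<^sub>R N" by (simp add: y_def)
      then have "(norm (x - y))\<^sup>2 = (norm (x - p))\<^sup>2 + (1 / M') * ((x - p) \<bullet> N) + R\<^sup>2"
        by (simp only: expand) (simp add: R_def)
      also have "(norm (x - p))\<^sup>2 + (1 / M') * ((x - p) \<bullet> N) = (1 / M') * ((x - p) \<bullet> N + M' * (norm (x - p))\<^sup>2)"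
        using M' by (simp add: field_simps)
      finally have "R\<^sup>2 < (norm (x - y))\<^sup>2" using pos[OF that] M' by simp
      then have "R < norm (x - y)" by (rule power_less_imp_less_base) simp
      then show ?thesis by (simp add: dist_norm norm_minus_commute)
    qed
    then have "ball y R \<inter> \<Omega> = {}" by blast
    moreover have "1 / (2 * M') \<le> R" using N1 M' by (simp add: R_def divide_right_mono)
    moreover have "0 < 1 / (2 * M')" using M' by simp
    ultimately show ?thesis by (intro smaller_exterior_ball[OF py])
  qed
  then have "\<forall>p\<in>frontier \<Omega> \<inter> ball x0 (r / 2). \<exists>y. dist p y = 1 / (2 * M') \<and> ball y (1 / (2 * M')) \<inter> \<Omega> = {}"
    by blast
  then show ?thesis by (rule that[rotated]) (use M' in simp)
qed

lemma smooth_bounded_domain_exterior_ball: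
  fixes \<Omega> :: "'a::euclidean_space set"
  assumes "smooth_bounded_domain \<Omega>"
  obtains r where "exterior_ball_domain \<Omega> r"
proof -
  have op: "open \<Omega>" and bd: "bounded \<Omega>"
    using assms by (auto simp: smooth_bounded_domain_def)
  define Q where "Q = (\<lambda>x0 \<rho> t. \<forall>p\<in>frontier \<Omega> \<inter> ball x0 \<rho>. \<exists>y. dist p y = t \<and> ball y t \<inter> \<Omega> = {})"
  have "\<exists>z. fst z > 0 \<and> snd z > 0 \<and> Q x0 (fst z) (snd z)" if x0: "x0 \<in> frontier \<Omega>" for x0
  proof -
    have "\<exists>r>0. \<exists>\<nu> \<gamma>. norm \<nu> = 1 \<and> Cinf_on UNIV \<gamma> \<and>
        \<Omega> \<inter> ball x0 r = {x \<in> ball x0 r. x \<bullet> \<nu> > \<gamma> (x - (x \<bullet> \<nu>) *\<^sub>R \<nu>)}"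
      using assms x0 unfolding smooth_bounded_domain_def by (elim conjE) (erule bspec)
    then obtain r \<nu> \<gamma> where *: "r > 0" "norm \<nu> = 1" "Cinf_on UNIV \<gamma>"
      "\<Omega> \<inter> ball x0 r = {x \<in> ball x0 r. x \<bullet> \<nu> > \<gamma> (x - (x \<bullet> \<nu>) *\<^sub>R \<nu>)}"
      by (elim exE conjE)
    have "Ck_on 2 UNIV \<gamma>" using *(3) unfolding Cinf_on_def by (rule spec)
    then obtain t where t: "t > 0" "\<forall>p\<in>frontier \<Omega> \<inter> ball x0 (r / 2). \<exists>y. dist p y = t \<and> ball y t \<inter> \<Omega> = {}"
      by (rule exterior_ball_graph[OF op *(1,2) _ *(4)])
    show ?thesis
      by (rule exI[of _ "(r / 2, t)"]) (use *(1) t in \<open>simp add: Q_def\<close>)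
  qed
  then have "\<exists>f. \<forall>x0\<in>frontier \<Omega>. fst (f x0) > 0 \<and> snd (f x0) > 0 \<and> Q x0 (fst (f x0)) (snd (f x0))"
    by (intro bchoice ballI)
  then obtain f where f: "\<forall>x0\<in>frontier \<Omega>. fst (f x0) > 0 \<and> snd (f x0) > 0 \<and> Q x0 (fst (f x0)) (snd (f x0))" ..
  define r where "r = (\<lambda>x0. fst (f x0))"
  define s where "s = (\<lambda>x0. snd (f x0))"
  have rs: "r x0 > 0" "s x0 > 0" "Q x0 (r x0) (s x0)" if "x0 \<in> frontier \<Omega>" for x0
    using f that by (simp_all add: r_def s_def)
  have cpt: "compact (frontier \<Omega>)" by (rule compact_frontier_bounded[OF bd])
  have cov: "frontier \<Omega> \<subseteq> (\<Union>x0\<in>frontier \<Omega>. ball x0 (r x0))" using rs(1) by auto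
  obtain C where C: "C \<subseteq> frontier \<Omega>" "finite C" "frontier \<Omega> \<subseteq> (\<Union>x0\<in>C. ball x0 (r x0))"
    by (rule compactE_image[OF cpt _ cov]) auto
  define t where "t = Min (insert 1 (s ` C))"
  have t: "t > 0" using C rs(2) by (auto simp: t_def)
  have "\<exists>y. dist p y = t \<and> ball y t \<inter> \<Omega> = {}" if p: "p \<in> frontier \<Omega>" for p
  proof -
    obtain x0 where x0: "x0 \<in> C" "p \<in> ball x0 (r x0)" using C(3) p by blast
    then obtain y where "dist p y = s x0" "ball y (s x0) \<inter> \<Omega> = {}"
      using rs(3)[of x0] C(1) p unfolding Q_def by blast
    moreover have "t \<le> s x0" unfolding t_def using C(2) x0 by (intro Min_le) auto
    ultimately show ?thesis by (intro smaller_exterior_ball[OF _ _ t])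
  qed
  then have "exterior_ball_domain \<Omega> t" using op bd t by unfold_locales
  then show ?thesis by (rule that)
qed

section \<open>The uniqueness theorem\<close>

lemma potential_nonneg:
  assumes "\<And>i. i \<in> {1..p} \<Longrightarrow> b i > 0"
  shows "0 \<le> potential p a m b x"
  unfolding potential_def using assms by (intro sum_nonneg divide_nonneg_nonneg) (auto intro: less_imp_le)

lemma potential_measurable [measurable]: "potential p a m b \<in> borel_measurable borel"
  unfolding potential_def[abs_def] by measurable

lemma potential_inverse_square:
  assumes b: "\<And>i. i \<in> {1..p} \<Longrightarrow> b i > 0" and i: "i \<in> {1..p}" "m i \<ge> 2"
    and y: "y \<noteq> a i" "norm (y - a i) \<le> 1"
  shows "b i / (norm (y - a i))\<^sup>2 \<le> potential p a m b y"
proof -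
  have n: "norm (y - a i) > 0" using y(1) by simp
  have "norm (y - a i) powr m i \<le> norm (y - a i) powr 2"
    using i y n by (intro powr_mono') auto
  then have "b i / (norm (y - a i))\<^sup>2 \<le> b i / norm (y - a i) powr m i"
    using n b[OF i(1)] by (intro divide_left_mono) (auto simp: powr_numeral)
  also have "\<dots> \<le> potential p a m b y"
    unfolding potential_def
    by (rule member_le_sum[where f = "\<lambda>i. b i / norm (y - a i) powr m i"])
       (use i b in \<open>auto intro!: divide_nonneg_nonneg intro: less_imp_le\<close>)
  finally show ?thesis .
qed

text \<open>Fubini's theorem and the measurability of convolutions are used for Borel functions on the whole space, so
  \<open>w\<close> is replaced by a Borel function that vanishes off \<open>\<Omega>\<close>.\<close>

lemma lebesgue_on_borel_representative:
  fixes w :: "'a::euclidean_space \<Rightarrow> real"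
  assumes \<Omega>[measurable]: "\<Omega> \<in> sets borel" and w: "integrable (lebesgue_on \<Omega>) w"
  obtains u where "integrable lborel u" "\<forall>x. x \<notin> \<Omega> \<longrightarrow> u x = 0" "AE x in lebesgue. indicator \<Omega> x * w x = u x"
proof -
  have \<Omega>': "\<Omega> \<inter> space lebesgue \<in> sets lebesgue" by simp
  have iw: "integrable lebesgue (\<lambda>x. indicator \<Omega> x * w x)"
    using w by (subst (asm) integrable_restrict_space[OF \<Omega>']) simp
  then obtain w0 where w0[measurable]: "w0 \<in> borel_measurable lborel" and ae: "AE x in lborel. indicator \<Omega> x * w x = w0 x"
    using completion_ex_borel_measurable_real[of "\<lambda>x. indicator \<Omega> x * w x" lborel] by auto
  define u where "u = (\<lambda>x. indicator \<Omega> x * w0 x)"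
  have [measurable]: "u \<in> borel_measurable lborel" unfolding u_def by measurable
  have "AE x in lborel. indicator \<Omega> x * w x = u x"
    using ae by eventually_elim (auto simp: u_def indicator_def split: if_splits)
  then have ae': "AE x in lebesgue. indicator \<Omega> x * w x = u x" by (rule AE_completion)
  have "integrable lebesgue u"
    using iw by (rule integrable_cong_AE_imp) (use ae' in \<open>auto intro: measurable_completion elim: eventually_mono\<close>)
  then have "integrable lborel u" by (simp add: integrable_completion)
  then show ?thesis using ae' by (intro that[of u]) (auto simp: u_def)
qed

text \<open>The map \<open>h\<close> allows the same statement to serve for integrals of \<open>w\<close> and of \<open>|w|\<close>.\<close>

lemma integral_lebesgue_on_representative:
  fixes w u F :: "'a::euclidean_space \<Rightarrow> real"
  assumes [measurable]: "S \<in> sets borel" "F \<in> borel_measurable borel" "u \<in> borel_measurable borel"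
    and ae: "AE x in lebesgue. indicator \<Omega> x * w x = u x" and S: "S \<subseteq> \<Omega>"
    and hm: "h \<in> borel_measurable borel"
    and w: "(\<lambda>x. indicator \<Omega> x * w x) \<in> borel_measurable lebesgue"
  shows "integral\<^sup>L (lebesgue_on S) (\<lambda>x. h (w x) * F x) = (\<integral>x. indicator S x * (h (u x) * F x) \<partial>lborel)"
proof -
  have S': "S \<inter> space lebesgue \<in> sets lebesgue" by simp
  have uh: "(\<lambda>x. h (u x)) \<in> borel_measurable borel" 
    using measurable_compose[OF \<open>u \<in> borel_measurable borel\<close> hm] .
  have wh: "(\<lambda>x. h (indicator \<Omega> x * w x)) \<in> borel_measurable lebesgue"
    using measurable_compose[OF w hm] .
  have mF: "(\<lambda>x. indicator S x * F x) \<in> borel_measurable lebesgue"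
    by (rule measurable_completion) measurable
  have eq: "indicator S x * (h (w x) * F x) = h (indicator \<Omega> x * w x) * (indicator S x * F x)" for x
    using S by (auto simp: indicator_def)
  have "integral\<^sup>L (lebesgue_on S) (\<lambda>x. h (w x) * F x) = (\<integral>x. indicator S x * (h (w x) * F x) \<partial>lebesgue)"
    by (subst integral_restrict_space[OF S']) simp
  also have "\<dots> = (\<integral>x. indicator S x * (h (u x) * F x) \<partial>lebesgue)"
  proof (rule integral_cong_AE)
    show "(\<lambda>x. indicator S x * (h (w x) * F x)) \<in> borel_measurable lebesgue"
      unfolding eq by (intro borel_measurable_times wh mF)
    show "(\<lambda>x. indicator S x * (h (u x) * F x)) \<in> borel_measurable lebesgue"
      by (rule measurable_completion) (use uh in measurable)
    show "AE x in lebesgue. indicator S x * (h (w x) * F x) = indicator S x * (h (u x) * F x)"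
      using ae by eventually_elim (use S in \<open>auto simp: indicator_def split: if_splits\<close>)
  qed
  also have "\<dots> = (\<integral>x. indicator S x * (h (u x) * F x) \<partial>lborel)"
    by (rule integral_completion) (use uh in measurable)
  finally show ?thesis .
qed

theorem mainTheorem2:
  fixes \<Omega> :: "(real ^ 'n) set"
    and p :: nat
    and a :: "nat \<Rightarrow> real ^ 'n"
    and m b :: "nat \<Rightarrow> real"
    and w :: "real ^ 'n \<Rightarrow> real"
  assumes "smooth_bounded_domain \<Omega>"
    and "p \<ge> 1"
    and "\<And>i. i \<in> {1..p} \<Longrightarrow> a i \<in> \<Omega>"
    and "\<And>i. i \<in> {1..p} \<Longrightarrow> m i \<ge> 0"
    and "\<And>i. i \<in> {1..p} \<Longrightarrow> b i > 0"
    and "w \<in> L1_weighted \<Omega> (potential p a m b) \<inter> L1_0 \<Omega>"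
    and "\<And>\<phi>. \<phi> \<in> Ck_compact_support 2 (\<Omega> - very_singular_points p a m) \<Longrightarrow>
           integral\<^sup>L (lebesgue_on \<Omega>)
             (\<lambda>x. w x * (- laplacian \<phi> x + potential p a m b x * \<phi> x)) = 0"
  shows "AE x in lebesgue_on \<Omega>. w x = 0"
proof -
  obtain r where "exterior_ball_domain \<Omega> r"
    by (rule smooth_bounded_domain_exterior_ball[OF assms(1)])
  then interpret exterior_ball_domain \<Omega> r .
  define V where "V = potential p a m b"
  define J where "J = {i \<in> {1..p}. m i \<ge> 2}"
  have J: "finite J" "very_singular_points p a m = a ` J"
    by (auto simp: J_def very_singular_points_def)
  have V0: "0 \<le> V x" for x unfolding V_def by (rule potential_nonneg) (rule assms(5))
  have [measurable]: "V \<in> borel_measurable borel" unfolding V_def by measurable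
  have \<Omega>m[measurable]: "\<Omega> \<in> sets borel" using op by simp
  have \<Omega>': "\<Omega> \<inter> space lebesgue \<in> sets lebesgue" by simp
  have wi: "integrable (lebesgue_on \<Omega>) w"
    and wV: "(\<integral>\<^sup>+x. ennreal (\<bar>w x\<bar> * V x) \<partial>(lebesgue_on \<Omega>)) < \<infinity>"
    and wd: "((\<lambda>\<epsilon>. 1 / \<epsilon> * integral\<^sup>L (lebesgue_on {x \<in> \<Omega>. infdist x (frontier \<Omega>) \<le> \<epsilon>}) (\<lambda>x. \<bar>w x\<bar>)) \<longlongrightarrow> 0) (at_right 0)"
    using assms(6) by (auto simp: L1_0_def L1_weighted_def V_def)
  obtain u where u: "integrable lborel u" "\<forall>x. x \<notin> \<Omega> \<longrightarrow> u x = 0" and ae: "AE x in lebesgue. indicator \<Omega> x * w x = u x"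
    by (rule lebesgue_on_borel_representative[OF \<Omega>m wi])
  have [measurable]: "u \<in> borel_measurable borel" using u(1) by auto
  have wm: "(\<lambda>x. indicator \<Omega> x * w x) \<in> borel_measurable lebesgue"
    using wi by (subst (asm) integrable_restrict_space[OF \<Omega>']) auto
  have Vu: "integrable lborel (\<lambda>x. V x * u x)"
  proof (rule integrableI_bounded)
    have "(\<integral>\<^sup>+x. ennreal (norm (V x * u x)) \<partial>lborel) = (\<integral>\<^sup>+x. ennreal (norm (V x * u x)) \<partial>lebesgue)"
      by (simp add: nn_integral_completion)
    also have "\<dots> = (\<integral>\<^sup>+x. ennreal (\<bar>w x\<bar> * V x) * indicator \<Omega> x \<partial>lebesgue)"
      by (rule nn_integral_cong_AE) (use ae in eventually_elim, use V0 in \<open>auto simp: indicator_def abs_mult mult.commute split: if_splits\<close>)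
    also have "\<dots> = (\<integral>\<^sup>+x. ennreal (\<bar>w x\<bar> * V x) \<partial>(lebesgue_on \<Omega>))"
      by (rule nn_integral_restrict_space[OF \<Omega>', symmetric])
    finally show "(\<integral>\<^sup>+x. ennreal (norm (V x * u x)) \<partial>lborel) < \<infinity>" using wV by simp
  qed measurable
  have transfer: "(\<integral>x. u x * F x \<partial>lborel) = integral\<^sup>L (lebesgue_on \<Omega>) (\<lambda>x. w x * F x)"
    if [measurable]: "F \<in> borel_measurable borel" for F
  proof -
    have "integral\<^sup>L (lebesgue_on \<Omega>) (\<lambda>x. w x * F x) = (\<integral>x. indicator \<Omega> x * (u x * F x) \<partial>lborel)"
      by (rule integral_lebesgue_on_representative[OF \<Omega>m that _ ae _ _ wm, where h = "\<lambda>x. x"]) auto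
    also have "\<dots> = (\<integral>x. u x * F x \<partial>lborel)"
      using u(2) by (intro Bochner_Integration.integral_cong) (auto simp: indicator_def)
    finally show ?thesis by simp
  qed
  have test: "(\<integral>x. u x * (- laplacian \<phi> x + V x * \<phi> x) \<partial>lborel) = 0"
    if "\<phi> \<in> Ck_compact_support 2 (\<Omega> - a ` J)" and [measurable]: "\<phi> \<in> borel_measurable borel" "laplacian \<phi> \<in> borel_measurable borel" for \<phi>
    using assms(7)[of \<phi>] that(1) by (subst transfer) (auto simp: J(2) V_def)
  define b0 where "b0 = Min (insert 1 (b ` J))"
  have b0: "b0 > 0" using J(1) assms(5) by (auto simp: b0_def J_def)
  have bV: "b0 / (norm (y - a i))\<^sup>2 \<le> V y" if "i \<in> J" "y \<noteq> a i" "norm (y - a i) \<le> 1" for i y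
  proof -
    have "b0 \<le> b i" unfolding b0_def using J(1) that(1) by (intro Min_le) auto
    then have "b0 / (norm (y - a i))\<^sup>2 \<le> b i / (norm (y - a i))\<^sup>2" by (rule divide_right_mono) simp
    also have "\<dots> \<le> V y"
      unfolding V_def by (rule potential_inverse_square[OF assms(5)]) (use that in \<open>auto simp: J_def\<close>)
    finally show ?thesis .
  qed
  have weak: "conv u (lmoll \<eta>) x = conv (\<lambda>y. V y * u y) (moll \<eta>) x" if "\<eta> > 0" "cball x \<eta> \<subseteq> \<Omega>" for x \<eta>
    unfolding conv_def
    by (rule remove_singularities[OF J(1) u(1) Vu _ V0 b0 bV test that(2,1)]) measurable
  have decay: "((\<lambda>\<epsilon>. 1 / \<epsilon> * (\<integral>x. \<bar>u x\<bar> * indicator {x. \<delta> x \<le> \<epsilon>} x \<partial>lborel)) \<longlongrightarrow> 0) (at_right 0)"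
  proof (rule tendsto_sandwich[OF _ _ tendsto_const wd])
    show "\<forall>\<^sub>F \<epsilon> in at_right 0. 0 \<le> 1 / \<epsilon> * (\<integral>x. \<bar>u x\<bar> * indicator {x. \<delta> x \<le> \<epsilon>} x \<partial>lborel)"
      using eventually_at_right_less[of "0::real"]
      by eventually_elim (auto intro!: divide_nonneg_pos integral_nonneg_AE)
    show "\<forall>\<^sub>F \<epsilon> in at_right 0. 1 / \<epsilon> * (\<integral>x. \<bar>u x\<bar> * indicator {x. \<delta> x \<le> \<epsilon>} x \<partial>lborel)
        \<le> 1 / \<epsilon> * integral\<^sup>L (lebesgue_on {x \<in> \<Omega>. infdist x (frontier \<Omega>) \<le> \<epsilon>}) (\<lambda>x. \<bar>w x\<bar>)"
      using eventually_at_right_less[of "0::real"]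
    proof eventually_elim
      fix \<epsilon> :: real assume "0 < \<epsilon>"
      let ?S = "{x \<in> \<Omega>. infdist x (frontier \<Omega>) \<le> \<epsilon>}"
      have "closed {x. infdist x (frontier \<Omega>) \<le> \<epsilon>}"
        by (intro closed_Collect_le continuous_intros)
      then have "\<Omega> \<inter> {x. infdist x (frontier \<Omega>) \<le> \<epsilon>} \<in> sets borel" by measurable
      then have S[measurable]: "?S \<in> sets borel" by (simp add: Int_def)
      have "integral\<^sup>L (lebesgue_on ?S) (\<lambda>x. \<bar>w x\<bar> * 1) = (\<integral>x. indicator ?S x * (\<bar>u x\<bar> * 1) \<partial>lborel)"
        by (rule integral_lebesgue_on_representative[OF S _ _ ae _ _ wm]) auto
      moreover have "(\<integral>x. \<bar>u x\<bar> * indicator {x. \<delta> x \<le> \<epsilon>} x \<partial>lborel) \<le> (\<integral>x. indicator ?S x * (\<bar>u x\<bar> * 1) \<partial>lborel)"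
      proof (rule integral_mono)
        show "integrable lborel (\<lambda>x. \<bar>u x\<bar> * indicator {x. \<delta> x \<le> \<epsilon>} x)"
          by (rule Bochner_Integration.integrable_bound[OF u(1)]) (auto simp: indicator_def)
        show "integrable lborel (\<lambda>x. indicator ?S x * (\<bar>u x\<bar> * 1))"
          using integrable_mult_indicator[OF _ integrable_abs[OF u(1)], of ?S] by simp
        fix x
        show "\<bar>u x\<bar> * indicator {x. \<delta> x \<le> \<epsilon>} x \<le> indicator ?S x * (\<bar>u x\<bar> * 1)"
        proof (cases "x \<in> \<Omega> \<and> \<delta> x \<le> \<epsilon>")
          case True
          then obtain q where "q \<in> frontier \<Omega>" "dist x q = \<delta> x" using \<delta>_frontier by blast
          then have "infdist x (frontier \<Omega>) \<le> \<delta> x" using infdist_le[of q "frontier \<Omega>" x] by simp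
          then show ?thesis using True by simp
        qed (use u(2) in \<open>auto simp: indicator_def\<close>)
      qed
      ultimately show "1 / \<epsilon> * (\<integral>x. \<bar>u x\<bar> * indicator {x. \<delta> x \<le> \<epsilon>} x \<partial>lborel)
        \<le> 1 / \<epsilon> * integral\<^sup>L (lebesgue_on ?S) (\<lambda>x. \<bar>w x\<bar>)"
        using \<open>0 < \<epsilon>\<close> by (intro mult_left_mono) auto
    qed
  qed
  have "AE x in lborel. u x = 0"
    by (rule kato_uniqueness[OF u(1) Vu _ refl V0 weak decay]) (use u(2) in auto)
  then have "AE x in lebesgue. u x = 0" by (rule AE_completion)
  with ae have "AE x in lebesgue. x \<in> \<Omega> \<longrightarrow> w x = 0"
    by eventually_elim (auto simp: indicator_def split: if_splits)
  then show ?thesis by (subst AE_restrict_space_iff[OF \<Omega>'])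
qed

end
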